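(* Assume there are constants $0<\delta\le M$ with $-M\le\Delta(t)\le-\delta$ for all $t\in[0,T_1]$, and let $z^*$ be the boundary function with $\mathcal C=\{z>z^*(t)\}$ if $0<\gamma<1$ and $\mathcal C=\{z<z^*(t)\}$ if $\gamma>1$. Then for every $t\in[0,T_1)$: if $\gamma>1$, $$\tilde{\mathbb E}\Big[\int_t^{T_1}e^{\vartheta(u-t)}\big(1+\Delta(u)(\mu^T(u)Z^{t,z^*(t)}(u))^{-\tilde\gamma}\big)1_{\{Z^{t,z^*(t)}(u)<z^*(u)\}}du\Big]=0;$$ if $0<\gamma<1$, the same identity holds with the indicator $1_{\{Z^{t,z^*(t)}(u)>z^*(u)\}}$. In either case $\lim_{t\to T_1-}z^*(t)=(-\Delta(T_1))^{1/\tilde\gamma}\mu^T(T_1)^{-1}$.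
   Context: Setting: a filtered probability space with the usual conditions carrying a standard Brownian motion $B$; $0<T_1<T<\infty$; constants $r,\mu,\sigma,\rho,\mu_w,\sigma_w,\alpha,\beta>0$, $\kappa=(\mu-r)/\sigma$; $\xi(t)=\exp(-\kappa B(t)-(\kappa^2/2+r)t)$, $\xi^t(s)=\xi(s)/\xi(t)$; $\mathcal W^{t,w}(s)=w\exp((\mu_w-\sigma_w^2/2)(s-t)+\sigma_w(B(s)-B(t)))$; $\vartheta=-r+\mu_w-\kappa\sigma_w<0$; $q(s)=(e^{\vartheta(T_1-s)}-1)/\vartheta$; $p^T(s)=\int_s^T e^{(\alpha-\beta-r)(u-s)}du$, $\mu^T=1+\alpha p^T$; $Y^{t,y}(s)=ye^{\rho(s-t)}\xi^t(s)$. Power utilities: $\gamma>0,\gamma\neq1$, $K:[0,T]\to(0,\infty)$ smooth, $U_1(t,x)=x^{1-\gamma}/(1-\gamma)$, $U_2(t,x)=K(t)x^{1-\gamma}/(1-\gamma)$; $\tilde\gamma=(1-\gamma)/\gamma$; $\Delta(t)=(1-K(t)^{1/\gamma})/\tilde\gamma$. $\hat V_i(t,y)=\sup_{c>0}\{U_i(t,c)-y\mu^T(t)c\}$; $\tilde V(t,y)=\mathbb E\int_t^Te^{-\rho(u-t)}\hat V_2(u,Y^{t,y}(u))du$. Measure change: $\mathcal E(t)=\exp(-\frac12(\sigma_w-\kappa)^2t+(\sigma_w-\kappa)B(t))$, $d\tilde{\mathbb P}=\mathcal E(T_1)d\mathbb P$, $\tilde{\mathbb E}$ its expectation. For $z>0$,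 $Z^{t,z}(s)=z\,(Y^{t,1}(s))^{1/(1-\gamma)}(\mathcal W^{t,1}(s))^{\gamma/(1-\gamma)}$. Reduced problem $\tilde w(t,z)=\sup_{\tau}\tilde{\mathbb E}\big[\int_t^\tau e^{\vartheta(u-t)}\hat V_1(u,Z^{t,z}(u))du+e^{\vartheta(\tau-t)}(\tilde V(\tau,Z^{t,z}(\tau))-q(\tau))\big]$ over stopping times $t\le\tau\le T_1$. Continuation region $\mathcal C=\{(t,z)\in[0,T_1)\times(0,\infty):\tilde w(t,z)>\tilde V(t,z)-q(t)\}$. *)

theory Defs
  imports "HOL-Probability.Probability"
begin

definition usual_filtration :: "'a measure \<Rightarrow> (real \<Rightarrow> 'a measure) \<Rightarrow> bool" where
  "usual_filtration M F \<longleftrightarrow>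
     filtration (space M) F \<and>
     (\<forall>t. sets (F t) \<subseteq> sets M) \<and>
     (\<forall>t. sets (F t) = (\<Inter>s\<in>{t<..}. sets (F s))) \<and>
     (\<forall>N. N \<subseteq> space M \<and> (\<exists>A\<in>null_sets M. N \<subseteq> A) \<longrightarrow> N \<in> sets (F 0))"

definition brownian_motion :: "'a measure \<Rightarrow> (real \<Rightarrow> 'a measure) \<Rightarrow> (real \<Rightarrow> 'a \<Rightarrow> real) \<Rightarrow> bool" where
  "brownian_motion M F B \<longleftrightarrow>
     (\<forall>\<omega>\<in>space M. B 0 \<omega> = 0) \<and>
     (\<forall>\<omega>\<in>space M. continuous_on {0..} (\<lambda>t. B t \<omega>)) \<and>
     (\<forall>t\<ge>0. B t \<in> borel_measurable (F t)) \<and>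
     (\<forall>s t. 0 \<le> s \<and> s < t \<longrightarrow>
        prob_space.indep_set M (sets (F s))
          {(\<lambda>\<omega>. B t \<omega> - B s \<omega>) -` A \<inter> space M | A. A \<in> sets borel} \<and>
        distributed M lborel (\<lambda>\<omega>. B t \<omega> - B s \<omega>) (\<lambda>x. ennreal (normal_density 0 (sqrt (t - s)) x)))"

definition smooth_on :: "real set \<Rightarrow> (real \<Rightarrow> real) \<Rightarrow> bool" where
  "smooth_on S f \<longleftrightarrow> (\<exists>D :: nat \<Rightarrow> real \<Rightarrow> real. (\<forall>x\<in>S. D 0 x = f x) \<and>
      (\<forall>n. \<forall>x\<in>S. (D n has_real_derivative D (Suc n) x) (at x within S)))"

definition kappa :: "real \<Rightarrow> real \<Rightarrow> real \<Rightarrow> real" where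
  "kappa \<mu> r \<sigma> = (\<mu> - r) / \<sigma>"

definition xi :: "real \<Rightarrow> real \<Rightarrow> (real \<Rightarrow> 'a \<Rightarrow> real) \<Rightarrow> real \<Rightarrow> 'a \<Rightarrow> real" where
  "xi \<kappa> r B t \<omega> = exp (- \<kappa> * B t \<omega> - (\<kappa>\<^sup>2 / 2 + r) * t)"

definition xi_from :: "real \<Rightarrow> real \<Rightarrow> (real \<Rightarrow> 'a \<Rightarrow> real) \<Rightarrow> real \<Rightarrow> real \<Rightarrow> 'a \<Rightarrow> real" where
  "xi_from \<kappa> r B t s \<omega> = xi \<kappa> r B s \<omega> / xi \<kappa> r B t \<omega>"

definition Wproc :: "real \<Rightarrow> real \<Rightarrow> (real \<Rightarrow> 'a \<Rightarrow> real) \<Rightarrow> real \<Rightarrow> real \<Rightarrow> real \<Rightarrow> 'a \<Rightarrow> real" where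
  "Wproc \<mu>w \<sigma>w B t w s \<omega> = w * exp ((\<mu>w - \<sigma>w\<^sup>2 / 2) * (s - t) + \<sigma>w * (B s \<omega> - B t \<omega>))"

definition theta :: "real \<Rightarrow> real \<Rightarrow> real \<Rightarrow> real \<Rightarrow> real" where
  "theta r \<mu>w \<kappa> \<sigma>w = - r + \<mu>w - \<kappa> * \<sigma>w"

definition qfun :: "real \<Rightarrow> real \<Rightarrow> real \<Rightarrow> real" where
  "qfun th T1 s = (exp (th * (T1 - s)) - 1) / th"

definition pT :: "real \<Rightarrow> real \<Rightarrow> real \<Rightarrow> real \<Rightarrow> real \<Rightarrow> real" where
  "pT \<alpha> \<beta> r T s = (LBINT u=s..T. exp ((\<alpha> - \<beta> - r) * (u - s)))"

definition muT :: "real \<Rightarrow> real \<Rightarrow> real \<Rightarrow> real \<Rightarrow> real \<Rightarrow> real" where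
  "muT \<alpha> \<beta> r T s = 1 + \<alpha> * pT \<alpha> \<beta> r T s"

definition Yproc :: "real \<Rightarrow> real \<Rightarrow> real \<Rightarrow> (real \<Rightarrow> 'a \<Rightarrow> real) \<Rightarrow> real \<Rightarrow> real \<Rightarrow> real \<Rightarrow> 'a \<Rightarrow> real" where
  "Yproc \<rho> \<kappa> r B t y s \<omega> = y * exp (\<rho> * (s - t)) * xi_from \<kappa> r B t s \<omega>"

definition U1 :: "real \<Rightarrow> real \<Rightarrow> real \<Rightarrow> real" where
  "U1 \<gamma> t x = x powr (1 - \<gamma>) / (1 - \<gamma>)"

definition U2 :: "real \<Rightarrow> (real \<Rightarrow> real) \<Rightarrow> real \<Rightarrow> real \<Rightarrow> real" where
  "U2 \<gamma> K t x = K t * x powr (1 - \<gamma>) / (1 - \<gamma>)"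

definition gtilde :: "real \<Rightarrow> real" where
  "gtilde \<gamma> = (1 - \<gamma>) / \<gamma>"

definition Delta :: "real \<Rightarrow> (real \<Rightarrow> real) \<Rightarrow> real \<Rightarrow> real" where
  "Delta \<gamma> K t = (1 - K t powr (1 / \<gamma>)) / gtilde \<gamma>"

definition Vhat :: "(real \<Rightarrow> real \<Rightarrow> real) \<Rightarrow> (real \<Rightarrow> real) \<Rightarrow> real \<Rightarrow> real \<Rightarrow> real" where
  "Vhat U m t y = (SUP c\<in>{0<..}. U t c - y * m t * c)"

definition Vtilde where
  "Vtilde M B \<gamma> K \<alpha> \<beta> r T \<rho> \<kappa> t y =
     integral\<^sup>L M (\<lambda>\<omega>. LBINT u=t..T. exp (- \<rho> * (u - t)) *
        Vhat (U2 \<gamma> K) (muT \<alpha> \<beta> r T) u (Yproc \<rho> \<kappa> r B t y u \<omega>))"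

definition Ecal :: "real \<Rightarrow> real \<Rightarrow> (real \<Rightarrow> 'a \<Rightarrow> real) \<Rightarrow> real \<Rightarrow> 'a \<Rightarrow> real" where
  "Ecal \<sigma>w \<kappa> B t \<omega> = exp (- (1/2) * (\<sigma>w - \<kappa>)\<^sup>2 * t + (\<sigma>w - \<kappa>) * B t \<omega>)"

text \<open>Expectation under \<open>d\<tilde>P = Ecal(T1) dP\<close>.\<close>
definition Etilde :: "'a measure \<Rightarrow> real \<Rightarrow> real \<Rightarrow> (real \<Rightarrow> 'a \<Rightarrow> real) \<Rightarrow> real \<Rightarrow> ('a \<Rightarrow> real) \<Rightarrow> real" where
  "Etilde M \<sigma>w \<kappa> B T1 X = integral\<^sup>L M (\<lambda>\<omega>. Ecal \<sigma>w \<kappa> B T1 \<omega> * X \<omega>)"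

definition Zproc :: "real \<Rightarrow> real \<Rightarrow> real \<Rightarrow> real \<Rightarrow> real \<Rightarrow> real \<Rightarrow> (real \<Rightarrow> 'a \<Rightarrow> real)
    \<Rightarrow> real \<Rightarrow> real \<Rightarrow> real \<Rightarrow> 'a \<Rightarrow> real" where
  "Zproc \<gamma> \<rho> \<kappa> r \<mu>w \<sigma>w B t z s \<omega> =
     z * (Yproc \<rho> \<kappa> r B t 1 s \<omega>) powr (1 / (1 - \<gamma>)) * (Wproc \<mu>w \<sigma>w B t 1 s \<omega>) powr (\<gamma> / (1 - \<gamma>))"

definition wtilde where
  "wtilde M F B \<gamma> K \<alpha> \<beta> r T T1 \<rho> \<kappa> \<mu>w \<sigma>w t z =
     (let th = theta r \<mu>w \<kappa> \<sigma>w; Z = Zproc \<gamma> \<rho> \<kappa> r \<mu>w \<sigma>w B t z in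
      SUP \<tau>\<in>{\<tau>. stopping_time F \<tau> \<and> (\<forall>\<omega>\<in>space M. t \<le> \<tau> \<omega> \<and> \<tau> \<omega> \<le> T1)}.
        Etilde M \<sigma>w \<kappa> B T1 (\<lambda>\<omega>.
           (LBINT u=t..\<tau> \<omega>. exp (th * (u - t)) * Vhat (U1 \<gamma>) (muT \<alpha> \<beta> r T) u (Z u \<omega>))
           + exp (th * (\<tau> \<omega> - t)) *
             (Vtilde M B \<gamma> K \<alpha> \<beta> r T \<rho> \<kappa> (\<tau> \<omega>) (Z (\<tau> \<omega>) \<omega>) - qfun th T1 (\<tau> \<omega>))))"

definition contregion where
  "contregion M F B \<gamma> K \<alpha> \<beta> r T T1 \<rho> \<kappa> \<mu>w \<sigma>w =
     {(t, z). 0 \<le> t \<and> t < T1 \<and> 0 < z \<and>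
        wtilde M F B \<gamma> K \<alpha> \<beta> r T T1 \<rho> \<kappa> \<mu>w \<sigma>w t z >
        Vtilde M B \<gamma> K \<alpha> \<beta> r T \<rho> \<kappa> t z - qfun (theta r \<mu>w \<kappa> \<sigma>w) T1 t}"

end

theory Submission
  imports Defs
begin

text \<open>
  Put \<open>Y = - gtilde \<gamma> * ln Z - m * u\<close> for a suitable constant \<open>m\<close>. Under the changed measure \<open>exp Y\<close> is an
  exponential martingale driven by a Brownian motion, and optional stopping turns the gain of a stopping
  time \<open>\<tau>\<close> over immediate stopping into the expectation of the integral of \<open>f u (Y u)\<close> over \<open>[t, \<tau>)\<close>,
  where \<open>f u y = exp (\<theta> * u) * (1 - a u * exp y)\<close>. For both signs of \<open>gtilde \<gamma>\<close> the continuation region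
  becomes \<open>{y < ys t}\<close>.

  The problem is compared with its Bermudan versions, whose values \<open>Q\<close> are given by a backward recursion
  with Gaussian kernels. Shifting time in this recursion shows that \<open>ys t - L * t\<close> is decreasing,
  so \<open>ys\<close> is continuous up to a countable set. Summing the recursion along the path started on the
  boundary expresses the integral of \<open>f\<close> over the Bermudan continuation region as the value that re-enters
  from the stopping region. This is at most the integral of \<open>\<bar>f\<bar>\<close> over a shrinking layer above the boundary,
  up to large deviations of one increment, and it tends to 0: if the volatility is nonzero, \<open>Y\<close> has no
  atoms; if it is zero, the times at which the constant path lies on the boundary with \<open>f \<noteq> 0\<close> are
  countably many. The limit at the horizon follows from a quadratic supersolution of the recursion.
\<close>

text \<open>Nothing is known about the boundary beyond its existence, so a change-of-variable
  formula cannot be applied to the value function across it. Grids replace it: the reward is affine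
  in \<open>exp Y\<close> and \<open>exp Y\<close> is a martingale, so the reward over one grid cell
  is explicit and a Gaussian kernel does the rest; product laws stand in for conditional
  expectations. Rounding a stopping time up to the grid costs the integral of \<open>exp Y\<close>
  over a strip of width h, which is of order \<open>sqrt h\<close>. Hence strict positivity passes
  between the two problems in both directions, and strict positivity is all that the continuation
  region asks for. In the identity the re-entering value is nonnegative, so one inequality is free.
  For the other, re-entry in one step from farther than l above the boundary has a weight of order
  \<open>h^2 / l^4\<close>, and there are about \<open>1 / h\<close> steps. The width
  \<open>l = h powr (1/8)\<close> makes the total of order \<open>sqrt h\<close> while l still tends
  to 0. The constant m is the exponential growth rate of \<open>Z powr (- gtilde \<gamma>)\<close>
  under the changed measure.\<close>

section \<open>Brownian increments\<close>

text \<open>The parameter is a variance, so that \<open>gauss (u - s)\<close> is the law of a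
  Brownian increment over \<open>[s, u]\<close>.\<close>

definition gauss :: "real \<Rightarrow> real measure" where
  "gauss h = density lborel (\<lambda>x. ennreal (normal_density 0 (sqrt h) x))"

lemma sets_gauss[simp, measurable_cong]: "sets (gauss h) = sets borel"
  by (simp add: gauss_def)

lemma space_gauss[simp]: "space (gauss h) = UNIV"
  by (simp add: gauss_def)

lemma prob_space_gauss: "0 < h \<Longrightarrow> prob_space (gauss h)"
  unfolding gauss_def by (rule prob_space_normal_density) simp

text \<open>Completing the square. This is the one-dimensional Cameron-Martin identity; the
  exponential moments and the Gaussian shift in Girsanov's theorem both come from it.\<close>

lemma normal_density_exp_tilt:
  assumes "0 < h"
  shows "normal_density 0 (sqrt h) x * exp (p * x - p\<^sup>2 / 2 * h) = normal_density (p * h) (sqrt h) x"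
proof -
  have "- x\<^sup>2 / (2 * h) + (p * x - p\<^sup>2 / 2 * h) = - (x - p * h)\<^sup>2 / (2 * h)"
    using assms by (simp add: field_simps power2_eq_square)
  then show ?thesis
    using assms by (simp add: normal_density_def exp_add[symmetric] mult.assoc)
qed

lemma gauss_exp:
  assumes "0 < h"
  shows "integrable (gauss h) (\<lambda>x. exp (p * x))"
    and "(\<integral>x. exp (p * x) \<partial>gauss h) = exp (p\<^sup>2 / 2 * h)"
proof -
  have eq: "normal_density 0 (sqrt h) x * exp (p * x) = exp (p\<^sup>2 / 2 * h) * normal_density (p * h) (sqrt h) x" for x
    by (subst normal_density_exp_tilt[OF assms, symmetric]) (simp add: exp_diff)
  show "integrable (gauss h) (\<lambda>x. exp (p * x))"
    unfolding gauss_def using assms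
    by (subst integrable_density) (auto simp: eq)
  show "(\<integral>x. exp (p * x) \<partial>gauss h) = exp (p\<^sup>2 / 2 * h)"
    unfolding gauss_def using assms
    by (subst integral_density) (auto simp: eq)
qed

lemma gauss_moment:
  assumes "0 < h"
  shows "integrable (gauss h) (\<lambda>x. x ^ k)"
    and "(\<integral>x. x ^ (2 * k) \<partial>gauss h) = fact (2 * k) / (2 ^ k * fact k) * h ^ k"
    and "(\<integral>x. x \<partial>gauss h) = 0"
proof -
  show "integrable (gauss h) (\<lambda>x. x ^ k)"
    unfolding gauss_def using assms integrable_normal_moment[of "sqrt h" 0 k]
    by (subst integrable_density) auto
  show "(\<integral>x. x ^ (2 * k) \<partial>gauss h) = fact (2 * k) / (2 ^ k * fact k) * h ^ k"
    unfolding gauss_def using assms integral_normal_moment_even[of "sqrt h" 0 k]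
    by (subst integral_density) (auto simp: power_divide)
  show "(\<integral>x. x \<partial>gauss h) = 0"
    unfolding gauss_def using assms integral_normal_moment_nz_1[of "sqrt h" 0]
    by (subst integral_density) auto
qed

lemma gauss_singleton: "emeasure (gauss h) {x} = 0"
  unfolding gauss_def by (subst emeasure_density) (auto simp: nn_integral_0_iff_AE intro: AE_I[of _ _ "{x}"])

text \<open>Independence and the Gaussian law are merged into the single product formula
  \<open>W_indep\<close>, tested on events of the past. In this form the property can be checked
  directly after a change of density. It is asked for up to \<open>T1\<close> only, because the
  density is the one at the horizon \<open>T1\<close>.\<close>

locale brownian_on = prob_space N for N :: "'a measure" +
  fixes F :: "real \<Rightarrow> 'a measure" and W :: "real \<Rightarrow> 'a \<Rightarrow> real" and T1 :: real
  assumes filt: "filtration (space N) F"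
    and F_sub: "sets (F u) \<subseteq> sets N"
    and W_cont: "\<omega> \<in> space N \<Longrightarrow> continuous_on UNIV (\<lambda>u. W u \<omega>)"
    and W_adapt: "0 \<le> u \<Longrightarrow> u \<le> T1 \<Longrightarrow> W u \<in> borel_measurable (F u)"
    and W_meas[measurable]: "W u \<in> borel_measurable N"
    and W_indep: "0 \<le> s \<Longrightarrow> s < u \<Longrightarrow> u \<le> T1 \<Longrightarrow> A \<in> sets (F s) \<Longrightarrow> C \<in> sets borel \<Longrightarrow>
      emeasure N (A \<inter> {\<omega> \<in> space N. W u \<omega> - W s \<omega> \<in> C}) = emeasure N A * emeasure (gauss (u - s)) C"
begin

lemma space_F[simp]: "space (F u) = space N"
  using filt by (simp add: filtration_def)

lemma F_mono: "s \<le> u \<Longrightarrow> sets (F s) \<subseteq> sets (F u)"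
  using filt by (simp add: filtration_def)

lemma subalgebra_F: "subalgebra N (F u)"
  using F_sub by (simp add: subalgebra_def)

lemma measurable_F_mono: "s \<le> u \<Longrightarrow> f \<in> borel_measurable (F s) \<Longrightarrow> f \<in> borel_measurable (F u)"
  using F_mono[of s u] by (auto simp: measurable_def)

lemma measurable_F_N: "f \<in> borel_measurable (F s) \<Longrightarrow> f \<in> borel_measurable N"
  using F_sub[of s] by (auto simp: measurable_def)

lemma W_adapt': "0 \<le> s \<Longrightarrow> s \<le> u \<Longrightarrow> u \<le> T1 \<Longrightarrow> W s \<in> borel_measurable (F u)"
  by (rule measurable_F_mono[of s]) (auto intro: W_adapt)

text \<open>Each approximation freezes the path at the last point of the grid of mesh
  \<open>1 / n\<close>, so that only countably many times occur; path continuity gives the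
  limit.\<close>

lemma W_joint[measurable]: "(\<lambda>x. W (snd x) (fst x)) \<in> borel_measurable (N \<Otimes>\<^sub>M borel)"
proof (rule borel_measurable_LIMSEQ_metric)
  fix n :: nat
  show "(\<lambda>x. W (of_int \<lfloor>real n * snd x\<rfloor> / real n) (fst x)) \<in> borel_measurable (N \<Otimes>\<^sub>M borel)"
    by (rule measurable_compose_countable[where g = "\<lambda>x. \<lfloor>real n * snd x\<rfloor>"]) measurable
next
  fix x assume "x \<in> space (N \<Otimes>\<^sub>M (borel :: real measure))"
  then have x: "fst x \<in> space N" by (auto simp: space_pair_measure)
  have "(\<lambda>n. of_int \<lfloor>real n * snd x\<rfloor> / real n) \<longlonglongrightarrow> snd x"
  proof (rule tendsto_sandwich)
    show "\<forall>\<^sub>F n in sequentially. snd x - 1 / real n \<le> of_int \<lfloor>real n * snd x\<rfloor> / real n"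
    proof (rule eventually_sequentiallyI[of 1])
      fix n :: nat assume "1 \<le> n"
      then have "snd x - 1 / real n = (real n * snd x - 1) / real n" by (simp add: field_simps)
      also have "\<dots> \<le> of_int \<lfloor>real n * snd x\<rfloor> / real n"
        by (rule divide_right_mono) (linarith, simp)
      finally show "snd x - 1 / real n \<le> of_int \<lfloor>real n * snd x\<rfloor> / real n" .
    qed
    show "\<forall>\<^sub>F n in sequentially. of_int \<lfloor>real n * snd x\<rfloor> / real n \<le> snd x"
      by (rule eventually_sequentiallyI[of 1]) (simp add: field_simps)
    show "(\<lambda>n. snd x - 1 / real n) \<longlonglongrightarrow> snd x"
      using tendsto_diff[OF tendsto_const lim_const_over_n[of 1]] by simp
  qed auto
  then show "(\<lambda>n. W (of_int \<lfloor>real n * snd x\<rfloor> / real n) (fst x)) \<longlonglongrightarrow> W (snd x) (fst x)"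
    using continuous_on_tendsto_compose[OF W_cont[OF x]] by auto
qed

text \<open>With the outcome observed through \<open>F s\<close> only, outcome and increment have a
  product law. Fubini then does the work of conditional expectation everywhere below.\<close>

lemma distr_increment:
  assumes "0 \<le> s" "s < u" "u \<le> T1"
  shows "distr N (F s \<Otimes>\<^sub>M borel) (\<lambda>\<omega>. (\<omega>, W u \<omega> - W s \<omega>)) = restr_to_subalg N (F s) \<Otimes>\<^sub>M gauss (u - s)"
proof -
  interpret R: prob_space "restr_to_subalg N (F s)"
    by (rule prob_space_restr_to_subalg[OF subalgebra_F]) unfold_locales
  interpret G: prob_space "gauss (u - s)"
    using assms by (intro prob_space_gauss) simp
  have id: "(\<lambda>\<omega>. \<omega>) \<in> measurable N (F s)"
    using F_sub[of s] by (auto simp: measurable_def dest: sets.sets_into_space)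
  have m[measurable]: "(\<lambda>\<omega>. (\<omega>, W u \<omega> - W s \<omega>)) \<in> measurable N (F s \<Otimes>\<^sub>M borel)"
    using id by (intro measurable_Pair) auto
  show ?thesis
  proof (rule pair_measure_eqI[symmetric])
    show "sigma_finite_measure (restr_to_subalg N (F s))" "sigma_finite_measure (gauss (u - s))"
      by unfold_locales
    show "sets (restr_to_subalg N (F s) \<Otimes>\<^sub>M gauss (u - s)) = sets (distr N (F s \<Otimes>\<^sub>M borel) (\<lambda>\<omega>. (\<omega>, W u \<omega> - W s \<omega>)))"
      using sets_restr_to_subalg[OF subalgebra_F]
      by (simp cong: sets_pair_measure_cong)
    fix A C assume "A \<in> sets (restr_to_subalg N (F s))" "C \<in> sets (gauss (u - s))"
    then have A: "A \<in> sets (F s)" and C: "C \<in> sets borel"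
      using sets_restr_to_subalg[OF subalgebra_F] by auto
    have "emeasure (distr N (F s \<Otimes>\<^sub>M borel) (\<lambda>\<omega>. (\<omega>, W u \<omega> - W s \<omega>))) (A \<times> C)
        = emeasure N (A \<inter> {\<omega> \<in> space N. W u \<omega> - W s \<omega> \<in> C})"
      using A C by (subst emeasure_distr) (auto intro!: arg_cong[of _ _ "emeasure N"])
    also have "\<dots> = emeasure N A * emeasure (gauss (u - s)) C"
      using assms A C by (rule W_indep)
    finally show "emeasure (restr_to_subalg N (F s)) A * emeasure (gauss (u - s)) C =
        emeasure (distr N (F s \<Otimes>\<^sub>M borel) (\<lambda>\<omega>. (\<omega>, W u \<omega> - W s \<omega>))) (A \<times> C)"
      using A by (simp add: emeasure_restr_to_subalg[OF subalgebra_F])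
  qed
qed

lemma measurable_pair_increment: "(\<lambda>\<omega>. (\<omega>, W u \<omega> - W s \<omega>)) \<in> measurable N (F s \<Otimes>\<^sub>M borel)"
proof -
  have id: "(\<lambda>\<omega>. \<omega>) \<in> measurable N (F s)"
    using F_sub[of s] by (auto simp: measurable_def dest: sets.sets_into_space)
  show ?thesis
    using id by (intro measurable_Pair) auto
qed

lemma nn_integral_increment:
  assumes "0 \<le> s" "s < u" "u \<le> T1" and g: "g \<in> borel_measurable (F s \<Otimes>\<^sub>M borel)"
  shows "(\<integral>\<^sup>+\<omega>. g (\<omega>, W u \<omega> - W s \<omega>) \<partial>N) = (\<integral>\<^sup>+\<omega>. \<integral>\<^sup>+x. g (\<omega>, x) \<partial>gauss (u - s) \<partial>N)"
proof -
  interpret R: prob_space "restr_to_subalg N (F s)"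
    by (rule prob_space_restr_to_subalg[OF subalgebra_F]) unfold_locales
  interpret G: prob_space "gauss (u - s)"
    using assms by (intro prob_space_gauss) simp
  interpret P: pair_sigma_finite "restr_to_subalg N (F s)" "gauss (u - s)" ..
  have se: "sets (restr_to_subalg N (F s) \<Otimes>\<^sub>M gauss (u - s)) = sets (F s \<Otimes>\<^sub>M borel)"
    using sets_restr_to_subalg[OF subalgebra_F] by (simp cong: sets_pair_measure_cong)
  have se2: "sets (F s \<Otimes>\<^sub>M gauss (u - s)) = sets (F s \<Otimes>\<^sub>M borel)"
    by (simp cong: sets_pair_measure_cong)
  have g': "g \<in> borel_measurable (restr_to_subalg N (F s) \<Otimes>\<^sub>M gauss (u - s))"
    using g measurable_cong_sets[OF se refl] by blast
  have g2: "g \<in> borel_measurable (F s \<Otimes>\<^sub>M gauss (u - s))"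
    using g measurable_cong_sets[OF se2 refl] by blast
  have "(\<integral>\<^sup>+\<omega>. g (\<omega>, W u \<omega> - W s \<omega>) \<partial>N) = (\<integral>\<^sup>+x. g x \<partial>distr N (F s \<Otimes>\<^sub>M borel) (\<lambda>\<omega>. (\<omega>, W u \<omega> - W s \<omega>)))"
    using g measurable_pair_increment by (subst nn_integral_distr) auto
  also have "\<dots> = (\<integral>\<^sup>+\<omega>. \<integral>\<^sup>+x. g (\<omega>, x) \<partial>gauss (u - s) \<partial>restr_to_subalg N (F s))"
    unfolding distr_increment[OF assms(1-3)] using g' by (subst G.nn_integral_fst[symmetric]) auto
  also have "\<dots> = (\<integral>\<^sup>+\<omega>. \<integral>\<^sup>+x. g (\<omega>, x) \<partial>gauss (u - s) \<partial>N)"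
    using g2 by (intro nn_integral_subalgebra2[OF subalgebra_F] G.borel_measurable_nn_integral) simp
  finally show ?thesis .
qed

lemma integral_increment:
  fixes g :: "'a \<times> real \<Rightarrow> real"
  assumes "0 \<le> s" "s < u" "u \<le> T1" and g: "g \<in> borel_measurable (F s \<Otimes>\<^sub>M borel)"
    and int: "integrable N (\<lambda>\<omega>. g (\<omega>, W u \<omega> - W s \<omega>))"
  shows "(\<integral>\<omega>. g (\<omega>, W u \<omega> - W s \<omega>) \<partial>N) = (\<integral>\<omega>. \<integral>x. g (\<omega>, x) \<partial>gauss (u - s) \<partial>N)"
    and "integrable N (\<lambda>\<omega>. \<integral>x. g (\<omega>, x) \<partial>gauss (u - s))"
proof -
  interpret R: prob_space "restr_to_subalg N (F s)"
    by (rule prob_space_restr_to_subalg[OF subalgebra_F]) unfold_locales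
  interpret G: prob_space "gauss (u - s)"
    using assms by (intro prob_space_gauss) simp
  interpret P: pair_sigma_finite "restr_to_subalg N (F s)" "gauss (u - s)" ..
  have se2: "sets (F s \<Otimes>\<^sub>M gauss (u - s)) = sets (F s \<Otimes>\<^sub>M borel)"
    by (simp cong: sets_pair_measure_cong)
  have g2: "g \<in> borel_measurable (F s \<Otimes>\<^sub>M gauss (u - s))"
    using g measurable_cong_sets[OF se2 refl] by blast
  have m: "(\<lambda>\<omega>. \<integral>x. g (\<omega>, x) \<partial>gauss (u - s)) \<in> borel_measurable (F s)"
    using g2 by (intro G.borel_measurable_lebesgue_integral) simp
  have i2: "integrable (restr_to_subalg N (F s) \<Otimes>\<^sub>M gauss (u - s)) g"
    using int g measurable_pair_increment unfolding distr_increment[OF assms(1-3), symmetric]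
    by (subst integrable_distr_eq) auto
  have "(\<integral>\<omega>. g (\<omega>, W u \<omega> - W s \<omega>) \<partial>N) = (\<integral>x. g x \<partial>distr N (F s \<Otimes>\<^sub>M borel) (\<lambda>\<omega>. (\<omega>, W u \<omega> - W s \<omega>)))"
    using g measurable_pair_increment by (subst integral_distr) auto
  also have "\<dots> = (\<integral>\<omega>. \<integral>x. g (\<omega>, x) \<partial>gauss (u - s) \<partial>restr_to_subalg N (F s))"
    unfolding distr_increment[OF assms(1-3)] using i2 by (subst P.integral_fst'[symmetric]) auto
  also have "\<dots> = (\<integral>\<omega>. \<integral>x. g (\<omega>, x) \<partial>gauss (u - s) \<partial>N)"
    using m by (intro integral_subalgebra2[OF subalgebra_F]) simp
  finally show "(\<integral>\<omega>. g (\<omega>, W u \<omega> - W s \<omega>) \<partial>N) = (\<integral>\<omega>. \<integral>x. g (\<omega>, x) \<partial>gauss (u - s) \<partial>N)" .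
  show "integrable N (\<lambda>\<omega>. \<integral>x. g (\<omega>, x) \<partial>gauss (u - s))"
    using P.integrable_fst'[OF i2] m by (intro integrable_from_subalg[OF subalgebra_F])
qed

lemma increment_exp:
  assumes "0 \<le> s" "s \<le> u" "u \<le> T1"
  shows "integrable N (\<lambda>\<omega>. exp (p * (W u \<omega> - W s \<omega>)))"
    and "(\<integral>\<omega>. exp (p * (W u \<omega> - W s \<omega>)) \<partial>N) = exp (p\<^sup>2 / 2 * (u - s))"
proof -
  have "(\<integral>\<^sup>+\<omega>. exp (p * (W u \<omega> - W s \<omega>)) \<partial>N) = ennreal (exp (p\<^sup>2 / 2 * (u - s)))"
  proof (cases "s = u")
    case True
    then show ?thesis by (simp add: emeasure_space_1)
  next
    case False
    then have su: "s < u" using assms by simp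
    have "(\<integral>\<^sup>+\<omega>. ennreal (exp (p * (W u \<omega> - W s \<omega>))) \<partial>N) = (\<integral>\<^sup>+\<omega>. \<integral>\<^sup>+x. ennreal (exp (p * x)) \<partial>gauss (u - s) \<partial>N)"
      using nn_integral_increment[OF assms(1) su assms(3), of "\<lambda>x. ennreal (exp (p * snd x))"] by simp
    also have "(\<integral>\<^sup>+x. ennreal (exp (p * x)) \<partial>gauss (u - s)) = ennreal (exp (p\<^sup>2 / 2 * (u - s)))"
      using gauss_exp[of "u - s" p] su by (subst nn_integral_eq_integral) auto
    finally show ?thesis by (simp add: emeasure_space_1)
  qed
  then have "has_bochner_integral N (\<lambda>\<omega>. exp (p * (W u \<omega> - W s \<omega>))) (exp (p\<^sup>2 / 2 * (u - s)))"
    by (intro has_bochner_integral_nn_integral) auto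
  then show "integrable N (\<lambda>\<omega>. exp (p * (W u \<omega> - W s \<omega>)))"
    "(\<integral>\<omega>. exp (p * (W u \<omega> - W s \<omega>)) \<partial>N) = exp (p\<^sup>2 / 2 * (u - s))"
    by (auto simp: has_bochner_integral_iff)
qed

end

section \<open>The reduced stopping problem\<close>

text \<open>\<open>a_growth\<close> says that \<open>ln (a u) + L * u\<close> is nondecreasing. The
  one-sided bound suffices because problems are only ever shifted to earlier times.\<close>

locale stopping_problem = brownian_on N F W T1
  for N :: "'a measure" and F :: "real \<Rightarrow> 'a measure" and W :: "real \<Rightarrow> 'a \<Rightarrow> real" and T1 :: real +
  fixes \<nu> \<theta> L amax :: real and a :: "real \<Rightarrow> real"
  assumes T1_pos: "0 < T1"
    and a_cont: "continuous_on UNIV a"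
    and a_pos: "0 < a u"
    and a_le: "a u \<le> amax"
    and L_nonneg: "0 \<le> L"
    and a_growth: "v \<le> w \<Longrightarrow> a v \<le> exp (L * (w - v)) * a w"
begin

definition Y :: "real \<Rightarrow> real \<Rightarrow> real \<Rightarrow> 'a \<Rightarrow> real" where
  "Y t y u \<omega> = y + \<nu> * (W u \<omega> - W t \<omega>) - \<nu>\<^sup>2 / 2 * (u - t)"

text \<open>The discount runs from time 0 and not from the starting time, so that one and the same f
  serves all starting times; the factor \<open>exp (- \<theta> * t)\<close> is put back in the
  reduction.\<close>

definition f :: "real \<Rightarrow> real \<Rightarrow> real" where
  "f u y = exp (\<theta> * u) * (1 - a u * exp y)"

definition fY :: "real \<Rightarrow> real \<Rightarrow> 'a \<times> real \<Rightarrow> real" where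
  "fY t y x = f (snd x) (Y t y (snd x) (fst x))"

text \<open>It bounds the discount factor on \<open>[0, T1]\<close> for either sign of \<theta>, and
  its reciprocal bounds it from below.\<close>

definition cmax :: real where "cmax = exp (\<bar>\<theta>\<bar> * T1)"

abbreviation PM :: "('a \<times> real) measure" where "PM \<equiv> N \<Otimes>\<^sub>M lborel"

sublocale NL: pair_sigma_finite N lborel ..

lemma exp_theta_le: "0 \<le> u \<Longrightarrow> u \<le> T1 \<Longrightarrow> exp (\<theta> * u) \<le> cmax"
  unfolding cmax_def using abs_ge_self[of "\<theta> * u"]
  by (simp add: abs_mult) (metis abs_ge_zero mult_left_mono order_trans)

lemma cmax_pos: "0 < cmax"
  by (simp add: cmax_def)

lemma amax_pos: "0 < amax"
  using a_pos[of 0] a_le[of 0] by linarith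

lemma a_meas[measurable]: "a \<in> borel_measurable borel"
  using a_cont by (rule borel_measurable_continuous_onI)

lemma Y_meas[measurable]: "Y t y u \<in> borel_measurable N"
  unfolding Y_def by measurable

lemma Y_adapt: "0 \<le> t \<Longrightarrow> t \<le> u \<Longrightarrow> u \<le> T1 \<Longrightarrow> Y t y u \<in> borel_measurable (F u)"
  unfolding Y_def using W_adapt'[of u u] W_adapt'[of t u] by measurable

lemma Y_joint[measurable]: "(\<lambda>x. Y t y (snd x) (fst x)) \<in> borel_measurable (N \<Otimes>\<^sub>M borel)"
  unfolding Y_def by measurable

lemma Y_cont: "\<omega> \<in> space N \<Longrightarrow> continuous_on UNIV (\<lambda>u. Y t y u \<omega>)"
  unfolding Y_def by (intro continuous_intros W_cont)

lemma Y_self[simp]: "Y t y t \<omega> = y"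
  by (simp add: Y_def)

lemma Y_step: "Y t y u \<omega> = Y t y s \<omega> + \<nu> * (W u \<omega> - W s \<omega>) - \<nu>\<^sup>2 / 2 * (u - s)"
  by (simp add: Y_def field_simps)

lemma fY_meas[measurable]: "fY t y \<in> borel_measurable (N \<Otimes>\<^sub>M borel)"
  unfolding fY_def f_def by measurable

lemma Y_exp_moment:
  assumes "0 \<le> t" "t \<le> u" "u \<le> T1"
  shows "integrable N (\<lambda>\<omega>. exp (p * Y t y u \<omega>))"
    and "(\<integral>\<omega>. exp (p * Y t y u \<omega>) \<partial>N) = exp (p * y + (p\<^sup>2 - p) * \<nu>\<^sup>2 / 2 * (u - t))"
proof -
  have eq: "exp (p * Y t y u \<omega>) = exp (p * y - p * \<nu>\<^sup>2 / 2 * (u - t)) * exp (p * \<nu> * (W u \<omega> - W t \<omega>))" for \<omega>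
    unfolding Y_def exp_add[symmetric] by (simp add: algebra_simps)
  show "integrable N (\<lambda>\<omega>. exp (p * Y t y u \<omega>))"
    unfolding eq using increment_exp(1)[OF assms, of "p * \<nu>"] by simp
  show "(\<integral>\<omega>. exp (p * Y t y u \<omega>) \<partial>N) = exp (p * y + (p\<^sup>2 - p) * \<nu>\<^sup>2 / 2 * (u - t))"
    unfolding eq Bochner_Integration.integral_mult_right_zero increment_exp(2)[OF assms]
    by (simp add: exp_add[symmetric]) (simp add: field_simps power_mult_distrib)
qed

lemma expY_int: "0 \<le> t \<Longrightarrow> t \<le> u \<Longrightarrow> u \<le> T1 \<Longrightarrow> integrable N (\<lambda>\<omega>. exp (Y t y u \<omega>))"
  using Y_exp_moment(1)[of t u 1] by simp

lemma Y_markov: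
  fixes g :: "real \<Rightarrow> real"
  assumes "0 \<le> t" "t \<le> s" "0 < h" "s + h \<le> T1" "A \<in> sets (F s)"
    and [measurable]: "g \<in> borel_measurable borel"
    and int: "integrable N (\<lambda>\<omega>. g (Y t y (s + h) \<omega>))"
  shows "(\<integral>\<omega>. indicator A \<omega> * g (Y t y (s + h) \<omega>) \<partial>N)
      = (\<integral>\<omega>. indicator A \<omega> * (\<integral>z. g (Y t y s \<omega> + \<nu> * z - \<nu>\<^sup>2 / 2 * h) \<partial>gauss h) \<partial>N)" (is ?eq)
    and "integrable N (\<lambda>\<omega>. indicator A \<omega> * (\<integral>z. g (Y t y s \<omega> + \<nu> * z - \<nu>\<^sup>2 / 2 * h) \<partial>gauss h))" (is ?int)
proof -
  define G where "G x = indicator A (fst x) * g (Y t y s (fst x) + \<nu> * snd x - \<nu>\<^sup>2 / 2 * h)" for x :: "'a \<times> real"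
  have "Y t y s \<in> borel_measurable (F s)" using assms by (intro Y_adapt) auto
  from measurable_compose[OF measurable_fst this]
  have yF: "(\<lambda>x. Y t y s (fst x)) \<in> borel_measurable (F s \<Otimes>\<^sub>M (borel :: real measure))" .
  have "(\<lambda>x. Y t y s (fst x) + \<nu> * snd x - \<nu>\<^sup>2 / 2 * h) \<in> borel_measurable (F s \<Otimes>\<^sub>M borel)"
    by (intro borel_measurable_diff borel_measurable_add yF) measurable
  from measurable_compose[OF this assms(6)]
  have gm: "(\<lambda>x. g (Y t y s (fst x) + \<nu> * snd x - \<nu>\<^sup>2 / 2 * h)) \<in> borel_measurable (F s \<Otimes>\<^sub>M borel)" .
  have Am: "(\<lambda>x. indicator A (fst x) :: real) \<in> borel_measurable (F s \<Otimes>\<^sub>M (borel :: real measure))"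
    by (rule measurable_compose[OF measurable_fst borel_measurable_indicator[OF assms(5)]])
  have Gm: "G \<in> borel_measurable (F s \<Otimes>\<^sub>M borel)"
    unfolding G_def by (rule borel_measurable_times[OF Am gm])
  have Geq: "G (\<omega>, W (s + h) \<omega> - W s \<omega>) = indicator A \<omega> * g (Y t y (s + h) \<omega>)" for \<omega>
    unfolding G_def using Y_step[of t y "s + h" \<omega> s] by simp
  have AN: "A \<in> sets N" using assms(5) F_sub by auto
  have "integrable N (\<lambda>\<omega>. indicator A \<omega> * g (Y t y (s + h) \<omega>))"
    using integrable_mult_indicator[OF AN int] by simp
  then have Gi: "integrable N (\<lambda>\<omega>. G (\<omega>, W (s + h) \<omega> - W s \<omega>))"
    unfolding Geq .
  have lt: "s < s + h" "0 \<le> s" using assms by auto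
  have G2: "(\<integral>x. G (\<omega>, x) \<partial>gauss (s + h - s)) = indicator A \<omega> * (\<integral>z. g (Y t y s \<omega> + \<nu> * z - \<nu>\<^sup>2 / 2 * h) \<partial>gauss h)" for \<omega>
    unfolding G_def by simp
  show ?eq using integral_increment(1)[OF lt(2,1) assms(4) Gm Gi] unfolding Geq G2 .
  show ?int using integral_increment(2)[OF lt(2,1) assms(4) Gm Gi] unfolding G2 .
qed

text \<open>The growth rate vanishes for p = 1, which is the martingale property; p = 2 supplies the
  second moments behind optional stopping.\<close>

lemma expY_cond:
  assumes "0 \<le> t" "t \<le> s" "s \<le> u" "u \<le> T1" "A \<in> sets (F s)"
  shows "(\<integral>\<omega>. indicator A \<omega> * exp (p * Y t y u \<omega>) \<partial>N)
    = exp ((p\<^sup>2 - p) * \<nu>\<^sup>2 / 2 * (u - s)) * (\<integral>\<omega>. indicator A \<omega> * exp (p * Y t y s \<omega>) \<partial>N)"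
proof (cases "s = u")
  case False
  then have h: "0 < u - s" using assms by simp
  have "(\<integral>z. exp (p * (x + \<nu> * z - \<nu>\<^sup>2 / 2 * (u - s))) \<partial>gauss (u - s)) = exp ((p\<^sup>2 - p) * \<nu>\<^sup>2 / 2 * (u - s)) * exp (p * x)" for x
  proof -
    have "(\<integral>z. exp (p * (x + \<nu> * z - \<nu>\<^sup>2 / 2 * (u - s))) \<partial>gauss (u - s)) = (\<integral>z. exp (p * x - p * \<nu>\<^sup>2 / 2 * (u - s)) * exp ((p * \<nu>) * z) \<partial>gauss (u - s))"
      by (simp add: exp_add[symmetric] algebra_simps)
    also have "\<dots> = exp ((p\<^sup>2 - p) * \<nu>\<^sup>2 / 2 * (u - s)) * exp (p * x)"
      unfolding Bochner_Integration.integral_mult_right_zero gauss_exp(2)[OF h]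
      by (simp add: exp_add[symmetric]) (simp add: field_simps power_mult_distrib)
    finally show ?thesis .
  qed
  then have "(\<integral>\<omega>. indicator A \<omega> * exp (p * Y t y u \<omega>) \<partial>N)
    = (\<integral>\<omega>. indicator A \<omega> * (exp ((p\<^sup>2 - p) * \<nu>\<^sup>2 / 2 * (u - s)) * exp (p * Y t y s \<omega>)) \<partial>N)"
    using Y_markov(1)[of t s "u - s" A "\<lambda>x. exp (p * x)" y] h assms Y_exp_moment(1)[of t u p y] by simp
  then show ?thesis
    unfolding Bochner_Integration.integral_mult_right_zero[symmetric] by (simp only: mult.left_commute)
qed simp

lemma expY_martingale:
  assumes "0 \<le> t" "t \<le> s" "s \<le> u" "u \<le> T1" "A \<in> sets (F s)"
  shows "(\<integral>\<omega>. indicator A \<omega> * exp (Y t y u \<omega>) \<partial>N) = (\<integral>\<omega>. indicator A \<omega> * exp (Y t y s \<omega>) \<partial>N)"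
  using expY_cond[OF assms, of 1 y] by simp

lemma prod_expY_int:
  assumes "0 \<le> t"
  shows "integrable PM (\<lambda>x. indicator {t..<T1} (snd x) * exp (p * Y t y (snd x) (fst x)))"
proof (rule integrableI_bounded)
  show "(\<lambda>x. indicator {t..<T1} (snd x) * exp (p * Y t y (snd x) (fst x))) \<in> borel_measurable PM"
    by measurable
  define C where "C = exp (p * y + \<bar>p\<^sup>2 - p\<bar> * \<nu>\<^sup>2 / 2 * T1)"
  have "(\<integral>\<^sup>+x. ennreal (norm (indicator {t..<T1} (snd x) * exp (p * Y t y (snd x) (fst x)))) \<partial>PM)
     = (\<integral>\<^sup>+u. \<integral>\<^sup>+\<omega>. ennreal (norm (indicator {t..<T1} u * exp (p * Y t y u \<omega>))) \<partial>N \<partial>lborel)"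
    by (subst NL.nn_integral_snd[symmetric]) (auto simp: split_beta')
  also have "\<dots> \<le> (\<integral>\<^sup>+u. ennreal C * indicator {t..<T1} u \<partial>lborel)"
  proof (rule nn_integral_mono)
    fix u :: real
    show "(\<integral>\<^sup>+\<omega>. ennreal (norm (indicator {t..<T1} u * exp (p * Y t y u \<omega>))) \<partial>N) \<le> ennreal C * indicator {t..<T1} u"
    proof (cases "u \<in> {t..<T1}")
      case True
      then have u: "t \<le> u" "u \<le> T1" by auto
      have "(p\<^sup>2 - p) * (\<nu>\<^sup>2 / 2) * (u - t) \<le> \<bar>p\<^sup>2 - p\<bar> * (\<nu>\<^sup>2 / 2) * T1"
        using u assms by (intro mult_mono mult_right_mono) auto
      then have "exp (p * y + (p\<^sup>2 - p) * \<nu>\<^sup>2 / 2 * (u - t)) \<le> C"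
        unfolding C_def by simp
      then show ?thesis
        using True Y_exp_moment[OF assms u, of p y]
        by (simp add: nn_integral_eq_integral ennreal_leI)
    qed simp
  qed
  also have "\<dots> < \<infinity>"
    using emeasure_bounded_finite[of "{t..<T1}"] by (simp add: nn_integral_cmult_indicator ennreal_mult_less_top)
  finally show "(\<integral>\<^sup>+x. ennreal (norm (indicator {t..<T1} (snd x) * exp (p * Y t y (snd x) (fst x)))) \<partial>PM) < \<infinity>" .
qed

lemma prod_const_int: "integrable PM (\<lambda>x. indicator {t..<T1} (snd x) * c :: real)"
proof (rule integrableI_bounded)
  show "(\<lambda>x. indicator {t..<T1} (snd x) * c) \<in> borel_measurable PM"
    by measurable
  have "(\<integral>\<^sup>+x. ennreal (norm (indicator {t..<T1} (snd x) * c)) \<partial>PM)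
     = (\<integral>\<^sup>+u. \<integral>\<^sup>+\<omega>. ennreal (norm (indicator {t..<T1} u * c)) \<partial>N \<partial>lborel)"
    by (subst NL.nn_integral_snd[symmetric]) (auto simp: split_beta')
  also have "\<dots> = (\<integral>\<^sup>+u. ennreal \<bar>c\<bar> * indicator {t..<T1} u \<partial>lborel)"
    by (intro nn_integral_cong) (auto simp: emeasure_space_1 split: split_indicator)
  also have "\<dots> < \<infinity>"
    using emeasure_bounded_finite[of "{t..<T1}"] by (simp add: nn_integral_cmult_indicator ennreal_mult_less_top)
  finally show "(\<integral>\<^sup>+x. ennreal (norm (indicator {t..<T1} (snd x) * c)) \<partial>PM) < \<infinity>" .
qed

text \<open>A common integrable majorant of all grid integrands, independent of the mesh, for
  dominated convergence.\<close>

definition fbd :: "real \<Rightarrow> real \<Rightarrow> 'a \<times> real \<Rightarrow> real" where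
  "fbd t y x = indicator {t..<T1} (snd x) * (cmax + cmax * amax * exp (Y t y (snd x) (fst x)))"

lemma fbd_int: "0 \<le> t \<Longrightarrow> integrable PM (fbd t y)"
  unfolding fbd_def using prod_expY_int[of t 1 y] prod_const_int[of t cmax]
  by (simp add: algebra_simps)

lemma f_bound: "0 \<le> u \<Longrightarrow> u \<le> T1 \<Longrightarrow> \<bar>f u y\<bar> \<le> cmax + cmax * amax * exp y"
proof -
  assume u: "0 \<le> u" "u \<le> T1"
  have "\<bar>f u y\<bar> = exp (\<theta> * u) * \<bar>1 - a u * exp y\<bar>" by (simp add: f_def abs_mult)
  also have "\<dots> \<le> cmax * (1 + amax * exp y)"
  proof (rule mult_mono)
    have "\<bar>1 - a u * exp y\<bar> \<le> 1 + a u * exp y" using a_pos[of u] by (simp add: abs_le_iff)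
    also have "\<dots> \<le> 1 + amax * exp y" using a_le[of u] by simp
    finally show "\<bar>1 - a u * exp y\<bar> \<le> 1 + amax * exp y" .
  qed (use exp_theta_le[OF u] cmax_pos in auto)
  finally show ?thesis by (simp add: algebra_simps)
qed

lemma f_le: "0 \<le> u \<Longrightarrow> u \<le> T1 \<Longrightarrow> f u y \<le> cmax"
proof -
  assume u: "0 \<le> u" "u \<le> T1"
  have "f u y \<le> exp (\<theta> * u) * 1" unfolding f_def using a_pos[of u] by (intro mult_left_mono) auto
  then show ?thesis using exp_theta_le[OF u] by simp
qed

lemma fY_bound: "0 \<le> t \<Longrightarrow> \<bar>b\<bar> \<le> indicator {t..<T1} (snd x) \<Longrightarrow> \<bar>b * fY t y x\<bar> \<le> fbd t y x"
proof (cases "snd x \<in> {t..<T1}")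
  case True
  assume "0 \<le> t" "\<bar>b\<bar> \<le> indicator {t..<T1} (snd x)"
  then have b: "\<bar>b\<bar> \<le> 1" and u: "0 \<le> snd x" "snd x \<le> T1" using True by auto
  have "\<bar>b * fY t y x\<bar> \<le> 1 * \<bar>fY t y x\<bar>" unfolding abs_mult using b by (intro mult_right_mono) auto
  also have "\<dots> \<le> fbd t y x" unfolding fY_def fbd_def using True f_bound[OF u] by simp
  finally show ?thesis .
qed (simp add: fbd_def)

lemma fY_int:
  assumes "0 \<le> t" and b[measurable]: "b \<in> borel_measurable (N \<Otimes>\<^sub>M borel)"
    and "\<And>x. \<bar>b x\<bar> \<le> indicator {t..<T1} (snd x)"
  shows "integrable PM (\<lambda>x. b x * fY t y x)"
  by (rule Bochner_Integration.integrable_bound[OF fbd_int[OF assms(1), of y]])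
    (use fY_bound[OF assms(1) assms(3)] in \<open>auto intro!: AE_I2 order_trans[OF _ abs_ge_self]\<close>)

section \<open>Expected reward over one grid cell\<close>

definition Cint :: "real \<Rightarrow> real \<Rightarrow> real" where
  "Cint s h = (\<integral>u. indicator {s..<s+h} u * exp (\<theta> * u) \<partial>lborel)"

definition Dint :: "real \<Rightarrow> real \<Rightarrow> real" where
  "Dint s h = (\<integral>u. indicator {s..<s+h} u * (exp (\<theta> * u) * a u) \<partial>lborel)"

text \<open>The reward over \<open>[s, s + h)\<close> with the state frozen at y. By
  \<open>prod_phi\<close> it is also the expected reward over that cell when the state
  moves.\<close>

definition phi :: "real \<Rightarrow> real \<Rightarrow> real \<Rightarrow> real" where
  "phi h s y = Cint s h - Dint s h * exp y"

lemma cont_interval_int: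
  assumes "continuous_on UNIV (g :: real \<Rightarrow> real)"
  shows "integrable lborel (\<lambda>u. indicator {s..<s'} u * g u)"
proof -
  have "integrable lborel (\<lambda>u. indicator {s..s'} u *\<^sub>R g u)"
    using borel_integrable_atLeastAtMost'[of s s' g] continuous_on_subset[OF assms]
    by (auto simp: set_integrable_def)
  then show ?thesis
    by (rule Bochner_Integration.integrable_bound)
      (use borel_measurable_continuous_onI[OF assms] in \<open>auto split: split_indicator intro!: AE_I2\<close>)
qed

lemma exp_theta_cont: "continuous_on UNIV (\<lambda>u. exp (\<theta> * u))"
  by (intro continuous_intros)

lemma Cint_integrable: "integrable lborel (\<lambda>u. indicator {s..<s'} u * exp (\<theta> * u))"
  by (rule cont_interval_int[OF exp_theta_cont])

lemma Dint_integrable: "integrable lborel (\<lambda>u. indicator {s..<s'} u * (exp (\<theta> * u) * a u))"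
  by (rule cont_interval_int) (intro continuous_intros a_cont)

lemma phi_eq: "phi h s y = (\<integral>u. indicator {s..<s+h} u * f u y \<partial>lborel)"
proof -
  have "phi h s y = (\<integral>u. indicator {s..<s+h} u * exp (\<theta> * u) - indicator {s..<s+h} u * (exp (\<theta> * u) * a u) * exp y \<partial>lborel)"
    unfolding phi_def Cint_def Dint_def
    by (subst Bochner_Integration.integral_diff) (auto intro: Cint_integrable Dint_integrable)
  also have "\<dots> = (\<integral>u. indicator {s..<s+h} u * f u y \<partial>lborel)"
    by (simp add: f_def algebra_simps)
  finally show ?thesis .
qed

lemma phi_meas[measurable]: "phi h s \<in> borel_measurable borel"
  unfolding phi_def by measurable

lemma f_integrable: "integrable lborel (\<lambda>u. indicator {s..<s'} u * f u y)"
  unfolding f_def by (rule cont_interval_int) (intro continuous_intros a_cont)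

lemma Dint_nonneg: "0 \<le> Dint s h"
  unfolding Dint_def using a_pos by (intro Bochner_Integration.integral_nonneg) (simp add: less_imp_le)

lemma phi_le:
  assumes "0 \<le> s" "0 \<le> h" "s + h \<le> T1"
  shows "phi h s y \<le> h * cmax"
proof -
  have "phi h s y \<le> (\<integral>u. indicator {s..<s+h} u * cmax \<partial>lborel)"
    unfolding phi_eq using assms
    by (intro integral_mono f_integrable) (auto split: split_indicator intro!: f_le)
  also have "\<dots> = h * cmax" using assms by simp
  finally show ?thesis .
qed

lemma phi_Y_int:
  assumes "0 \<le> t" "t \<le> s" "s \<le> T1"
  shows "integrable N (\<lambda>\<omega>. phi h s (Y t y s \<omega>))"
  unfolding phi_def using expY_int[OF assms] by simp

text \<open>f is affine in \<open>exp y\<close>, so after exchanging the integrals the martingale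
  property replaces the state at u by the state at s. Hence no discretisation error arises inside a
  cell.\<close>

lemma prod_phi:
  assumes "0 \<le> t" "t \<le> s" "0 \<le> h" "s + h \<le> T1" and A: "A \<in> sets (F s)"
  shows "(\<integral>x. indicator A (fst x) * indicator {s..<s+h} (snd x) * fY t y x \<partial>PM)
     = (\<integral>\<omega>. indicator A \<omega> * phi h s (Y t y s \<omega>) \<partial>N)"
proof -
  have AN[measurable]: "A \<in> sets N" using A F_sub by auto
  have int: "integrable PM (\<lambda>(\<omega>,u). indicator A \<omega> * indicator {s..<s+h} u * fY t y (\<omega>, u))"
    using assms fY_int[of t "\<lambda>x. indicator A (fst x) * indicator {s..<s+h} (snd x)" y]
    by (auto simp: split_beta' split: split_indicator)
  have "(\<integral>x. indicator A (fst x) * indicator {s..<s+h} (snd x) * fY t y x \<partial>PM)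
     = (\<integral>u. \<integral>\<omega>. indicator A \<omega> * indicator {s..<s+h} u * fY t y (\<omega>, u) \<partial>N \<partial>lborel)"
    using NL.integral_snd[OF int] by (simp add: split_beta')
  also have "\<dots> = (\<integral>u. indicator {s..<s+h} u * exp (\<theta> * u) * prob A
      - indicator {s..<s+h} u * (exp (\<theta> * u) * a u) * (\<integral>\<omega>. indicator A \<omega> * exp (Y t y s \<omega>) \<partial>N) \<partial>lborel)"
  proof (intro Bochner_Integration.integral_cong refl)
    fix u
    show "(\<integral>\<omega>. indicator A \<omega> * indicator {s..<s+h} u * fY t y (\<omega>, u) \<partial>N) = indicator {s..<s+h} u * exp (\<theta> * u) * prob A
      - indicator {s..<s+h} u * (exp (\<theta> * u) * a u) * (\<integral>\<omega>. indicator A \<omega> * exp (Y t y s \<omega>) \<partial>N)"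
    proof (cases "u \<in> {s..<s+h}")
      case True
      then have u: "t \<le> u" "s \<le> u" "u \<le> T1" using assms by auto
      have i1: "integrable N (\<lambda>\<omega>. indicator A \<omega> * exp (Y t y u \<omega>))"
        using integrable_mult_indicator[OF AN expY_int[OF assms(1) u(1,3), of y]] by simp
      have "(\<integral>\<omega>. indicator A \<omega> * fY t y (\<omega>, u) \<partial>N)
         = (\<integral>\<omega>. exp (\<theta> * u) * indicator A \<omega> - exp (\<theta> * u) * a u * (indicator A \<omega> * exp (Y t y u \<omega>)) \<partial>N)"
        by (intro Bochner_Integration.integral_cong refl) (simp add: fY_def f_def algebra_simps)
      also have "\<dots> = exp (\<theta> * u) * prob A - exp (\<theta> * u) * a u * (\<integral>\<omega>. indicator A \<omega> * exp (Y t y u \<omega>) \<partial>N)"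
        using i1 by (subst Bochner_Integration.integral_diff) (auto simp: less_top[symmetric])
      finally show ?thesis using True expY_martingale[OF assms(1,2) u(2,3) A, of y] by simp
    qed simp
  qed
  also have "\<dots> = Cint s h * prob A - Dint s h * (\<integral>\<omega>. indicator A \<omega> * exp (Y t y s \<omega>) \<partial>N)"
    unfolding Cint_def Dint_def
    by (subst Bochner_Integration.integral_diff) (auto intro!: Cint_integrable Dint_integrable)
  also have "\<dots> = (\<integral>\<omega>. Cint s h * indicator A \<omega> - Dint s h * (indicator A \<omega> * exp (Y t y s \<omega>)) \<partial>N)"
    using integrable_mult_indicator[OF AN expY_int[OF assms(1,2), of y]] assms
    by (subst Bochner_Integration.integral_diff) (auto simp: less_top[symmetric])
  also have "\<dots> = (\<integral>\<omega>. indicator A \<omega> * phi h s (Y t y s \<omega>) \<partial>N)"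
    by (intro Bochner_Integration.integral_cong refl) (simp add: phi_def algebra_simps)
  finally show ?thesis .
qed


subsection \<open>Bermudan value functions\<close>

text \<open>\<open>Q k h s y\<close> is the value at time \<open>s\<close> in state \<open>y\<close> when stopping is allowed at \<open>s, s + h, \<dots>, s + k * h\<close> only.\<close>

primrec Q :: "nat \<Rightarrow> real \<Rightarrow> real \<Rightarrow> real \<Rightarrow> real" where
  "Q 0 h s y = 0"
| "Q (Suc k) h s y = max 0 (phi h s y + (\<integral>z. Q k h (s + h) (y + \<nu> * z - \<nu>\<^sup>2 / 2 * h) \<partial>gauss h))"

definition cont :: "nat \<Rightarrow> real \<Rightarrow> real \<Rightarrow> real \<Rightarrow> real" where
  "cont k h s y = phi h s y + (\<integral>z. Q k h (s + h) (y + \<nu> * z - \<nu>\<^sup>2 / 2 * h) \<partial>gauss h)"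

lemma Q_Suc: "Q (Suc k) h s y = max 0 (cont k h s y)"
  by (simp add: cont_def)

lemma Q_nonneg: "0 \<le> Q k h s y"
  by (cases k) auto

lemma Q_meas[measurable]: "0 < h \<Longrightarrow> Q k h s \<in> borel_measurable borel"
proof (induction k arbitrary: s)
  case 0
  then show ?case by simp
next
  case (Suc k)
  interpret G: prob_space "gauss h" using Suc.prems by (rule prob_space_gauss)
  note [measurable] = Suc.IH[OF Suc.prems]
  show ?case by (subst Q.simps[abs_def]) measurable
qed

lemma cont_meas[measurable]: "0 < h \<Longrightarrow> cont k h s \<in> borel_measurable borel"
proof -
  assume h: "0 < h"
  interpret G: prob_space "gauss h" using h by (rule prob_space_gauss)
  note [measurable] = Q_meas[OF h]
  show ?thesis by (subst cont_def[abs_def]) measurable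
qed

lemma Q_bounded_int:
  assumes "0 < h" "0 < h'" "\<And>y. Q k h s y \<le> C"
  shows "integrable (gauss h') (\<lambda>z. Q k h s (y + \<nu> * z - c))"
proof -
  interpret G: prob_space "gauss h'" using assms(2) by (rule prob_space_gauss)
  note [measurable] = Q_meas[OF assms(1)]
  show ?thesis
    using assms(3) Q_nonneg by (intro G.integrable_const_bound[where B = C]) auto
qed

lemma Q_le: "0 < h \<Longrightarrow> 0 \<le> s \<Longrightarrow> s + real k * h \<le> T1 \<Longrightarrow> Q k h s y \<le> real k * h * cmax"
proof (induction k arbitrary: s y)
  case (Suc k)
  interpret G: prob_space "gauss h" using Suc.prems(1) by (rule prob_space_gauss)
  have IH: "Q k h (s + h) y \<le> real k * h * cmax" for y
    using Suc.prems by (intro Suc.IH) (auto simp: algebra_simps)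
  have "(\<integral>z. Q k h (s + h) (y + \<nu> * z - \<nu>\<^sup>2 / 2 * h) \<partial>gauss h) \<le> (\<integral>z. real k * h * cmax \<partial>gauss h)"
    using IH by (intro integral_mono Q_bounded_int[OF Suc.prems(1,1)]) auto
  moreover have "phi h s y \<le> h * cmax"
  proof (rule phi_le)
    have "0 \<le> real k * h" using Suc.prems by simp
    then show "s + h \<le> T1" using Suc.prems(3) by (simp add: algebra_simps)
  qed (use Suc.prems in auto)
  ultimately show ?case
    using Suc.prems cmax_pos by (auto simp: algebra_simps G.prob_space[simplified])
qed simp

lemma Q_int:
  assumes "0 < h" "0 \<le> s" "s + real k * h \<le> T1"
  shows "integrable (gauss h) (\<lambda>z. Q k h s (y + \<nu> * z - c))"
  using Q_le[OF assms] by (intro Q_bounded_int[OF assms(1,1)])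

lemma Q_antimono: "0 < h \<Longrightarrow> 0 \<le> s \<Longrightarrow> s + real k * h \<le> T1 \<Longrightarrow> y \<le> y' \<Longrightarrow> Q k h s y' \<le> Q k h s y"
proof (induction k arbitrary: s y y')
  case (Suc k)
  have p: "0 \<le> s + h" "s + h + real k * h \<le> T1" using Suc.prems by (auto simp: algebra_simps)
  have "(\<integral>z. Q k h (s + h) (y' + \<nu> * z - \<nu>\<^sup>2 / 2 * h) \<partial>gauss h) \<le> (\<integral>z. Q k h (s + h) (y + \<nu> * z - \<nu>\<^sup>2 / 2 * h) \<partial>gauss h)"
    using Suc.prems p by (intro integral_mono Q_int Suc.IH) auto
  moreover have "phi h s y' \<le> phi h s y"
    unfolding phi_def using Dint_nonneg[of s h] Suc.prems by (intro diff_left_mono mult_left_mono) auto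
  ultimately show ?case by simp
qed simp

lemma Q_mono_steps: "0 < h \<Longrightarrow> 0 \<le> s \<Longrightarrow> s + real (Suc k) * h \<le> T1 \<Longrightarrow> Q k h s y \<le> Q (Suc k) h s y"
proof (induction k arbitrary: s y)
  case (Suc k)
  have p: "0 \<le> s + h" "s + h + real (Suc k) * h \<le> T1" "s + h + real k * h \<le> T1" using Suc.prems by (auto simp: algebra_simps)
  have "(\<integral>z. Q k h (s + h) (y + \<nu> * z - \<nu>\<^sup>2 / 2 * h) \<partial>gauss h) \<le> (\<integral>z. Q (Suc k) h (s + h) (y + \<nu> * z - \<nu>\<^sup>2 / 2 * h) \<partial>gauss h)"
    using Suc.prems p by (intro integral_mono Q_int Suc.IH) auto
  then show ?case unfolding Q_Suc cont_def by (intro max.mono) auto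
qed simp

text \<open>Moving the cell back by d lets a grow by at most the factor \<open>exp (L * d)\<close>,
  which lowering the state by \<open>L * d\<close> absorbs; the discount contributes the factor in
  front.\<close>

lemma phi_time_shift:
  assumes "s' \<le> s"
  shows "exp (- \<theta> * (s - s')) * phi h s y \<le> phi h s' (y - L * (s - s'))"
proof -
  define d where "d = s - s'"
  have d: "0 \<le> d" using assms by (simp add: d_def)
  have "phi h s' (y - L * d) = (\<integral>u. indicator {s..<s+h} u * f (u - d) (y - L * d) \<partial>lborel)"
    unfolding phi_eq
    by (subst lborel_integral_real_affine[of 1 _ "- d"])
      (auto simp: d_def indicator_def algebra_simps intro!: Bochner_Integration.integral_cong)
  moreover have "exp (- \<theta> * d) * phi h s y \<le> (\<integral>u. indicator {s..<s+h} u * f (u - d) (y - L * d) \<partial>lborel)"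
    unfolding phi_eq Bochner_Integration.integral_mult_right_zero[symmetric]
  proof (rule integral_mono)
    show "integrable lborel (\<lambda>u. exp (- \<theta> * d) * (indicator {s..<s+h} u * f u y))"
      by (intro integrable_mult_right f_integrable)
    show "integrable lborel (\<lambda>u. indicator {s..<s+h} u * f (u - d) (y - L * d))"
      unfolding f_def
      by (rule cont_interval_int) (intro continuous_intros continuous_on_compose2[OF a_cont], auto)
    fix u
    have "a (u - d) * exp (y - L * d) \<le> exp (L * d) * a u * exp (y - L * d)"
      using a_growth[of "u - d" u] d by (intro mult_right_mono) auto
    also have "\<dots> = a u * exp y" by (simp add: exp_diff)
    finally have "1 - a u * exp y \<le> 1 - a (u - d) * exp (y - L * d)" by simp
    then have "exp (\<theta> * (u - d)) * (1 - a u * exp y) \<le> f (u - d) (y - L * d)"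
      unfolding f_def by (rule mult_left_mono) simp
    moreover have "exp (- \<theta> * d) * f u y = exp (\<theta> * (u - d)) * (1 - a u * exp y)"
      unfolding f_def mult.assoc[symmetric] exp_add[symmetric] by (simp add: algebra_simps)
    ultimately show "exp (- \<theta> * d) * (indicator {s..<s+h} u * f u y) \<le> indicator {s..<s+h} u * f (u - d) (y - L * d)"
      by (auto split: split_indicator)
  qed
  ultimately show ?thesis by (simp add: d_def)
qed

text \<open>The Gaussian kernel commutes with translations of the state, so the cell estimate passes
  through the recursion. The number of steps is kept, hence the shifted schedule still ends before
  \<open>T1\<close>.\<close>

lemma Q_time_shift:
  "0 < h \<Longrightarrow> 0 \<le> s' \<Longrightarrow> s' \<le> s \<Longrightarrow> s + real k * h \<le> T1 \<Longrightarrow>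
    exp (- \<theta> * (s - s')) * Q k h s y \<le> Q k h s' (y - L * (s - s'))"
proof (induction k arbitrary: s s' y)
  case (Suc k)
  define e where "e = exp (- \<theta> * (s - s'))"
  have p: "0 \<le> s + h" "0 \<le> s' + h" "s' + h \<le> s + h" "s + h + real k * h \<le> T1" "s' + h + real k * h \<le> T1"
    using Suc.prems by (auto simp: algebra_simps)
  have "e * (\<integral>z. Q k h (s + h) (y + \<nu> * z - \<nu>\<^sup>2 / 2 * h) \<partial>gauss h)
     \<le> (\<integral>z. Q k h (s' + h) (y - L * (s - s') + \<nu> * z - \<nu>\<^sup>2 / 2 * h) \<partial>gauss h)"
    unfolding Bochner_Integration.integral_mult_right_zero[symmetric]
  proof (rule integral_mono)
    show "integrable (gauss h) (\<lambda>z. e * Q k h (s + h) (y + \<nu> * z - \<nu>\<^sup>2 / 2 * h))"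
      "integrable (gauss h) (\<lambda>z. Q k h (s' + h) (y - L * (s - s') + \<nu> * z - \<nu>\<^sup>2 / 2 * h))"
      using Suc.prems p by (auto intro!: Q_int)
    show "e * Q k h (s + h) (y + \<nu> * z - \<nu>\<^sup>2 / 2 * h) \<le> Q k h (s' + h) (y - L * (s - s') + \<nu> * z - \<nu>\<^sup>2 / 2 * h)" for z
      using Suc.IH[OF Suc.prems(1) p(2,3,4), of "y + \<nu> * z - \<nu>\<^sup>2 / 2 * h"] by (simp add: e_def algebra_simps)
  qed
  then have "e * cont k h s y \<le> cont k h s' (y - L * (s - s'))"
    using phi_time_shift[OF Suc.prems(3), of h y] unfolding cont_def e_def by (simp add: distrib_left)
  moreover have "e * max 0 (cont k h s y) = max 0 (e * cont k h s y)"
    unfolding e_def by (simp add: max_def zero_le_mult_iff)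
  ultimately show ?case unfolding Q_Suc e_def[symmetric] by (auto simp: max_def)
qed simp

lemma QY_int:
  assumes "0 < h" "0 \<le> s" "s + real k * h \<le> T1"
  shows "integrable N (\<lambda>\<omega>. Q k h s (Y t y u \<omega>))"
proof -
  note [measurable] = Q_meas[OF assms(1)]
  show ?thesis
    using Q_le[OF assms] Q_nonneg by (intro integrable_const_bound[where B = "real k * h * cmax"]) auto
qed

text \<open>The dynamic programming step, integrated over an event of the past so that it can be
  summed along a path.\<close>

lemma cont_step:
  assumes "0 \<le> t" "t \<le> s" "0 < h" "s + real (Suc k) * h \<le> T1" and A: "A \<in> sets (F s)"
  shows "(\<integral>\<omega>. indicator A \<omega> * cont k h s (Y t y s \<omega>) \<partial>N) =
      (\<integral>x. indicator A (fst x) * indicator {s..<s+h} (snd x) * fY t y x \<partial>PM)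
      + (\<integral>\<omega>. indicator A \<omega> * Q k h (s + h) (Y t y (s + h) \<omega>) \<partial>N)" (is ?eq)
    and "integrable N (\<lambda>\<omega>. indicator A \<omega> * cont k h s (Y t y s \<omega>))" (is ?int)
proof -
  have AN: "A \<in> sets N" using A F_sub by auto
  have p: "0 \<le> s" "0 \<le> s + h" "s + h + real k * h \<le> T1" using assms by (auto simp: algebra_simps)
  have "0 \<le> real k * h" using assms by simp
  then have sh: "s + h \<le> T1" using p by linarith
  note m = Q_meas[OF assms(3), of k "s + h"]
  note mk = Y_markov[OF assms(1,2,3) sh A m QY_int[OF assms(3) p(2,3)], of y]
  have i1: "integrable N (\<lambda>\<omega>. indicator A \<omega> * phi h s (Y t y s \<omega>))"
    using integrable_mult_indicator[OF AN phi_Y_int[OF assms(1,2), of h y]] sh assms(3) by simp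
  have eq: "indicator A \<omega> * cont k h s (Y t y s \<omega>) = indicator A \<omega> * phi h s (Y t y s \<omega>)
     + indicator A \<omega> * (\<integral>z. Q k h (s + h) (Y t y s \<omega> + \<nu> * z - \<nu>\<^sup>2 / 2 * h) \<partial>gauss h)" for \<omega>
    by (simp add: cont_def distrib_left)
  show ?int unfolding eq using i1 mk(2) by (rule Bochner_Integration.integrable_add)
  show ?eq unfolding eq Bochner_Integration.integral_add[OF i1 mk(2)]
    using mk(1) prod_phi[OF assms(1,2) _ sh A, of y] assms(3) by simp
qed

end

text \<open>At most one cell contains u. This converts the sums produced by the recursion into
  pointwise expressions, for which estimates and limits are taken.\<close>

lemma grid_sum:
  fixes g :: "nat \<Rightarrow> real"
  assumes h: "0 < h"
  shows "(\<Sum>i<k. g i * indicator {s + real i * h..<s + real i * h + h} u)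
    = (if s \<le> u \<and> u < s + real k * h then g (nat \<lfloor>(u - s) / h\<rfloor>) else 0)"
proof (induction k)
  case (Suc k)
  show ?case
  proof (cases "u \<in> {s + real k * h..<s + real k * h + h}")
    case True
    have "0 \<le> real k * h" using h by simp
    then have "s \<le> u" using True unfolding atLeastLessThan_iff by linarith
    moreover have "\<not> u < s + real k * h" "u < s + real (Suc k) * h"
      using True by (auto simp: algebra_simps)
    ultimately have su: "s \<le> u" "\<not> u < s + real k * h" "u < s + real (Suc k) * h" by auto
    have "\<lfloor>(u - s) / h\<rfloor> = int k"
      using True h by (intro floor_unique) (auto simp: field_simps)
    then show ?thesis using Suc True su by simp
  next
    case False
    then have "(s \<le> u \<and> u < s + real (Suc k) * h) \<longleftrightarrow> (s \<le> u \<and> u < s + real k * h)"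
      using h by (auto simp: algebra_simps)
    then show ?thesis using Suc False by simp
  qed
qed auto

context stopping_problem
begin

subsection \<open>Stopping times\<close>

definition stops :: "real \<Rightarrow> ('a \<Rightarrow> real) \<Rightarrow> bool" where
  "stops s \<tau> \<longleftrightarrow> stopping_time F \<tau> \<and> (\<forall>\<omega>\<in>space N. s \<le> \<tau> \<omega> \<and> \<tau> \<omega> \<le> T1)"

definition J :: "real \<Rightarrow> real \<Rightarrow> ('a \<Rightarrow> real) \<Rightarrow> real" where
  "J t y \<tau> = (\<integral>x. indicator {t..<\<tau> (fst x)} (snd x) * fY t y x \<partial>PM)"

text \<open>Stopping at once has gain 0, so a strict improvement amounts to one stopping time of
  positive gain; this avoids carrying a supremum along.\<close>

definition Cont :: "real \<Rightarrow> real \<Rightarrow> bool" where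
  "Cont s y \<longleftrightarrow> (\<exists>\<tau>. stops s \<tau> \<and> 0 < J s y \<tau>)"

lemma stopping_time_meas: "stopping_time F \<tau> \<Longrightarrow> \<tau> \<in> borel_measurable N"
  by (rule measurable_stopping_time[of F]) (use F_sub in auto)

lemma stop_indicator_meas:
  fixes t :: real
  assumes [measurable]: "\<tau> \<in> borel_measurable N"
  shows "(\<lambda>x. indicator {t..<\<tau> (fst x)} (snd x) :: real) \<in> borel_measurable (N \<Otimes>\<^sub>M borel)"
  unfolding indicator_def atLeastLessThan_iff by measurable

lemma space_NL: "x \<in> space PM \<longleftrightarrow> fst x \<in> space N"
  by (cases x) (simp add: space_pair_measure)

text \<open>Stop at s unless the continuation value is positive, and otherwise follow the optimal
  rule from \<open>s + h\<close>. The identity is tested on every event of \<open>F s\<close>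
  because the induction needs it on A cut down to the event of continuing.\<close>

lemma Q_attained:
  assumes "0 \<le> t" "0 < h"
  shows "t \<le> s \<Longrightarrow> s + real k * h \<le> T1 \<Longrightarrow>
    \<exists>\<tau>. stopping_time F \<tau> \<and> (\<forall>\<omega>\<in>space N. s \<le> \<tau> \<omega> \<and> \<tau> \<omega> \<le> s + real k * h) \<and>
      (\<forall>A\<in>sets (F s). (\<integral>x. indicator A (fst x) * indicator {s..<\<tau> (fst x)} (snd x) * fY t y x \<partial>PM)
        = (\<integral>\<omega>. indicator A \<omega> * Q k h s (Y t y s \<omega>) \<partial>N))"
proof (induction k arbitrary: s)
  case 0
  show ?case by (rule exI[of _ "\<lambda>_. s"]) (simp add: stopping_time_const)
next
  case (Suc k)
  have p: "t \<le> s + h" "s + h + real k * h \<le> T1" using Suc.prems assms by (auto simp: algebra_simps)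
  have kh: "0 \<le> real k * h" using assms by simp
  have sT: "s \<le> T1" using p assms kh by linarith
  from Suc.IH[OF p] obtain \<tau>' where \<tau>': "stopping_time F \<tau>'"
    "\<And>\<omega>. \<omega> \<in> space N \<Longrightarrow> s + h \<le> \<tau>' \<omega>" "\<And>\<omega>. \<omega> \<in> space N \<Longrightarrow> \<tau>' \<omega> \<le> s + h + real k * h"
    "\<And>A. A \<in> sets (F (s + h)) \<Longrightarrow> (\<integral>x. indicator A (fst x) * indicator {s+h..<\<tau>' (fst x)} (snd x) * fY t y x \<partial>PM)
        = (\<integral>\<omega>. indicator A \<omega> * Q k h (s + h) (Y t y (s + h) \<omega>) \<partial>N)"
    by blast
  \<comment> \<open>The event of continuing; it is decided at time s.\<close>
  define D where "D = {\<omega> \<in> space N. 0 < cont k h s (Y t y s \<omega>)}"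
  have Yad: "Y t y s \<in> borel_measurable (F s)" using assms Suc.prems sT by (intro Y_adapt) auto
  have "D = (\<lambda>\<omega>. cont k h s (Y t y s \<omega>)) -` {0<..} \<inter> space (F s)" by (auto simp: D_def)
  then have D: "D \<in> sets (F s)"
    using measurable_sets[OF measurable_compose[OF Yad cont_meas[OF assms(2), of k s]], of "{0<..}"] by simp
  define \<tau> where "\<tau> \<omega> = (if \<omega> \<in> D then \<tau>' \<omega> else s)" for \<omega>
  have \<tau>'m: "\<tau>' \<in> borel_measurable N" by (rule stopping_time_meas[OF \<tau>'(1)])
  show ?case
  proof (intro exI[of _ \<tau>] conjI ballI)
    show "stopping_time F \<tau>"
    proof (rule stopping_timeI)
      fix v
      show "Measurable.pred (F v) (\<lambda>\<omega>. \<tau> \<omega> \<le> v)"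
      proof (cases "s \<le> v")
        case True
        then have "D \<in> sets (F v)" using D F_mono by blast
        then have "Measurable.pred (F v) (\<lambda>\<omega>. (\<omega> \<in> D \<and> \<tau>' \<omega> \<le> v) \<or> \<not> (\<omega> \<in> D))"
          using stopping_timeD[OF \<tau>'(1), of v] by (intro pred_intros_logic pred_sets2[of _ "F v"]) auto
        moreover have "(\<lambda>\<omega>. \<tau> \<omega> \<le> v) = (\<lambda>\<omega>. (\<omega> \<in> D \<and> \<tau>' \<omega> \<le> v) \<or> \<not> (\<omega> \<in> D))"
          using True unfolding \<tau>_def by auto
        ultimately show ?thesis by simp
      next
        case False
        have "\<not> \<tau> \<omega> \<le> v" if "\<omega> \<in> space N" for \<omega>
          using \<tau>'(2)[OF that] False assms(2) unfolding \<tau>_def by auto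
        then have eq: "{\<omega> \<in> space (F v). \<tau> \<omega> \<le> v} = {}" by auto
        show ?thesis unfolding pred_def eq by simp
      qed
    qed
  next
    fix \<omega> assume w: "\<omega> \<in> space N"
    show "s \<le> \<tau> \<omega>" using \<tau>'(2)[OF w] assms unfolding \<tau>_def by auto
    have "0 \<le> real (Suc k) * h" using assms by simp
    then show "\<tau> \<omega> \<le> s + real (Suc k) * h" using \<tau>'(3)[OF w] assms unfolding \<tau>_def by (auto simp: algebra_simps)
  next
    fix A assume A: "A \<in> sets (F s)"
    have AD: "A \<inter> D \<in> sets (F s)" using A D by blast
    have AD': "A \<inter> D \<in> sets (F (s + h))" using AD F_mono[of s "s + h"] assms by auto
    have ADN[measurable]: "A \<inter> D \<in> sets N" using AD F_sub by auto
    define b1 where "b1 x = (indicator (A \<inter> D) (fst x) * indicator {s..<s+h} (snd x) :: real)" for x :: "'a \<times> real"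
    \<comment> \<open>The factor \<open>indicator {t..<T1}\<close> makes the bound demanded by
      \<open>fY_int\<close> hold also off \<open>space N\<close>, where nothing is known about the
      stopping time. On \<open>space PM\<close> it changes nothing.\<close>
    define b2 where "b2 x = (indicator (A \<inter> D) (fst x) * (indicator {s+h..<\<tau>' (fst x)} (snd x) * indicator {t..<T1} (snd x)) :: real)" for x :: "'a \<times> real"
    define b2' where "b2' x = (indicator (A \<inter> D) (fst x) * indicator {s+h..<\<tau>' (fst x)} (snd x) :: real)" for x :: "'a \<times> real"
    have b22: "b2 x = b2' x" if "x \<in> space PM" for x
      using \<tau>'(3)[of "fst x"] that p assms Suc.prems unfolding b2_def b2'_def space_NL
      by (auto split: split_indicator)
    have b1m: "b1 \<in> borel_measurable (N \<Otimes>\<^sub>M borel)"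
      unfolding b1_def by measurable
    have b2m: "b2 \<in> borel_measurable (N \<Otimes>\<^sub>M borel)"
      unfolding b2_def
      by (intro borel_measurable_times stop_indicator_meas[OF \<tau>'m]; measurable)
    have shT: "s + h \<le> T1" using p kh by linarith
    have i1: "integrable PM (\<lambda>x. b1 x * fY t y x)"
      using assms Suc.prems shT
      by (intro fY_int b1m) (auto simp: b1_def split: split_indicator)
    have i2: "integrable PM (\<lambda>x. b2 x * fY t y x)"
      using assms by (intro fY_int b2m) (auto simp: b2_def split: split_indicator)
    have "(\<integral>x. indicator A (fst x) * indicator {s..<\<tau> (fst x)} (snd x) * fY t y x \<partial>PM)
      = (\<integral>x. b1 x * fY t y x + b2 x * fY t y x \<partial>PM)"
    proof (intro Bochner_Integration.integral_cong refl)
      fix x :: "'a \<times> real" assume x: "x \<in> space PM"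
      then have "fst x \<in> space N" by (simp add: space_NL)
      then have "indicator A (fst x) * indicator {s..<\<tau> (fst x)} (snd x) = b1 x + b2' x"
        using \<tau>'(2)[of "fst x"] assms unfolding \<tau>_def b1_def b2'_def by (auto simp: indicator_def)
      then show "indicator A (fst x) * indicator {s..<\<tau> (fst x)} (snd x) * fY t y x = b1 x * fY t y x + b2 x * fY t y x"
        unfolding b22[OF x] by (simp add: distrib_right)
    qed
    also have "\<dots> = (\<integral>x. b1 x * fY t y x \<partial>PM) + (\<integral>x. b2' x * fY t y x \<partial>PM)"
      unfolding Bochner_Integration.integral_add[OF i1 i2]
      by (intro arg_cong2[of _ _ _ _ "(+)"] refl Bochner_Integration.integral_cong) (auto simp: b22)
    also have "\<dots> = (\<integral>\<omega>. indicator (A \<inter> D) \<omega> * cont k h s (Y t y s \<omega>) \<partial>N)"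
      unfolding b1_def b2'_def \<tau>'(4)[OF AD'] cont_step(1)[OF assms(1) Suc.prems(1) assms(2) Suc.prems(2) AD] ..
    also have "\<dots> = (\<integral>\<omega>. indicator A \<omega> * Q (Suc k) h s (Y t y s \<omega>) \<partial>N)"
      unfolding Q_Suc by (intro Bochner_Integration.integral_cong refl) (auto simp: D_def max_def indicator_def)
    finally show "(\<integral>x. indicator A (fst x) * indicator {s..<\<tau> (fst x)} (snd x) * fY t y x \<partial>PM)
      = (\<integral>\<omega>. indicator A \<omega> * Q (Suc k) h s (Y t y s \<omega>) \<partial>N)" .
  qed
qed

lemma Q_pos_imp_Cont:
  assumes "0 \<le> s" "0 < h" "s + real k * h \<le> T1" "0 < Q k h s y"
  shows "Cont s y"
proof -
  from Q_attained[OF assms(1,2) order_refl assms(3), of y] obtain \<tau> where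
    \<tau>: "stopping_time F \<tau>" "\<forall>\<omega>\<in>space N. s \<le> \<tau> \<omega> \<and> \<tau> \<omega> \<le> s + real k * h"
    "\<forall>A\<in>sets (F s). (\<integral>x. indicator A (fst x) * indicator {s..<\<tau> (fst x)} (snd x) * fY s y x \<partial>PM)
        = (\<integral>\<omega>. indicator A \<omega> * Q k h s (Y s y s \<omega>) \<partial>N)" by blast
  have sN: "space N \<in> sets (F s)" using sets.top[of "F s"] by simp
  have "J s y \<tau> = (\<integral>x. indicator (space N) (fst x) * indicator {s..<\<tau> (fst x)} (snd x) * fY s y x \<partial>PM)"
    unfolding J_def by (intro Bochner_Integration.integral_cong refl) (auto simp: space_NL)
  also have "\<dots> = (\<integral>\<omega>. indicator (space N) \<omega> * Q k h s (Y s y s \<omega>) \<partial>N)"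
    using \<tau>(3) sN by blast
  also have "\<dots> = (\<integral>\<omega>. Q k h s y \<partial>N)"
    by (intro Bochner_Integration.integral_cong refl) auto
  also have "\<dots> = Q k h s y" by (simp add: prob_space[simplified])
  finally show ?thesis
    unfolding Cont_def stops_def using \<tau>(1,2) assms(3,4) by (intro exI[of _ \<tau>]) fastforce
qed

text \<open>\<open>A i\<close> is the event that a rule is still running after the i-th date.
  Continuing is worth at most Q, and since Q is nonnegative the event may be enlarged from
  \<open>A (Suc 0)\<close> to \<open>A 0\<close> before the step back.\<close>

lemma grid_le_Q:
  assumes "0 \<le> t" "0 < h"
  shows "t \<le> s \<Longrightarrow> s + real k * h \<le> T1 \<Longrightarrow> (\<And>i. i < k \<Longrightarrow> A i \<in> sets (F (s + real i * h))) \<Longrightarrow> (\<And>i. A (Suc i) \<subseteq> A i) \<Longrightarrow>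
    (\<Sum>i<k. \<integral>x. indicator (A i) (fst x) * indicator {s + real i * h..<s + real i * h + h} (snd x) * fY t y x \<partial>PM)
     \<le> (\<integral>\<omega>. indicator (A 0) \<omega> * Q k h s (Y t y s \<omega>) \<partial>N)"
proof (induction k arbitrary: s A)
  case (Suc k)
  have p: "t \<le> s + h" "s + h + real k * h \<le> T1" "0 \<le> s + h" using Suc.prems assms by (auto simp: algebra_simps)
  have sh: "s + real (Suc i) * h = s + h + real i * h" for i by (simp add: algebra_simps)
  have A0: "A 0 \<in> sets (F s)" using Suc.prems(3)[of 0] by simp
  have A0N: "A 0 \<in> sets N" using A0 F_sub by auto
  have QI: "integrable N (\<lambda>\<omega>. Q k h (s + h) (Y t y (s + h) \<omega>))"
    using assms(2) p(3,2) by (rule QY_int)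
  have "(\<Sum>i<k. \<integral>x. indicator (A (Suc i)) (fst x) * indicator {s + h + real i * h..<s + h + real i * h + h} (snd x) * fY t y x \<partial>PM)
     \<le> (\<integral>\<omega>. indicator (A (Suc 0)) \<omega> * Q k h (s + h) (Y t y (s + h) \<omega>) \<partial>N)"
  proof (rule Suc.IH[OF p(1,2)])
    show "A (Suc i) \<in> sets (F (s + h + real i * h))" if "i < k" for i
      using Suc.prems(3)[of "Suc i"] that by (simp add: algebra_simps)
  qed (use Suc.prems in auto)
  also have "\<dots> \<le> (\<integral>\<omega>. indicator (A 0) \<omega> * Q k h (s + h) (Y t y (s + h) \<omega>) \<partial>N)"
  proof (cases k)
    case (Suc k')
    have "A (Suc 0) \<in> sets N" using Suc.prems(3)[of "Suc 0"] F_sub \<open>k = Suc k'\<close> by auto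
    then show ?thesis
      using integrable_mult_indicator[OF _ QI] A0N Suc.prems(4)[of 0] Q_nonneg
      by (intro integral_mono) (auto split: split_indicator)
  qed simp
  finally have 1: "(\<Sum>i<k. \<integral>x. indicator (A (Suc i)) (fst x) * indicator {s + h + real i * h..<s + h + real i * h + h} (snd x) * fY t y x \<partial>PM)
     \<le> (\<integral>\<omega>. indicator (A 0) \<omega> * Q k h (s + h) (Y t y (s + h) \<omega>) \<partial>N)" .
  note cs = cont_step[OF assms(1) Suc.prems(1) assms(2) Suc.prems(2) A0, of y]
  have QI0: "integrable N (\<lambda>\<omega>. indicator (A 0) \<omega> * Q (Suc k) h s (Y t y s \<omega>))"
    using integrable_mult_indicator[OF A0N QY_int[OF assms(2) _ Suc.prems(2)]] assms Suc.prems by simp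
  have "(\<integral>\<omega>. indicator (A 0) \<omega> * cont k h s (Y t y s \<omega>) \<partial>N) \<le> (\<integral>\<omega>. indicator (A 0) \<omega> * Q (Suc k) h s (Y t y s \<omega>) \<partial>N)"
    using cs(2) QI0 by (intro integral_mono) (auto simp: Q_Suc split: split_indicator simp del: Q.simps)
  then show ?case
    using 1 cs(1) unfolding sum.lessThan_Suc_shift sh by (simp del: Q.simps)
qed simp

text \<open>The free weight l trades a first moment over a thin strip for a second moment over the
  whole interval.\<close>

lemma mean_square_split: "0 < l \<Longrightarrow> x \<le> l + x\<^sup>2 / (l::real)"
proof -
  assume l: "0 < l"
  have "0 \<le> (x - l)\<^sup>2 + x\<^sup>2 + l\<^sup>2" by simp
  then have "x * l \<le> l\<^sup>2 + x\<^sup>2" by (simp add: power2_diff)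
  then show ?thesis using l by (simp add: field_simps power2_eq_square)
qed

text \<open>Rounding the stopping time up to the grid loses at most the negative part of f between
  it and the next date, which is bounded by \<open>exp Y\<close> on a strip of width h. The
  incomplete last cell before \<open>T1\<close> adds at most \<open>h * cmax\<close>. C may depend
  on the stopping time but not on the grid.\<close>

lemma J_le_Q:
  assumes "0 \<le> s" "stops s \<tau>"
  obtains C where "0 \<le> C" "\<And>h k. 0 < h \<Longrightarrow> h \<le> 1 \<Longrightarrow> s + real k * h \<le> T1 \<Longrightarrow> T1 \<le> s + real k * h + h \<Longrightarrow>
    J s y \<tau> \<le> Q k h s y + C * sqrt h"
proof -
  define K2 where "K2 = (\<integral>x. indicator {s..<T1} (snd x) * exp (2 * Y s y (snd x) (fst x)) \<partial>PM)"
  have K2: "0 \<le> K2" unfolding K2_def by simp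
  have st: "stopping_time F \<tau>" and \<tau>b: "\<And>\<omega>. \<omega> \<in> space N \<Longrightarrow> s \<le> \<tau> \<omega> \<and> \<tau> \<omega> \<le> T1"
    using assms(2) by (auto simp: stops_def)
  have \<tau>m[measurable]: "\<tau> \<in> borel_measurable N" by (rule stopping_time_meas[OF st])
  show thesis
  proof (rule that[of "cmax * amax * (1 + K2) + cmax"])
    show "0 \<le> cmax * amax * (1 + K2) + cmax" using K2 cmax_pos amax_pos by simp
    fix h k assume h: "0 < h" "h \<le> 1" and k1: "s + real k * h \<le> T1" and k2: "T1 \<le> s + real k * h + h"
    \<comment> \<open>This choice balances \<open>l * h\<close> against \<open>K2 / l\<close>: both
      are of order \<open>sqrt h\<close>.\<close>
    define l where "l = 1 / sqrt h"
    have l: "0 < l" using h by (simp add: l_def)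
    \<comment> \<open>A cell is run through in full when the rule is still alive strictly after its
      left end, which is rounding up.\<close>
    define A where "A i = {\<omega> \<in> space N. s + real i * h < \<tau> \<omega>}" for i
    have AF: "A i \<in> sets (F (s + real i * h))" for i
      using stopping_timeD2[OF st, of "s + real i * h"] by (simp add: A_def pred_def)
    have AN[measurable]: "A i \<in> sets N" for i using AF F_sub by blast
    have As: "A (Suc i) \<subseteq> A i" for i using h by (auto simp: A_def algebra_simps)
    define g where "g i x = indicator (A i) (fst x) * indicator {s + real i * h..<s + real i * h + h} (snd x) * fY s y x" for i x
    have gi: "integrable PM (g i)" if "i < k" for i
      unfolding g_def
    proof (rule fY_int[OF assms(1)])
      have "real (Suc i) * h \<le> real k * h" using that h by (intro mult_right_mono) auto
      then have "s + real i * h + h \<le> T1" using k1 by (simp add: algebra_simps)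
      moreover have "0 \<le> real i * h" using h by simp
      ultimately show "\<bar>indicator (A i) (fst x) * indicator {s + real i * h..<s + real i * h + h} (snd x)\<bar> \<le> (indicator {s..<T1} (snd x) :: real)" for x :: "'a \<times> real"
        by (auto split: split_indicator)
    qed measurable
    \<comment> \<open>\<open>e1\<close> marks the overshoot strip after \<tau>, \<open>e2\<close>
      carries the second moment, and \<open>e3\<close> marks the incomplete last cell.\<close>
    define e1 where "e1 x = (indicator {\<tau> (fst x)..<\<tau> (fst x) + h} (snd x) :: real)" for x :: "'a \<times> real"
    define e2 where "e2 x = (indicator {s..<T1} (snd x) * exp (2 * Y s y (snd x) (fst x)) :: real)" for x :: "'a \<times> real"
    define e3 where "e3 x = (indicator {s + real k * h..<s + real k * h + h} (snd x) :: real)" for x :: "'a \<times> real"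
    have e1m[measurable]: "e1 \<in> borel_measurable (N \<Otimes>\<^sub>M borel)"
      unfolding e1_def indicator_def atLeastLessThan_iff by measurable
    have e1: "has_bochner_integral PM e1 h"
    proof (rule has_bochner_integral_nn_integral)
      have "(\<integral>\<^sup>+x. ennreal (e1 x) \<partial>PM) = (\<integral>\<^sup>+\<omega>. \<integral>\<^sup>+u. ennreal (e1 (\<omega>, u)) \<partial>lborel \<partial>N)"
        by (subst lborel.nn_integral_fst[symmetric]) auto
      also have "\<dots> = (\<integral>\<^sup>+\<omega>. ennreal h \<partial>N)"
        unfolding e1_def fst_conv snd_conv ennreal_indicator using h by (intro nn_integral_cong) simp
      also have "\<dots> = h" by (simp add: emeasure_space_1)
      finally show "(\<integral>\<^sup>+x. ennreal (e1 x) \<partial>PM) = h" .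
    qed (use h in \<open>auto simp: e1_def\<close>)
    have e3: "has_bochner_integral PM e3 h"
    proof (rule has_bochner_integral_nn_integral)
      have "(\<integral>\<^sup>+x. ennreal (e3 x) \<partial>PM) = (\<integral>\<^sup>+\<omega>. \<integral>\<^sup>+u. ennreal (e3 (\<omega>, u)) \<partial>lborel \<partial>N)"
        by (subst lborel.nn_integral_fst[symmetric]) (auto simp: e3_def)
      also have "\<dots> = (\<integral>\<^sup>+\<omega>. ennreal h \<partial>N)"
        unfolding e3_def fst_conv snd_conv ennreal_indicator using h by (intro nn_integral_cong) simp
      also have "\<dots> = h" by (simp add: emeasure_space_1)
      finally show "(\<integral>\<^sup>+x. ennreal (e3 x) \<partial>PM) = h" .
      show "e3 \<in> borel_measurable PM" unfolding e3_def by measurable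
    qed (use h in \<open>auto simp: e3_def\<close>)
    have e2: "integrable PM e2" "(\<integral>x. e2 x \<partial>PM) = K2"
      using prod_expY_int[OF assms(1), of 2 y] unfolding e2_def K2_def by auto
    have e2h: "has_bochner_integral PM e2 K2"
      using e2 by (simp add: has_bochner_integral_iff)
    have hb: "has_bochner_integral PM (\<lambda>x. (\<Sum>i<k. g i x) + (cmax * amax * (l * e1 x + e2 x / l) + cmax * e3 x))
      ((\<Sum>i<k. \<integral>x. g i x \<partial>PM) + (cmax * amax * (l * h + K2 / l) + cmax * h))"
      by (intro has_bochner_integral_add has_bochner_integral_sum has_bochner_integral_mult_right
          has_bochner_integral_divide_zero e1 e2h e3 has_bochner_integral_integrable gi) auto
    have bm: "(\<lambda>x. indicator ({s..<\<tau> (fst x)} \<inter> {s..<T1}) (snd x) :: real) \<in> borel_measurable (N \<Otimes>\<^sub>M borel)"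
      unfolding indicator_inter_arith by (intro borel_measurable_times stop_indicator_meas[OF \<tau>m]) measurable
    have Ji: "integrable PM (\<lambda>x. indicator ({s..<\<tau> (fst x)} \<inter> {s..<T1}) (snd x) * fY s y x)"
      by (rule fY_int[OF assms(1) bm]) (auto split: split_indicator)
    have "J s y \<tau> = (\<integral>x. indicator ({s..<\<tau> (fst x)} \<inter> {s..<T1}) (snd x) * fY s y x \<partial>PM)"
      unfolding J_def
      by (intro Bochner_Integration.integral_cong refl) (auto simp: space_NL split: split_indicator dest!: \<tau>b)
    also have "\<dots> \<le> (\<integral>x. (\<Sum>i<k. g i x) + (cmax * amax * (l * e1 x + e2 x / l) + cmax * e3 x) \<partial>PM)"
    proof (rule integral_mono_AE[OF Ji _ AE_I2])
      show "integrable PM (\<lambda>x. (\<Sum>i<k. g i x) + (cmax * amax * (l * e1 x + e2 x / l) + cmax * e3 x))"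
        using hb by (simp add: has_bochner_integral_iff)
      fix x :: "'a \<times> real" assume "x \<in> space PM"
      then have \<tau>x: "s \<le> \<tau> (fst x)" "\<tau> (fst x) \<le> T1" "fst x \<in> space N" using \<tau>b by (auto simp: space_NL)
      define u where "u = snd x"
      have e_nonneg: "0 \<le> cmax * amax * (l * e1 x + e2 x / l)" "0 \<le> cmax * e3 x"
        using l cmax_pos amax_pos by (auto simp: e1_def e2_def e3_def)
      have sumg: "(\<Sum>i<k. g i x) = (if s \<le> u \<and> u < s + real k * h then indicator (A (nat \<lfloor>(u - s) / h\<rfloor>)) (fst x) * fY s y x else 0)"
        using grid_sum[OF h(1), where k = k and s = s and u = u and g = "\<lambda>i. indicator (A i) (fst x) * fY s y x"]
        unfolding g_def u_def by (simp add: ac_simps)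
      have lower: "- (cmax * amax * (l * e1 x + e2 x / l)) \<le> fY s y x" if "s \<le> u" "u < T1" "\<tau> (fst x) \<le> u" "u < \<tau> (fst x) + h"
      proof -
        have u0: "0 \<le> u" "u \<le> T1" using that assms by auto
        have "- fY s y x \<le> exp (\<theta> * u) * (a u * exp (Y s y u (fst x)))"
          by (simp add: fY_def f_def u_def algebra_simps)
        also have "\<dots> \<le> cmax * (amax * exp (Y s y u (fst x)))"
          using exp_theta_le[OF u0] a_le[of u] a_pos[of u] cmax_pos amax_pos
          by (intro mult_mono mult_right_mono) (auto simp: less_imp_le)
        also have "\<dots> \<le> cmax * (amax * (l + (exp (Y s y u (fst x)))\<^sup>2 / l))"
          using cmax_pos amax_pos by (intro mult_left_mono mean_square_split[OF l]) auto
        also have "\<dots> = cmax * amax * (l * e1 x + e2 x / l)"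
          using that by (simp add: e1_def e2_def u_def exp_double[symmetric])
        finally show ?thesis by simp
      qed
      show "indicator ({s..<\<tau> (fst x)} \<inter> {s..<T1}) (snd x) * fY s y x
        \<le> (\<Sum>i<k. g i x) + (cmax * amax * (l * e1 x + e2 x / l) + cmax * e3 x)"
      proof (cases "s \<le> u \<and> u < T1")
        case out: False
        then have "(\<Sum>i<k. g i x) = 0" using sumg k1 by auto
        then show ?thesis using out e_nonneg by (simp add: u_def[symmetric])
      next
        case in': True
        show ?thesis
        proof (cases "u < s + real k * h")
          case True
          define i where "i = nat \<lfloor>(u - s) / h\<rfloor>"
          have "0 \<le> (u - s) / h" using in' h by simp
          then have ri: "real i = of_int \<lfloor>(u - s) / h\<rfloor>" unfolding i_def by simp
          have "real i \<le> (u - s) / h" "(u - s) / h < real i + 1" unfolding ri by linarith+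
          then have iu: "s + real i * h \<le> u" "u < s + real i * h + h" using h by (auto simp: field_simps)
          have S: "(\<Sum>i<k. g i x) = indicator (A i) (fst x) * fY s y x"
            using sumg True in' by (simp add: i_def)
          show ?thesis
          proof (cases "s + real i * h < \<tau> (fst x)")
            case T: True
            then have S': "(\<Sum>i<k. g i x) = fY s y x" using S \<tau>x by (simp add: A_def)
            show ?thesis
            proof (cases "u < \<tau> (fst x)")
              case True
              then show ?thesis unfolding S' using in' e_nonneg by (simp add: u_def[symmetric])
            next
              case False
              then show ?thesis unfolding S' using in' e_nonneg lower T iu by (simp add: u_def[symmetric])
            qed
          next
            case F: False
            then have S': "(\<Sum>i<k. g i x) = 0" using S by (simp add: A_def)
            show ?thesis unfolding S' using F iu e_nonneg by (simp add: u_def[symmetric])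
          qed
        next
          case False
          have e3': "e3 x = 1" using False in' k2 by (simp add: e3_def u_def)
          have S': "(\<Sum>i<k. g i x) = 0" using sumg False by simp
          have "fY s y x \<le> cmax" unfolding fY_def using in' assms by (intro f_le) (auto simp: u_def)
          then show ?thesis unfolding S' e3' using e_nonneg cmax_pos by (simp split: split_indicator)
        qed
      qed
    qed
    also have "\<dots> = (\<Sum>i<k. \<integral>x. g i x \<partial>PM) + (cmax * amax * (l * h + K2 / l) + cmax * h)"
      using has_bochner_integral_integral_eq[OF hb] .
    also have "(\<Sum>i<k. \<integral>x. g i x \<partial>PM) \<le> (\<integral>\<omega>. indicator (A 0) \<omega> * Q k h s (Y s y s \<omega>) \<partial>N)"
      unfolding g_def using k1 AF As by (intro grid_le_Q[OF assms(1) h(1)]) auto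
    also have "(\<integral>\<omega>. indicator (A 0) \<omega> * Q k h s (Y s y s \<omega>) \<partial>N) \<le> (\<integral>\<omega>. Q k h s y \<partial>N)"
      using Q_nonneg[of k h s y] by (intro integral_mono) (auto split: split_indicator simp: less_top[symmetric])
    also have "\<dots> = Q k h s y" by (simp add: prob_space[simplified])
    also have "Q k h s y + (cmax * amax * (l * h + K2 / l) + cmax * h) \<le> Q k h s y + (cmax * amax * (1 + K2) + cmax) * sqrt h"
    proof -
      have lh: "l * h = sqrt h" unfolding l_def using h by (simp add: real_div_sqrt)
      have "h \<le> sqrt h" using h by (intro real_le_rsqrt) (simp add: power2_eq_square mult_left_le)
      then have "cmax * h \<le> cmax * sqrt h" using cmax_pos by simp
      then show ?thesis unfolding lh by (simp add: l_def algebra_simps)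
    qed
    finally show "J s y \<tau> \<le> Q k h s y + (cmax * amax * (1 + K2) + cmax) * sqrt h" by simp
  qed
qed

end

section \<open>Continuation region and Bermudan values; behaviour near the horizon\<close>

context stopping_problem
begin

text \<open>A fixed stopping time of positive gain keeps it up to \<open>C * sqrt h\<close>, so
  every sufficiently fine grid that fills the interval up to its last incomplete cell sees
  it.\<close>

lemma Cont_imp_Q_pos:
  assumes "0 \<le> s" "Cont s y"
  obtains H where "0 < H" "\<And>h k. 0 < h \<Longrightarrow> h < H \<Longrightarrow> s + real k * h \<le> T1 \<Longrightarrow> T1 \<le> s + real k * h + h \<Longrightarrow> 0 < Q k h s y"
proof -
  from assms(2) obtain \<tau> where \<tau>: "stops s \<tau>" "0 < J s y \<tau>" by (auto simp: Cont_def)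
  from J_le_Q[OF assms(1) \<tau>(1), of y] obtain C where C: "0 \<le> C"
    "\<And>h k. 0 < h \<Longrightarrow> h \<le> 1 \<Longrightarrow> s + real k * h \<le> T1 \<Longrightarrow> T1 \<le> s + real k * h + h \<Longrightarrow> J s y \<tau> \<le> Q k h s y + C * sqrt h"
    by blast
  define q where "q = J s y \<tau> / (C + 1)"
  have q: "0 < q" using \<tau> C by (simp add: q_def)
  show thesis
  proof (rule that[of "min 1 (q\<^sup>2)"])
    show "0 < min 1 (q\<^sup>2)" using q by simp
    fix h k assume h: "0 < h" "h < min 1 (q\<^sup>2)" and k: "s + real k * h \<le> T1" "T1 \<le> s + real k * h + h"
    have "sqrt h < q" using h q by (intro real_less_lsqrt) auto
    then have "C * sqrt h \<le> C * q" using C by (intro mult_left_mono) auto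
    also have "\<dots> < J s y \<tau>" using q C by (simp add: q_def field_simps \<tau>)
    finally show "0 < Q k h s y" using C(2)[of h k] h k by simp
  qed
qed

lemma stops_le: "stops s \<tau> \<Longrightarrow> s \<le> T1"
  using not_empty by (fastforce simp: stops_def)

lemma grid_steps_exist:
  assumes "0 < h" "s \<le> T1"
  obtains k where "s + real k * h \<le> T1" "T1 \<le> s + real k * h + h"
proof -
  define k where "k = nat \<lfloor>(T1 - s) / h\<rfloor>"
  have "0 \<le> (T1 - s) / h" using assms by simp
  then have ri: "real k = of_int \<lfloor>(T1 - s) / h\<rfloor>" by (simp add: k_def)
  have "real k \<le> (T1 - s) / h" "(T1 - s) / h \<le> real k + 1" unfolding ri by linarith+
  then show thesis
    using assms by (intro that[of k]) (auto simp: field_simps)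
qed

text \<open>The shift is carried out in the Bermudan problem, where the recursion allows an
  induction; a single fine grid suffices to go there and back.\<close>

lemma Cont_time_shift:
  assumes "0 \<le> s'" "s' \<le> s" "Cont s y"
  shows "Cont s' (y - L * (s - s'))"
proof -
  have s0: "0 \<le> s" using assms by simp
  have sT: "s \<le> T1" using assms(3) stops_le by (auto simp: Cont_def)
  obtain H where H: "0 < H" "\<And>h k. 0 < h \<Longrightarrow> h < H \<Longrightarrow> s + real k * h \<le> T1 \<Longrightarrow> T1 \<le> s + real k * h + h \<Longrightarrow> 0 < Q k h s y"
    using Cont_imp_Q_pos[OF s0 assms(3)] by blast
  have h: "0 < H / 2" using H by simp
  obtain k where k: "s + real k * (H / 2) \<le> T1" "T1 \<le> s + real k * (H / 2) + H / 2"
    using grid_steps_exist[OF h sT] by blast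
  have "0 < exp (- \<theta> * (s - s')) * Q k (H / 2) s y" using H(2)[OF h _ k] h by simp
  also have "\<dots> \<le> Q k (H / 2) s' (y - L * (s - s'))" by (rule Q_time_shift[OF h assms(1,2) k(1)])
  finally show ?thesis
    using k assms by (intro Q_pos_imp_Cont[OF assms(1) h]) auto
qed

lemma isCont_f: "isCont (\<lambda>u. f u y) s"
  unfolding f_def using a_cont by (intro continuous_intros) (auto simp: continuous_on_eq_continuous_at)

text \<open>By continuity f stays positive for a while with the state frozen, and one grid step that
  short already has positive value.\<close>

lemma Cont_if_f_pos:
  assumes "0 \<le> s" "s < T1" "a s * exp y < 1"
  shows "Cont s y"
proof -
  have pos: "0 < f s y" using assms(3) by (simp add: f_def)
  have "\<forall>\<^sub>F u in at s. f s y / 2 < f u y"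
    using isCont_f[of s y] pos unfolding isCont_def by (elim order_tendstoD(1)) auto
  then obtain d where d: "0 < d" "\<And>u. u \<noteq> s \<Longrightarrow> dist u s < d \<Longrightarrow> f s y / 2 < f u y"
    unfolding eventually_at by auto
  define h where "h = min d (T1 - s)"
  have h: "0 < h" "s + h \<le> T1" and hd: "h \<le> d" using d assms by (auto simp: h_def)
  have "(\<integral>u. indicator {s..<s+h} u * (f s y / 2) \<partial>lborel) \<le> phi h s y"
    unfolding phi_eq
  proof (intro integral_mono f_integrable)
    show "indicator {s..<s+h} u * (f s y / 2) \<le> indicator {s..<s+h} u * f u y" for u
      using d(2)[of u] pos hd by (cases "u = s") (auto simp: dist_real_def split: split_indicator)
  qed (auto intro!: cont_interval_int continuous_on_const simp: integrable_mult_left)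
  moreover have "(\<integral>u. indicator {s..<s+h} u * (f s y / 2) \<partial>lborel) = h * (f s y / 2)"
    using h by simp
  moreover have "0 < h * (f s y / 2)" using h pos by simp
  ultimately have "0 < phi h s y" by linarith
  then have "0 < Q 1 h s y" by simp
  then show ?thesis using h by (intro Q_pos_imp_Cont[OF assms(1) h(1), of 1]) auto
qed

text \<open>The Bermudan values are dominated by a multiple of the squared Brownian displacement,
  which vanishes at the starting point.\<close>

lemma not_Cont_near_horizon:
  assumes "1 < a T1 * exp y"
  obtains s0 where "s0 < T1" "\<And>s. 0 \<le> s \<Longrightarrow> s0 < s \<Longrightarrow> s < T1 \<Longrightarrow> \<not> Cont s y"
proof -
  \<comment> \<open>The midpoint between y and \<open>- ln (a T1)\<close>, the level at which f
    changes sign at the horizon. So f stays negative above y1, and y keeps a positive distance from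
    y1.\<close>
  define y1 where "y1 = y - ln (a T1 * exp y) / 2"
  have ln: "0 < ln (a T1 * exp y)" using assms by simp
  have y1: "y1 < y" using ln by (simp add: y1_def)
  define q where "q = (y - y1) / 2"
  have q: "0 < q" using y1 by (simp add: q_def)
  have "ln (a T1 * exp y1) = ln (a T1 * exp y) / 2"
    using a_pos[of T1] by (simp add: ln_mult y1_def field_simps)
  then have gt: "1 < a T1 * exp y1" using ln a_pos[of T1]
    by (metis half_gt_zero_iff ln_gt_zero_iff mult_pos_pos exp_gt_zero)
  define e where "e = (a T1 * exp y1 - 1) / 2"
  have e: "0 < e" using gt by (simp add: e_def)
  have "isCont (\<lambda>u. a u * exp y1) T1"
    using a_cont by (intro continuous_intros) (auto simp: continuous_on_eq_continuous_at)
  then have "\<forall>\<^sub>F u in at T1. 1 + e < a u * exp y1"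
    using gt unfolding isCont_def by (elim order_tendstoD(1)) (auto simp: e_def field_simps)
  then obtain d where d: "0 < d" "\<And>u. u \<noteq> T1 \<Longrightarrow> dist u T1 < d \<Longrightarrow> 1 + e < a u * exp y1"
    unfolding eventually_at by auto
  define k0 where "k0 = e / cmax"
  have k0: "0 < k0" using e cmax_pos by (simp add: k0_def)
  \<comment> \<open>A makes \<open>A * w^2\<close> at least \<open>cmax + k0\<close> once
    \<open>\<bar>\<nu> * w\<bar>\<close> reaches q. That covers the states that may have fallen
    below y1, where only the bound by \<open>cmax\<close> is available.\<close>
  define A where "A = (cmax + k0) * \<nu>\<^sup>2 / q\<^sup>2"
  have A: "0 \<le> A" using k0 cmax_pos by (simp add: A_def)
  have f_neg: "f u x \<le> - k0" if "0 \<le> u" "T1 - d < u" "u < T1" "y1 \<le> x" for u x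
  proof -
    have "1 + e < a u * exp y1" using that d by (auto simp: dist_real_def)
    also have "\<dots> \<le> a u * exp x" using that a_pos[of u] by simp
    finally have 1: "1 - a u * exp x \<le> - e" by simp
    have "\<bar>\<theta> * u\<bar> \<le> \<bar>\<theta>\<bar> * T1" unfolding abs_mult using that by (intro mult_left_mono) auto
    then have "1 / cmax \<le> exp (\<theta> * u)" unfolding cmax_def inverse_eq_divide[symmetric] exp_minus[symmetric] by auto
    then have "e * (1 / cmax) \<le> e * exp (\<theta> * u)" using e by (intro mult_left_mono) auto
    moreover have "f u x \<le> exp (\<theta> * u) * (- e)" unfolding f_def using 1 by (intro mult_left_mono) auto
    ultimately show ?thesis unfolding k0_def by (simp add: mult.commute)
  qed
  \<comment> \<open>The three terms ensure in turn that f is at most \<open>- k0\<close> above y1,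
    that \<open>A * (T1 - s)\<close> is at most k0, and that the drift uses up at most half of
    \<open>y - y1\<close>.\<close>
  define s0 where "s0 = T1 - min d (min (k0 / (A + 1)) ((y - y1) / (\<nu>\<^sup>2 + 1)))"
  show thesis
  proof (rule that[of s0])
    show "s0 < T1" using d k0 A y1 by (simp add: s0_def add_nonneg_pos)
    fix s assume s: "0 \<le> s" "s0 < s" "s < T1"
    have sd: "T1 - d < s" using s by (simp add: s0_def)
    have "T1 - s < k0 / (A + 1)" using s by (auto simp: s0_def)
    then have sA: "A * (T1 - s) \<le> k0" using A s by (simp add: field_simps)
    have "T1 - s < (y - y1) / (\<nu>\<^sup>2 + 1)" using s by (auto simp: s0_def)
    then have "(T1 - s) * (\<nu>\<^sup>2 + 1) < y - y1" by (simp add: pos_less_divide_eq add_nonneg_pos)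
    then have sn: "\<nu>\<^sup>2 * (T1 - s) \<le> y - y1" using s by (simp add: algebra_simps)
    have phi_super: "phi h v (y + \<nu> * w - \<nu>\<^sup>2 / 2 * (v - s)) \<le> h * (- k0 + A * w\<^sup>2)"
      if v: "0 < h" "s \<le> v" "v + h \<le> T1" for h v w
    proof (cases "y1 \<le> y + \<nu> * w - \<nu>\<^sup>2 / 2 * (v - s)")
      case True
      have "phi h v (y + \<nu> * w - \<nu>\<^sup>2 / 2 * (v - s)) \<le> (\<integral>u. indicator {v..<v+h} u * (- k0) \<partial>lborel)"
        unfolding phi_eq using v s sd True
        by (intro integral_mono f_integrable)
          (auto intro!: cont_interval_int continuous_on_const f_neg split: split_indicator)
      also have "\<dots> = h * (- k0)" using v by simp
      also have "\<dots> \<le> h * (- k0 + A * w\<^sup>2)" using v A by (intro mult_left_mono) auto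
      finally show ?thesis .
    next
      case False
      define r where "r = \<nu>\<^sup>2 / 2 * (v - s)"
      have "r \<le> \<nu>\<^sup>2 / 2 * (T1 - s)" unfolding r_def using v by (intro mult_left_mono) auto
      also have "\<dots> \<le> (y - y1) / 2" using sn by simp
      finally have "\<nu> * w \<le> - q" using False unfolding q_def r_def[symmetric] by (simp add: field_simps)
      then have "q\<^sup>2 \<le> (\<nu> * w)\<^sup>2" using q by (intro abs_le_square_iff[THEN iffD1]) auto
      then have "1 \<le> \<nu>\<^sup>2 * w\<^sup>2 / q\<^sup>2" using q by (simp add: power_mult_distrib)
      then have "(cmax + k0) * 1 \<le> (cmax + k0) * (\<nu>\<^sup>2 * w\<^sup>2 / q\<^sup>2)" using cmax_pos k0 by (intro mult_left_mono) auto
      also have "\<dots> = A * w\<^sup>2" by (simp add: A_def)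
      finally have "h * cmax \<le> h * (- k0 + A * w\<^sup>2)" using v by (intro mult_left_mono) auto
      moreover have "phi h v (y + \<nu> * w - \<nu>\<^sup>2 / 2 * (v - s)) \<le> h * cmax"
        using v s by (intro phi_le) auto
      ultimately show ?thesis by simp
    qed
    \<comment> \<open>w is the Brownian displacement since s. Averaging \<open>w^2\<close> over one
      step adds h, and the resulting term \<open>A * k * h * h\<close> is paid for by
      \<open>- k0 * h\<close> from the reward. At w = 0 the bound is 0.\<close>
    have Q_super: "0 < h \<Longrightarrow> s \<le> v \<Longrightarrow> v + real k * h \<le> T1 \<Longrightarrow>
      Q k h v (y + \<nu> * w - \<nu>\<^sup>2 / 2 * (v - s)) \<le> A * (real k * h) * w\<^sup>2" for h k v w
    proof (induction k arbitrary: v w)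
      case (Suc k)
      have p: "s \<le> v + h" "v + h + real k * h \<le> T1" "0 \<le> v + h" using Suc.prems s by (auto simp: algebra_simps)
      have kh: "0 \<le> real k * h" using Suc.prems by simp
      have vh: "v + h \<le> T1" using p kh by linarith
      note h = Suc.prems(1)
      interpret G: prob_space "gauss h" using h by (rule prob_space_gauss)
      have i2: "integrable (gauss h) (\<lambda>z. z\<^sup>2)" "integrable (gauss h) (\<lambda>z. z)"
        using gauss_moment(1)[OF h, of 2] gauss_moment(1)[OF h, of 1] by auto
      have m2: "(\<integral>z. z\<^sup>2 \<partial>gauss h) = h"
        using gauss_moment(2)[OF h, of 1] by (simp add: numeral_2_eq_2)
      have hb: "has_bochner_integral (gauss h) (\<lambda>z. A * (real k * h) * (w\<^sup>2 + (2 * w * z + z\<^sup>2)))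
          (A * (real k * h) * (w\<^sup>2 + (2 * w * 0 + h)))"
        using i2 m2 gauss_moment(3)[OF h] G.prob_space
        by (intro has_bochner_integral_mult_right has_bochner_integral_add)
          (auto simp: has_bochner_integral_iff)
      have "(\<integral>z. Q k h (v + h) (y + \<nu> * w - \<nu>\<^sup>2 / 2 * (v - s) + \<nu> * z - \<nu>\<^sup>2 / 2 * h) \<partial>gauss h)
         \<le> (\<integral>z. A * (real k * h) * (w\<^sup>2 + (2 * w * z + z\<^sup>2)) \<partial>gauss h)"
      proof (rule integral_mono)
        show "integrable (gauss h) (\<lambda>z. Q k h (v + h) (y + \<nu> * w - \<nu>\<^sup>2 / 2 * (v - s) + \<nu> * z - \<nu>\<^sup>2 / 2 * h))"
          by (rule Q_int[OF h p(3,2)])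
        show "integrable (gauss h) (\<lambda>z. A * (real k * h) * (w\<^sup>2 + (2 * w * z + z\<^sup>2)))"
          using hb by (simp add: has_bochner_integral_iff)
        fix z
        have eqy: "y + \<nu> * w - \<nu>\<^sup>2 / 2 * (v - s) + \<nu> * z - \<nu>\<^sup>2 / 2 * h = y + \<nu> * (w + z) - \<nu>\<^sup>2 / 2 * (v + h - s)"
          by (simp add: algebra_simps add_divide_distrib diff_divide_distrib)
        have eqw: "w\<^sup>2 + (2 * w * z + z\<^sup>2) = (w + z)\<^sup>2" by (simp add: power2_sum)
        show "Q k h (v + h) (y + \<nu> * w - \<nu>\<^sup>2 / 2 * (v - s) + \<nu> * z - \<nu>\<^sup>2 / 2 * h) \<le> A * (real k * h) * (w\<^sup>2 + (2 * w * z + z\<^sup>2))"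
          unfolding eqy eqw by (rule Suc.IH[OF h p(1,2)])
      qed
      also have "\<dots> = A * (real k * h) * (w\<^sup>2 + h)" using has_bochner_integral_integral_eq[OF hb] by simp
      finally have 1: "cont k h v (y + \<nu> * w - \<nu>\<^sup>2 / 2 * (v - s)) \<le> h * (- k0 + A * w\<^sup>2) + A * (real k * h) * (w\<^sup>2 + h)"
        unfolding cont_def using phi_super[OF h Suc.prems(2) vh, of w] by simp
      have "A * (real k * h) \<le> A * (T1 - s)" using A p Suc.prems h by (intro mult_left_mono) auto
      then have "h * (A * (real k * h)) \<le> h * k0" using sA h by (intro mult_left_mono) auto
      then have "h * (- k0 + A * w\<^sup>2) + A * (real k * h) * (w\<^sup>2 + h) \<le> A * (real (Suc k) * h) * w\<^sup>2"
        by (simp add: algebra_simps)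
      moreover have "0 \<le> A * (real (Suc k) * h) * w\<^sup>2" using A h by (intro mult_nonneg_nonneg) auto
      ultimately show ?case unfolding Q_Suc using 1 by simp
    qed simp
    show "\<not> Cont s y"
    proof
      assume C: "Cont s y"
      obtain H where H: "0 < H" "\<And>h k. 0 < h \<Longrightarrow> h < H \<Longrightarrow> s + real k * h \<le> T1 \<Longrightarrow> T1 \<le> s + real k * h + h \<Longrightarrow> 0 < Q k h s y"
        using Cont_imp_Q_pos[OF s(1) C] by blast
      have h: "0 < H / 2" using H by simp
      obtain k where k: "s + real k * (H / 2) \<le> T1" "T1 \<le> s + real k * (H / 2) + H / 2"
        using grid_steps_exist[OF h] s by (metis less_imp_le)
      have "0 < Q k (H / 2) s y" using H(2)[OF h _ k] h by simp
      moreover have "Q k (H / 2) s y \<le> 0" using Q_super[OF h order_refl k(1), of 0] by simp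
      ultimately show False by simp
    qed
  qed
qed


subsection \<open>Optional stopping of the exponential martingale\<close>

text \<open>Truncating at l costs at most the second moment divided by l.\<close>

lemma min_ge_minus_square:
  fixes z l :: real
  assumes "0 < l" "0 \<le> z"
  shows "z - z\<^sup>2 / l \<le> min z l"
proof (cases "z \<le> l")
  case False
  then have "z * l \<le> z\<^sup>2" using assms by (simp add: power2_eq_square)
  then have "z \<le> z\<^sup>2 / l" using assms by (simp add: field_simps)
  then show ?thesis using False assms by simp
qed (use assms in simp)

lemma Y_stopped_meas[measurable]:
  assumes [measurable]: "\<tau> \<in> borel_measurable N"
  shows "(\<lambda>\<omega>. Y t y (\<tau> \<omega>) \<omega>) \<in> borel_measurable N"
  using measurable_compose[of "\<lambda>\<omega>. (\<omega>, \<tau> \<omega>)" N "N \<Otimes>\<^sub>M borel", OF _ Y_joint[of t y]] by simp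

text \<open>For stopping times rounded up to a grid the mean is exact by summing martingale
  increments. A bound on the second moments, uniform in the grid, prevents loss of mass: the limit
  is taken first for truncations and then in the truncation level.\<close>

lemma expY_stopped:
  assumes t: "0 \<le> t" and st: "stops t \<tau>"
  shows "has_bochner_integral N (\<lambda>\<omega>. exp (Y t y (\<tau> \<omega>) \<omega>)) (exp y)"
proof -
  have stop: "stopping_time F \<tau>" and \<tau>b: "\<And>\<omega>. \<omega> \<in> space N \<Longrightarrow> t \<le> \<tau> \<omega> \<and> \<tau> \<omega> \<le> T1"
    using st by (auto simp: stops_def)
  have \<tau>m[measurable]: "\<tau> \<in> borel_measurable N" by (rule stopping_time_meas[OF stop])
  have tT: "t \<le> T1" by (rule stops_le[OF st])
  show ?thesis
  \<comment> \<open>In this case the grid used below would have step 0.\<close>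
  proof (cases "t = T1")
    case True
    have eq: "exp (Y t y (\<tau> \<omega>) \<omega>) = exp y" if "\<omega> \<in> space N" for \<omega>
    proof -
      have "\<tau> \<omega> = t" using \<tau>b[OF that] True by linarith
      then show ?thesis by simp
    qed
    have "has_bochner_integral N (\<lambda>_. exp y) (exp y)"
      by (simp add: has_bochner_integral_iff prob_space)
    then show ?thesis
      by (subst has_bochner_integral_cong[OF refl eq refl])
  next
    case False
    define h where "h n = (T1 - t) / real (Suc n)" for n
    have h: "0 < h n" for n using False tT by (simp add: h_def)
    have hn: "t + real (Suc n) * h n = T1" for n by (simp add: h_def)
    \<comment> \<open>Rounding up, so that going on beyond the i-th date is an event of the past at
      that date: it is \<open>A n i\<close>.\<close>
    define m where "m n \<omega> = nat \<lceil>(\<tau> \<omega> - t) / h n\<rceil>" for n \<omega>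
    define Z where "Z n \<omega> = exp (Y t y (t + real (m n \<omega>) * h n) \<omega>)" for n \<omega>
    define A where "A n i = {\<omega> \<in> space N. t + real i * h n < \<tau> \<omega>}" for n i
    have AF: "A n i \<in> sets (F (t + real i * h n))" for n i
      using stopping_timeD2[OF stop, of "t + real i * h n"] by (simp add: A_def pred_def)
    have AN: "A n i \<in> sets N" for n i using AF F_sub by blast
    have m_bd: "\<tau> \<omega> \<le> t + real (m n \<omega>) * h n" "t + real (m n \<omega>) * h n < \<tau> \<omega> + h n" "m n \<omega> \<le> Suc n"
      if w: "\<omega> \<in> space N" for n \<omega>
    proof -
      have "0 \<le> (\<tau> \<omega> - t) / h n" using \<tau>b[OF w] h[of n] by simp
      then have ri: "real (m n \<omega>) = of_int \<lceil>(\<tau> \<omega> - t) / h n\<rceil>" by (simp add: m_def)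
      have 1: "(\<tau> \<omega> - t) / h n \<le> real (m n \<omega>)" "real (m n \<omega>) < (\<tau> \<omega> - t) / h n + 1" unfolding ri by linarith+
      then show "\<tau> \<omega> \<le> t + real (m n \<omega>) * h n" "t + real (m n \<omega>) * h n < \<tau> \<omega> + h n"
        using h[of n] by (auto simp: field_simps)
      have "(\<tau> \<omega> - t) / h n \<le> (T1 - t) / h n" using \<tau>b[OF w] h[of n] by (intro divide_right_mono) auto
      also have "\<dots> = real (Suc n)" using False by (simp add: h_def)
      finally show "m n \<omega> \<le> Suc n" using 1 by linarith
    qed
    have A_iff: "\<omega> \<in> A n i \<longleftrightarrow> i < m n \<omega>" if w: "\<omega> \<in> space N" for n i \<omega>
    proof
      assume "\<omega> \<in> A n i"
      then have "t + real i * h n < \<tau> \<omega>" by (simp add: A_def)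
      also have "\<dots> \<le> t + real (m n \<omega>) * h n" by (rule m_bd[OF w])
      finally show "i < m n \<omega>" using h[of n] by simp
    next
      assume "i < m n \<omega>"
      then have "real i + 1 \<le> real (m n \<omega>)" by linarith
      then have "(real i + 1) * h n \<le> real (m n \<omega>) * h n" using h[of n] by (intro mult_right_mono) auto
      then show "\<omega> \<in> A n i" using m_bd(2)[OF w, of n] w by (simp add: A_def algebra_simps)
    qed
    have grid: "t \<le> t + real i * h n" "t + real i * h n \<le> T1" if "i \<le> Suc n" for i n
    proof -
      have "real i * h n \<le> real (Suc n) * h n" using that h[of n] by (intro mult_right_mono) auto
      then show "t + real i * h n \<le> T1" using hn[of n] by linarith
      show "t \<le> t + real i * h n" using h[of n] by simp
    qed
    have grid_step: "t + real i * h n \<le> t + real (Suc i) * h n" for i n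
      using h[of n] by (simp add: algebra_simps)
    \<comment> \<open>The increment of \<open>exp (p * Y)\<close> on the event of not having
      stopped. The exponent p = 1 gives the mean, p = 2 the second moment.\<close>
    define D where "D p n i \<omega> = indicator (A n i) \<omega> * exp (p * Y t y (t + real (Suc i) * h n) \<omega>)
       - indicator (A n i) \<omega> * exp (p * Y t y (t + real i * h n) \<omega>)" for p n i \<omega>
    have ip: "integrable N (\<lambda>\<omega>. indicator (A n j) \<omega> * exp (p * Y t y (t + real i * h n) \<omega>))" if "i \<le> Suc n" for p n i j
      using integrable_mult_indicator[OF AN Y_exp_moment(1)[OF t grid[OF that], of p y], of n j] by simp
    have Di: "integrable N (D p n i)" if "i < Suc n" for p n i
      unfolding D_def using ip[of i n i p] ip[of "Suc i" n i p] that by (intro Bochner_Integration.integrable_diff) auto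
    have tele: "exp (p * Y t y (t + real (m n \<omega>) * h n) \<omega>) = exp (p * y) + (\<Sum>i<Suc n. D p n i \<omega>)"
      if w: "\<omega> \<in> space N" for p n \<omega>
    proof -
      define g where "g i = exp (p * Y t y (t + real i * h n) \<omega>)" for i
      have "(\<Sum>i<Suc n. D p n i \<omega>) = (\<Sum>i<Suc n. if i < m n \<omega> then g (Suc i) - g i else 0)"
        by (intro sum.cong refl) (auto simp: D_def g_def A_iff[OF w] indicator_def)
      also have "\<dots> = (\<Sum>i<m n \<omega>. g (Suc i) - g i)"
        using m_bd(3)[OF w, of n] by (intro sum.mono_neutral_cong_right) auto
      also have "\<dots> = g (m n \<omega>) - g 0" by (rule sum_lessThan_telescope)
      finally show ?thesis by (simp add: g_def)
    qed
    have ED: "(\<integral>\<omega>. D p n i \<omega> \<partial>N) = (exp ((p\<^sup>2 - p) * \<nu>\<^sup>2 / 2 * (t + real (Suc i) * h n - (t + real i * h n))) - 1)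
      * (\<integral>\<omega>. indicator (A n i) \<omega> * exp (p * Y t y (t + real i * h n) \<omega>) \<partial>N)" if "i < Suc n" for p n i
    proof -
      have i: "i \<le> Suc n" "Suc i \<le> Suc n" using that by auto
      show ?thesis
        unfolding D_def Bochner_Integration.integral_diff[OF ip[OF i(2)] ip[OF i(1)]]
          expY_cond[OF t grid(1)[OF i(1)] grid_step grid(2)[OF i(2)] AF] left_diff_distrib by simp
    qed
    have ZI: "has_bochner_integral N (\<lambda>\<omega>. exp (p * Y t y (t + real (m n \<omega>) * h n) \<omega>)) (exp (p * y) + (\<Sum>i<Suc n. \<integral>\<omega>. D p n i \<omega> \<partial>N))" for p n
    proof -
      have "has_bochner_integral N (\<lambda>\<omega>. exp (p * y) + (\<Sum>i<Suc n. D p n i \<omega>)) (exp (p * y) + (\<Sum>i<Suc n. \<integral>\<omega>. D p n i \<omega> \<partial>N))"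
        by (intro has_bochner_integral_add has_bochner_integral_sum has_bochner_integral_integrable Di)
          (auto simp: has_bochner_integral_iff prob_space)
      then show ?thesis
        by (subst has_bochner_integral_cong[OF refl _ refl]) (rule tele, simp)
    qed
    have Z1: "has_bochner_integral N (Z n) (exp y)" for n
    proof -
      have "(\<Sum>i<Suc n. \<integral>\<omega>. D 1 n i \<omega> \<partial>N) = 0" by (intro sum.neutral ballI) (simp add: ED)
      then show ?thesis using ZI[of 1 n] unfolding Z_def by simp
    qed
    define K where "K = exp (2 * y + \<nu>\<^sup>2 * (T1 - t))"
    have Z2: "integrable N (\<lambda>\<omega>. (Z n \<omega>)\<^sup>2)" "(\<integral>\<omega>. (Z n \<omega>)\<^sup>2 \<partial>N) \<le> K" for n
    proof -
      have sq: "(Z n \<omega>)\<^sup>2 = exp (2 * Y t y (t + real (m n \<omega>) * h n) \<omega>)" for \<omega>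
        by (simp add: Z_def exp_double)
      show "integrable N (\<lambda>\<omega>. (Z n \<omega>)\<^sup>2)" unfolding sq using ZI[of 2 n] by (simp add: has_bochner_integral_iff)
      define g where "g i = exp (2 * y + \<nu>\<^sup>2 * (real i * h n))" for i
      have "(\<integral>\<omega>. D 2 n i \<omega> \<partial>N) \<le> g (Suc i) - g i" if i: "i < Suc n" for i
      proof -
        have "(\<integral>\<omega>. indicator (A n i) \<omega> * exp (2 * Y t y (t + real i * h n) \<omega>) \<partial>N) \<le> (\<integral>\<omega>. exp (2 * Y t y (t + real i * h n) \<omega>) \<partial>N)"
          using i by (intro integral_mono ip Y_exp_moment(1)[OF t grid]) (auto split: split_indicator)
        also have "\<dots> = g i" using Y_exp_moment(2)[OF t grid, of i n 2 y] i by (simp add: g_def)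
        finally have le: "(\<integral>\<omega>. indicator (A n i) \<omega> * exp (2 * Y t y (t + real i * h n) \<omega>) \<partial>N) \<le> g i" .
        have "(\<integral>\<omega>. D 2 n i \<omega> \<partial>N) = (exp (\<nu>\<^sup>2 * h n) - 1) * (\<integral>\<omega>. indicator (A n i) \<omega> * exp (2 * Y t y (t + real i * h n) \<omega>) \<partial>N)"
          unfolding ED[OF i] by (simp add: algebra_simps)
        also have "\<dots> \<le> (exp (\<nu>\<^sup>2 * h n) - 1) * g i" using le h[of n] by (intro mult_left_mono) auto
        also have "\<dots> = g (Suc i) - g i" by (simp add: g_def algebra_simps exp_add[symmetric])
        finally show ?thesis .
      qed
      then have "(\<Sum>i<Suc n. \<integral>\<omega>. D 2 n i \<omega> \<partial>N) \<le> (\<Sum>i<Suc n. g (Suc i) - g i)" by (intro sum_mono) auto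
      also have "\<dots> = g (Suc n) - g 0" by (rule sum_lessThan_telescope)
      also have "g (Suc n) = K" using hn[of n] unfolding g_def K_def by (metis add_diff_cancel_left')
      finally show "(\<integral>\<omega>. (Z n \<omega>)\<^sup>2 \<partial>N) \<le> K"
        unfolding sq using has_bochner_integral_integral_eq[OF ZI[of 2 n]] by (simp add: g_def)
    qed
    have h0: "h \<longlonglongrightarrow> 0"
      unfolding h_def using LIMSEQ_Suc[OF lim_const_over_n[of "T1 - t"]] by simp
    have lim: "(\<lambda>n. Z n \<omega>) \<longlonglongrightarrow> exp (Y t y (\<tau> \<omega>) \<omega>)" if w: "\<omega> \<in> space N" for \<omega>
    proof -
      have "(\<lambda>n. t + real (m n \<omega>) * h n) \<longlonglongrightarrow> \<tau> \<omega>"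
      proof (rule tendsto_sandwich[where f = "\<lambda>_. \<tau> \<omega>" and h = "\<lambda>n. \<tau> \<omega> + h n"])
        show "(\<lambda>n. \<tau> \<omega> + h n) \<longlonglongrightarrow> \<tau> \<omega>" using tendsto_add[OF tendsto_const h0, of "\<tau> \<omega>"] by simp
        show "\<forall>\<^sub>F n in sequentially. \<tau> \<omega> \<le> t + real (m n \<omega>) * h n"
          by (intro always_eventually allI m_bd(1)[OF w])
        show "\<forall>\<^sub>F n in sequentially. t + real (m n \<omega>) * h n \<le> \<tau> \<omega> + h n"
          by (intro always_eventually allI less_imp_le m_bd(2)[OF w])
      qed simp
      then have "(\<lambda>n. Y t y (t + real (m n \<omega>) * h n) \<omega>) \<longlonglongrightarrow> Y t y (\<tau> \<omega>) \<omega>"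
        using continuous_on_tendsto_compose[OF Y_cont[OF w]] by auto
      then show ?thesis unfolding Z_def by (rule tendsto_exp)
    qed
    have Zm[measurable]: "Z n \<in> borel_measurable N" for n using Z1[of n] by (auto simp: has_bochner_integral_iff)
    \<comment> \<open>The truncated means lie between \<open>exp y - K / l\<close> and
      \<open>exp y\<close>, so monotone convergence in l identifies the mean of the limit.\<close>
    define E where "E l = (\<integral>\<omega>. min (exp (Y t y (\<tau> \<omega>) \<omega>)) l \<partial>N)" for l
    have E_lim: "(\<lambda>n. \<integral>\<omega>. min (Z n \<omega>) l \<partial>N) \<longlonglongrightarrow> E l" if "0 < l" for l
      unfolding E_def
    proof (rule integral_dominated_convergence[where w = "\<lambda>_. l"])
      show "AE \<omega> in N. (\<lambda>n. min (Z n \<omega>) l) \<longlonglongrightarrow> min (exp (Y t y (\<tau> \<omega>) \<omega>)) l"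
        using lim by (intro AE_I2 tendsto_min) auto
      show "AE \<omega> in N. norm (min (Z n \<omega>) l) \<le> l" for n
        using that by (intro AE_I2) (auto simp: Z_def)
    qed auto
    have Z0: "0 \<le> Z n \<omega>" for n \<omega> by (simp add: Z_def)
    have mi: "integrable N (\<lambda>\<omega>. min (Z n \<omega>) l)" if "0 < l" for n l
      using that Z0 by (intro integrable_const_bound[where B = l]) auto
    have E_low: "exp y - K / l \<le> E l" if l: "0 < l" for l
    proof (rule LIMSEQ_le_const[OF E_lim[OF l]], intro exI allI impI)
      fix n
      have "exp y - K / l \<le> (\<integral>\<omega>. Z n \<omega> - (Z n \<omega>)\<^sup>2 / l \<partial>N)"
        using Z1[of n] Z2[of n] l by (subst Bochner_Integration.integral_diff) (auto simp: has_bochner_integral_iff divide_right_mono)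
      also have "\<dots> \<le> (\<integral>\<omega>. min (Z n \<omega>) l \<partial>N)"
        using Z1[of n] Z2[of n] l mi[OF l]
        by (intro integral_mono min_ge_minus_square[OF l Z0]) (auto simp: has_bochner_integral_iff)
      finally show "exp y - K / l \<le> (\<integral>\<omega>. min (Z n \<omega>) l \<partial>N)" .
    qed
    have E_up: "E l \<le> exp y" if l: "0 < l" for l
    proof (rule LIMSEQ_le_const2[OF E_lim[OF l]], intro exI allI impI)
      fix n
      have "(\<integral>\<omega>. min (Z n \<omega>) l \<partial>N) \<le> (\<integral>\<omega>. Z n \<omega> \<partial>N)"
        using Z1[of n] mi[OF l] by (intro integral_mono) (auto simp: has_bochner_integral_iff)
      then show "(\<integral>\<omega>. min (Z n \<omega>) l \<partial>N) \<le> exp y" using Z1[of n] by (simp add: has_bochner_integral_iff)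
    qed
    have Elim: "(\<lambda>n. E (real (Suc n))) \<longlonglongrightarrow> exp y"
    proof (rule tendsto_sandwich[where h = "\<lambda>_. exp y"])
      show "(\<lambda>n. exp y - K / real (Suc n)) \<longlonglongrightarrow> exp y"
        using tendsto_diff[OF tendsto_const LIMSEQ_Suc[OF lim_const_over_n[of K]], of "exp y"] by simp
      show "\<forall>\<^sub>F n in sequentially. exp y - K / real (Suc n) \<le> E (real (Suc n))"
        by (intro always_eventually allI E_low) simp
      show "\<forall>\<^sub>F n in sequentially. E (real (Suc n)) \<le> exp y"
        by (intro always_eventually allI E_up) simp
    qed simp
    have "integrable N (\<lambda>\<omega>. exp (Y t y (\<tau> \<omega>) \<omega>))" "(\<integral>\<omega>. exp (Y t y (\<tau> \<omega>) \<omega>) \<partial>N) = exp y"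
    proof -
      have i: "integrable N (\<lambda>\<omega>. min (exp (Y t y (\<tau> \<omega>) \<omega>)) (real (Suc n)))" for n
        by (intro integrable_const_bound[where B = "real (Suc n)"]) auto
      have mono: "AE \<omega> in N. mono (\<lambda>n. min (exp (Y t y (\<tau> \<omega>) \<omega>)) (real (Suc n)))"
        by (intro AE_I2 monoI min.mono) auto
      have l: "AE \<omega> in N. (\<lambda>n. min (exp (Y t y (\<tau> \<omega>) \<omega>)) (real (Suc n))) \<longlonglongrightarrow> exp (Y t y (\<tau> \<omega>) \<omega>)"
      proof (rule AE_I2)
        fix \<omega>
        obtain n0 where n0: "exp (Y t y (\<tau> \<omega>) \<omega>) \<le> real n0" using real_arch_simple by blast
        show "(\<lambda>n. min (exp (Y t y (\<tau> \<omega>) \<omega>)) (real (Suc n))) \<longlonglongrightarrow> exp (Y t y (\<tau> \<omega>) \<omega>)"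
          by (rule tendsto_eventually, rule eventually_sequentiallyI[of n0]) (use n0 in \<open>auto simp: min_def\<close>)
      qed
      show "integrable N (\<lambda>\<omega>. exp (Y t y (\<tau> \<omega>) \<omega>))" "(\<integral>\<omega>. exp (Y t y (\<tau> \<omega>) \<omega>) \<partial>N) = exp y"
        using integrable_monotone_convergence[OF i mono l Elim[unfolded E_def]]
          integral_monotone_convergence[OF i mono l Elim[unfolded E_def]] by auto
    qed
    then show ?thesis by (simp add: has_bochner_integral_iff)
  qed
qed

end

section \<open>Constant paths: the case of zero volatility\<close>

context stopping_problem
begin

lemma phi_add:
  assumes "0 \<le> h" "0 \<le> h'"
  shows "phi (h + h') s y = phi h s y + phi h' (s + h) y"
  unfolding phi_eq using assms
  by (subst Bochner_Integration.integral_add[symmetric])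
    (auto intro!: f_integrable Bochner_Integration.integral_cong split: split_indicator)

lemma phi_0: "phi 0 s y = 0"
  by (simp add: phi_eq)

lemma Dint_le:
  assumes "0 \<le> s" "0 \<le> h" "s + h \<le> T1"
  shows "Dint s h \<le> h * (cmax * amax)"
proof -
  have "Dint s h \<le> (\<integral>u. indicator {s..<s+h} u * (cmax * amax) \<partial>lborel)"
    unfolding Dint_def
  proof (intro integral_mono Dint_integrable)
    show "indicator {s..<s+h} u * (exp (\<theta> * u) * a u) \<le> indicator {s..<s+h} u * (cmax * amax)" for u
      using assms exp_theta_le[of u] a_le[of u] a_pos[of u] cmax_pos
      by (auto split: split_indicator intro!: mult_mono simp: less_imp_le)
  qed (rule cont_interval_int[OF continuous_on_const])
  also have "\<dots> = h * (cmax * amax)" using assms by simp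
  finally show ?thesis .
qed

text \<open>Along a constant path the recursion is a deterministic optimisation over the number of
  steps; j = 0 is stopping at once.\<close>

lemma Q_degenerate:
  assumes "\<nu> = 0" "0 < h"
  shows "\<exists>j\<le>k. Q k h s y = phi (real j * h) s y"
proof (induction k arbitrary: s)
  case 0
  show ?case by (simp add: phi_0)
next
  case (Suc k)
  interpret G: prob_space "gauss h" using assms(2) by (rule prob_space_gauss)
  obtain j where j: "j \<le> k" "Q k h (s + h) y = phi (real j * h) (s + h) y" using Suc.IH by blast
  have "cont k h s y = phi h s y + phi (real j * h) (s + h) y"
    unfolding cont_def using assms(1) j(2) G.prob_space by simp
  also have "\<dots> = phi (real (Suc j) * h) s y"
    using phi_add[of h "real j * h" s y] assms(2) by (simp add: algebra_simps)
  finally have c: "cont k h s y = phi (real (Suc j) * h) s y" .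
  show ?case
  proof (cases "0 \<le> cont k h s y")
    case True
    then show ?thesis using c j(1) unfolding Q_Suc by (intro exI[of _ "Suc j"]) auto
  next
    case False
    then show ?thesis unfolding Q_Suc by (intro exI[of _ 0]) (auto simp: phi_0)
  qed
qed

lemma J_const:
  assumes "0 \<le> s" "0 \<le> h" "s + h \<le> T1"
  shows "J s y (\<lambda>_. s + h) = phi h s y"
proof -
  have sN: "space N \<in> sets (F s)" using sets.top[of "F s"] by simp
  have "J s y (\<lambda>_. s + h) = (\<integral>x. indicator (space N) (fst x) * indicator {s..<s+h} (snd x) * fY s y x \<partial>PM)"
    unfolding J_def by (intro Bochner_Integration.integral_cong refl) (auto simp: space_NL)
  also have "\<dots> = (\<integral>\<omega>. indicator (space N) \<omega> * phi h s (Y s y s \<omega>) \<partial>N)"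
    using assms sN by (intro prod_phi) auto
  also have "\<dots> = (\<integral>\<omega>. phi h s y \<partial>N)"
    by (intro Bochner_Integration.integral_cong refl) auto
  finally show ?thesis using prob_space by simp
qed

end

section \<open>Regularity of the free boundary and its limit at the horizon\<close>

locale stopping_boundary = stopping_problem +
  fixes ys :: "real \<Rightarrow> real"
  assumes boundary: "0 \<le> s \<Longrightarrow> s < T1 \<Longrightarrow> Cont s y \<longleftrightarrow> y < ys s"
begin

text \<open>Otherwise the boundary point at \<open>s'\<close> would be the shift of a point strictly
  below the boundary at s, and would itself belong to the continuation region.\<close>

lemma ys_shift:
  assumes "0 \<le> s'" "s' \<le> s" "s < T1"
  shows "ys s - L * (s - s') \<le> ys s'"
proof (rule ccontr)
  assume "\<not> ?thesis"
  then have "Cont s (ys s' + L * (s - s'))" using assms by (subst boundary) auto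
  from Cont_time_shift[OF assms(1,2) this] have "Cont s' (ys s')" by simp
  then show False using boundary[of s' "ys s'"] assms by simp
qed

lemma ys_ge:
  assumes "0 \<le> s" "s < T1"
  shows "1 \<le> a s * exp (ys s)"
proof (rule ccontr)
  assume "\<not> ?thesis"
  then have "Cont s (ys s)" using Cont_if_f_pos[OF assms] by simp
  then show False using boundary[OF assms] by simp
qed

text \<open>The lower bound holds because one continues wherever f is positive. The upper one
  applies \<open>not_Cont_near_horizon\<close> at a level strictly between
  \<open>- ln (a T1)\<close> and y.\<close>

lemma ys_lim: "(ys \<longlongrightarrow> - ln (a T1)) (at_left T1)"
proof (rule order_tendstoI)
  fix y assume y: "y < - ln (a T1)"
  have "isCont (\<lambda>u. - ln (a u)) T1"
    using a_cont a_pos by (intro continuous_intros) (auto simp: continuous_on_eq_continuous_at less_imp_neq[symmetric])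
  then have "((\<lambda>u. - ln (a u)) \<longlongrightarrow> - ln (a T1)) (at_left T1)"
    unfolding isCont_def by (rule tendsto_within_subset) auto
  then have "\<forall>\<^sub>F s in at_left T1. y < - ln (a s)" using y by (rule order_tendstoD)
  moreover have "\<forall>\<^sub>F s in at_left T1. s \<in> {0<..<T1}" using T1_pos by (rule eventually_at_left_real)
  ultimately show "\<forall>\<^sub>F s in at_left T1. y < ys s"
  proof eventually_elim
    case (elim s)
    then have "0 \<le> ln (a s * exp (ys s))" using ys_ge[of s] by simp
    then have "- ln (a s) \<le> ys s" using a_pos[of s] by (simp add: ln_mult)
    then show ?case using elim by simp
  qed
next
  fix y assume y: "- ln (a T1) < y"
  define z where "z = (y - ln (a T1)) / 2"
  have z: "- ln (a T1) < z" "z < y" using y by (auto simp: z_def)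
  have "0 < ln (a T1 * exp z)" using z a_pos[of T1] by (simp add: ln_mult)
  then have "1 < a T1 * exp z" using a_pos[of T1] by simp
  from not_Cont_near_horizon[OF this] obtain s0 where s0: "s0 < T1" "\<And>s. 0 \<le> s \<Longrightarrow> s0 < s \<Longrightarrow> s < T1 \<Longrightarrow> \<not> Cont s z" by blast
  have "\<forall>\<^sub>F s in at_left T1. s \<in> {max 0 s0<..<T1}" using T1_pos s0 by (intro eventually_at_left_real) auto
  then show "\<forall>\<^sub>F s in at_left T1. ys s < y"
  proof eventually_elim
    case (elim s)
    then have "\<not> z < ys s" using s0(2)[of s] boundary[of s z] by auto
    then show ?case using z by simp
  qed
qed

lemma ys_mono: "mono_on {0..<T1} (\<lambda>s. L * s - ys s)"
  using ys_shift by (intro mono_onI) (fastforce simp: algebra_simps)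

text \<open>\<open>ys\<close> is unconstrained outside \<open>[0, T1)\<close>; cutting it off yields
  a Borel function on the whole line.\<close>

definition ysm :: "real \<Rightarrow> real" where "ysm u = indicator {0..<T1} u * ys u"

lemma ysm_eq: "0 \<le> u \<Longrightarrow> u < T1 \<Longrightarrow> ysm u = ys u"
  by (simp add: ysm_def)

lemma ysm_meas[measurable]: "ysm \<in> borel_measurable borel"
proof -
  have "(\<lambda>s. indicator {0..<T1} s * (L * s - ys s)) \<in> borel_measurable borel"
    using borel_measurable_mono_on_fnc[OF ys_mono] by (subst (asm) borel_measurable_restrict_space_iff) auto
  then have "(\<lambda>s. indicator {0..<T1} s * (L * s) - indicator {0..<T1} s * (L * s - ys s)) \<in> borel_measurable borel"
    by measurable
  also have "(\<lambda>s. indicator {0..<T1} s * (L * s) - indicator {0..<T1} s * (L * s - ys s)) = ysm"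
    by (auto simp: ysm_def split: split_indicator)
  finally show ?thesis .
qed

lemma ys_discont_countable: "countable {u \<in> {0..<T1}. \<not> continuous (at u within {0..<T1}) ys}"
proof -
  have "continuous (at u within {0..<T1}) ys" if c: "continuous (at u within {0..<T1}) (\<lambda>s. L * s - ys s)" for u
  proof -
    have "continuous (at u within {0..<T1}) (\<lambda>s. L * s)" by (intro continuous_intros)
    from continuous_diff[OF this c] show ?thesis by simp
  qed
  then show ?thesis
    by (intro countable_subset[OF _ mono_on_ctble_discont[OF ys_mono]]) auto
qed

text \<open>Suppose the boundary is at level y again at a slightly later u'. A state z just below y
  continues at u, but the reward is negative until u', so a profitable horizon must reach beyond u'
  and earn more than that loss afterwards. Starting at u' from y instead of z costs less than the
  loss, so y would continue at u', although it lies on the boundary there.\<close>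

lemma degenerate_level_isolated:
  assumes "\<nu> = 0" "0 \<le> u" "u < T1" "ys u = y" "f u y \<noteq> 0"
  shows "\<exists>e>0. \<forall>u'. u < u' \<longrightarrow> u' < u + e \<longrightarrow> u' < T1 \<longrightarrow> ys u' \<noteq> y"
proof -
  have "1 < a u * exp y" using ys_ge[OF assms(2,3)] assms(4,5) by (auto simp: f_def)
  \<comment> \<open>In logarithms, halfway from y to the zero of f at time u; the reward is still
    negative at y2 for times close to u.\<close>
  define y2 where "y2 = y - ln (a u * exp y) / 2"
  have ln: "0 < ln (a u * exp y)" using \<open>1 < a u * exp y\<close> by simp
  have y2: "y2 < y" using ln by (simp add: y2_def)
  have "ln (a u * exp y2) = ln (a u * exp y) / 2"
    using a_pos[of u] by (simp add: ln_mult y2_def field_simps)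
  then have gt: "1 < a u * exp y2" using ln a_pos[of u]
    by (metis half_gt_zero_iff ln_gt_zero_iff mult_pos_pos exp_gt_zero)
  have "isCont (\<lambda>v. a v * exp y2) u"
    using a_cont by (intro continuous_intros) (auto simp: continuous_on_eq_continuous_at)
  then have "\<forall>\<^sub>F v in at u. 1 < a v * exp y2"
    using gt unfolding isCont_def by (elim order_tendstoD(1))
  then obtain e where e: "0 < e" "\<And>v. v \<noteq> u \<Longrightarrow> dist v u < e \<Longrightarrow> 1 < a v * exp y2"
    unfolding eventually_at by auto
  have neg: "f v z < 0" if "u \<le> v" "v < u + e" "y2 \<le> z" for v z
  proof -
    have "1 < a v * exp y2" using e(2)[of v] gt that by (cases "v = u") (auto simp: dist_real_def)
    also have "\<dots> \<le> a v * exp z" using that a_pos[of v] by simp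
    finally show ?thesis by (simp add: f_def mult_pos_neg)
  qed
  show ?thesis
  proof (intro exI[of _ e] conjI allI impI e(1) notI)
    fix u' assume u': "u < u'" "u' < u + e" "u' < T1" "ys u' = y"
    have phi_mono: "phi h s z \<le> phi h s z'" if "z' \<le> z" for h s z z'
      unfolding phi_def using Dint_nonneg[of s h] that by (intro diff_left_mono mult_left_mono) auto
    have phi_neg: "phi h u z \<le> 0" if "u + h \<le> u'" "y2 \<le> z" for h z
    proof -
      have "phi h u z \<le> (\<integral>v. 0 \<partial>(lborel :: real measure))"
        unfolding phi_eq using that u' neg[of _ z]
        by (intro integral_mono f_integrable) (auto split: split_indicator intro!: less_imp_le)
      then show ?thesis by simp
    qed
    \<comment> \<open>A lower bound for the loss on \<open>[u, u')\<close>, uniform over the states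
      above y2.\<close>
    define \<eta> where "\<eta> = - phi (u' - u) u y2"
    have "0 < \<eta>"
    proof -
      define g where "g v = indicator {u..<u'} v * (- f v y2)" for v
      have g0: "0 \<le> g v" for v using neg[of v y2] u' by (auto simp: g_def split: split_indicator intro!: less_imp_le)
      have gi: "integrable lborel g" unfolding g_def using integrable_minus[OF f_integrable[of u u' y2]] by simp
      have "integral\<^sup>L lborel g \<noteq> 0"
      proof
        assume "integral\<^sup>L lborel g = 0"
        then have "AE v in lborel. g v = 0" using integral_nonneg_eq_0_iff_AE[OF gi] g0 by simp
        then have "AE v in lborel. v \<notin> {u..<u'}"
          by eventually_elim (use neg[of _ y2] u' in \<open>force simp: g_def\<close>)
        then have "{u..<u'} \<in> null_sets lborel" by (subst AE_iff_null_sets) auto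
        then show False using u' by (simp add: null_sets_def)
      qed
      moreover have "0 \<le> integral\<^sup>L lborel g" using g0 by simp
      ultimately have "0 < (\<integral>v. indicator {u..<u'} v * (- f v y2) \<partial>lborel)" unfolding g_def by simp
      then show ?thesis unfolding \<eta>_def phi_eq by simp
    qed
    define Dm where "Dm = T1 * (cmax * amax)"
    have Dm: "0 < Dm" using T1_pos cmax_pos amax_pos by (simp add: Dm_def)
    \<comment> \<open>The first bound keeps z above y2. The second makes the change of reward
      between z and y after u' at most half of \<eta>, since \<open>Dm\<close> bounds
      \<open>Dint\<close>.\<close>
    define d where "d = min (exp y - exp y2) (\<eta> / (2 * Dm))"
    have d: "0 < d" using y2 \<open>0 < \<eta>\<close> Dm by (simp add: d_def)
    define z where "z = ln (exp y - d)"
    have ed: "exp y2 \<le> exp y - d" by (simp add: d_def)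
    then have "0 < exp y - d" using exp_gt_zero[of y2] by linarith
    then have ez: "exp z = exp y - d" by (simp add: z_def)
    have z: "z < y" "y2 \<le> z" using ez d ed by (metis exp_less_cancel_iff diff_less_eq less_add_same_cancel1, metis exp_le_cancel_iff)
    have "Cont u z" using boundary[OF assms(2,3)] z assms(4) by simp
    then obtain H where H: "0 < H" "\<And>h k. 0 < h \<Longrightarrow> h < H \<Longrightarrow> u + real k * h \<le> T1 \<Longrightarrow> T1 \<le> u + real k * h + h \<Longrightarrow> 0 < Q k h u z"
      using Cont_imp_Q_pos[OF assms(2)] by blast
    have h: "0 < H / 2" using H by simp
    obtain k where k: "u + real k * (H / 2) \<le> T1" "T1 \<le> u + real k * (H / 2) + H / 2"
      using grid_steps_exist[OF h] assms(3) by (metis less_imp_le)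
    obtain j where j: "j \<le> k" "Q k (H / 2) u z = phi (real j * (H / 2)) u z"
      using Q_degenerate[OF assms(1) h] by blast
    define l where "l = real j * (H / 2)"
    have lpos: "0 < phi l u z" using H(2)[OF h _ k] h j(2) by (simp add: l_def)
    have "l \<le> real k * (H / 2)" unfolding l_def using j h by (intro mult_right_mono) auto
    then have lT: "u + l \<le> T1" using k by simp
    \<comment> \<open>A horizon ending by u' collects no positive reward.\<close>
    have l: "u' < u + l" using phi_neg[of l z] lpos z by (auto simp: not_le[symmetric])
    have "phi l u z = phi (u' - u) u z + phi (u + l - u') u' z"
      using phi_add[of "u' - u" "u + l - u'" u z] u' l by simp
    moreover have "phi (u' - u) u z \<le> - \<eta>" unfolding \<eta>_def using phi_mono[OF z(2), of "u' - u" u] by simp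
    ultimately have "\<eta> < phi (u + l - u') u' z" using lpos by linarith
    moreover have "phi (u + l - u') u' z - phi (u + l - u') u' y = Dint u' (u + l - u') * d"
      by (simp add: phi_def ez algebra_simps)
    moreover have "Dint u' (u + l - u') * d \<le> Dm * (\<eta> / (2 * Dm))"
    proof (rule mult_mono)
      have "Dint u' (u + l - u') \<le> (u + l - u') * (cmax * amax)" using u' l lT assms(2) by (intro Dint_le) auto
      also have "\<dots> \<le> Dm" unfolding Dm_def using u' lT assms(2) cmax_pos amax_pos by (intro mult_right_mono) auto
      finally show "Dint u' (u + l - u') \<le> Dm" .
    qed (use d Dm Dint_nonneg in \<open>auto simp: d_def\<close>)
    ultimately have "0 < phi (u + l - u') u' y" using \<open>0 < \<eta>\<close> Dm by simp
    then have "0 < J u' y (\<lambda>_. u' + (u + l - u'))" using J_const[of u' "u + l - u'" y] u' l lT assms(2) by simp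
    moreover have "stops u' (\<lambda>_. u' + (u + l - u'))" using l lT by (auto simp: stops_def stopping_time_const)
    ultimately have "Cont u' y" unfolding Cont_def by blast
    then show False using boundary[of u' y] u' assms(2) by simp
  qed
qed

text \<open>Every point of the set is isolated from the right, and the gaps to the right of distinct
  points are disjoint open intervals.\<close>

lemma degenerate_level_countable:
  assumes "\<nu> = 0"
  shows "countable {u \<in> {0..<T1}. ys u = y \<and> f u y \<noteq> 0}" (is "countable ?E")
proof -
  have "\<forall>u\<in>?E. \<exists>e>0. \<forall>u'. u < u' \<longrightarrow> u' < u + e \<longrightarrow> u' < T1 \<longrightarrow> ys u' \<noteq> y"
    using degenerate_level_isolated[OF assms] by auto
  then obtain e where e: "\<And>u. u \<in> ?E \<Longrightarrow> 0 < e u"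
    "\<And>u u'. u \<in> ?E \<Longrightarrow> u < u' \<Longrightarrow> u' < u + e u \<Longrightarrow> u' < T1 \<Longrightarrow> ys u' \<noteq> y"
    by (metis (no_types, lifting))
  define G where "G u = {u<..<u + e u}" for u
  have disj: "disjnt (G u) (G u')" if "u \<in> ?E" "u' \<in> ?E" "u < u'" for u u'
    using e(2)[of u u'] that by (fastforce simp: G_def disjnt_iff)
  have ne: "G u \<noteq> {}" if "u \<in> ?E" for u using e(1)[OF that] by (simp add: G_def)
  have d2: "disjnt (G u) (G u')" if "u \<in> ?E" "u' \<in> ?E" "u \<noteq> u'" for u u'
    using disj[of u u'] disj[of u' u] that by (cases "u < u'") (auto simp: disjnt_sym)
  have inj: "inj_on G ?E"
    using d2 ne by (intro inj_onI) (metis (no_types, lifting) disjnt_self_iff_empty)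
  have "countable (G ` ?E)"
    using d2 by (intro countable_disjoint_open_subsets) (auto simp: G_def pairwise_def)
  then show ?thesis using inj by (rule countable_image_inj_on)
qed

text \<open>The alternative \<open>f = 0\<close> is essential: with zero volatility and constant a,
  the path started on the boundary stays on it all the time, and f vanishes there.\<close>

lemma AE_off_boundary:
  assumes "0 \<le> t" "t < T1"
  shows "AE u in lborel. u \<in> {t<..<T1} \<longrightarrow> (AE \<omega> in N. Y t y u \<omega> \<noteq> ysm u \<or> f u (Y t y u \<omega>) = 0)"
proof (cases "\<nu> = 0")
  case True
  then have Yc: "Y t y u \<omega> = y" for u \<omega> unfolding Y_def by (simp add: True)
  show ?thesis
    by (rule AE_I'[OF countable_imp_null_set_lborel[OF degenerate_level_countable[OF True, of y]]])
      (use assms Yc in \<open>auto simp: ysm_eq\<close>)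
next
  case False
  have "AE \<omega> in N. Y t y u \<omega> \<noteq> c" if u: "t < u" "u < T1" for u c
  proof -
    define c' where "c' = (c - y + \<nu>\<^sup>2 / 2 * (u - t)) / \<nu>"
    have eq: "Y t y u \<omega> = c \<longleftrightarrow> W u \<omega> - W t \<omega> = c'" for \<omega>
      using False by (auto simp: Y_def c'_def field_simps)
    have "emeasure N (space N \<inter> {\<omega> \<in> space N. W u \<omega> - W t \<omega> \<in> {c'}}) = emeasure N (space N) * emeasure (gauss (u - t)) {c'}"
      using u assms sets.top[of "F t"] by (intro W_indep) auto
    also have "\<dots> = 0" by (simp add: gauss_singleton)
    finally have "emeasure N {\<omega> \<in> space N. Y t y u \<omega> = c} = 0" by (simp add: eq Int_def)
    moreover have "{\<omega> \<in> space N. Y t y u \<omega> = c} \<in> sets N" by measurable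
    ultimately show ?thesis by (subst AE_iff_measurable[OF _ refl]) auto
  qed
  note ne = this
  show ?thesis
  proof (rule AE_I2, rule impI)
    fix u assume "u \<in> {t<..<T1}"
    then have "AE \<omega> in N. Y t y u \<omega> \<noteq> ysm u" by (intro ne) auto
    then show "AE \<omega> in N. Y t y u \<omega> \<noteq> ysm u \<or> f u (Y t y u \<omega>) = 0" by eventually_elim simp
  qed
qed

end

context brownian_on
begin

text \<open>Summed over about \<open>1 / h\<close> steps, a second moment would bound the large
  deviations only by order \<open>1 / l^2\<close>; the fourth leaves order
  \<open>h / l^4\<close>.\<close>

lemma increment_moment4:
  assumes "0 \<le> s" "s < u" "u \<le> T1"
  shows "has_bochner_integral N (\<lambda>\<omega>. (W u \<omega> - W s \<omega>) ^ 4) (3 * (u - s)\<^sup>2)"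
proof (rule has_bochner_integral_nn_integral)
  have h: "0 < u - s" using assms by simp
  have "(\<integral>\<^sup>+\<omega>. ennreal ((W u \<omega> - W s \<omega>) ^ 4) \<partial>N) = (\<integral>\<^sup>+\<omega>. \<integral>\<^sup>+x. ennreal (x ^ 4) \<partial>gauss (u - s) \<partial>N)"
    using nn_integral_increment[OF assms, of "\<lambda>x. ennreal (snd x ^ 4)"] by simp
  also have "(\<integral>\<^sup>+x. ennreal (x ^ 4) \<partial>gauss (u - s)) = ennreal (3 * (u - s)\<^sup>2)"
    using gauss_moment(1)[OF h, of 4] gauss_moment(2)[OF h, of 2]
    by (subst nn_integral_eq_integral) (auto simp: fact_numeral)
  finally show "(\<integral>\<^sup>+\<omega>. ennreal ((W u \<omega> - W s \<omega>) ^ 4) \<partial>N) = ennreal (3 * (u - s)\<^sup>2)"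
    by (simp add: emeasure_space_1)
qed auto

end

section \<open>The Bermudan continuation region along a path started on the boundary\<close>

context stopping_boundary
begin

text \<open>Only the upper side is limited: states below the boundary at which the Bermudan problem
  already stops are included.\<close>

definition near :: "nat \<Rightarrow> real \<Rightarrow> real \<Rightarrow> real \<Rightarrow> real \<Rightarrow> real \<Rightarrow> 'a set" where
  "near k h l t y s = {\<omega> \<in> space N. Q k h s (Y t y s \<omega>) = 0 \<and> Y t y s \<omega> < ys s + l}"

definition pos :: "nat \<Rightarrow> real \<Rightarrow> real \<Rightarrow> real \<Rightarrow> real \<Rightarrow> 'a set" where
  "pos k h t y s = {\<omega> \<in> space N. 0 < Q k h s (Y t y s \<omega>)}"

lemma near_sets:
  assumes "0 \<le> t" "t \<le> s" "s \<le> T1" "0 < h"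
  shows "near k h l t y s \<in> sets (F s)" "pos k h t y s \<in> sets (F s)"
proof -
  have Ym: "Y t y s \<in> borel_measurable (F s)" using assms by (intro Y_adapt) auto
  note Qm = measurable_compose[OF Ym Q_meas[OF assms(4), of k s]]
  have "pos k h t y s = (\<lambda>\<omega>. Q k h s (Y t y s \<omega>)) -` {0<..} \<inter> space (F s)" by (auto simp: pos_def)
  then show "pos k h t y s \<in> sets (F s)" using measurable_sets[OF Qm, of "{0<..}"] by simp
  have "near k h l t y s = ((\<lambda>\<omega>. Q k h s (Y t y s \<omega>)) -` {0} \<inter> space (F s)) \<inter> (Y t y s -` {..<ys s + l} \<inter> space (F s))"
    by (auto simp: near_def)
  then show "near k h l t y s \<in> sets (F s)"
    using measurable_sets[OF Qm, of "{0}"] measurable_sets[OF Ym, of "{..<ys s + l}"] by auto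
qed

text \<open>One step of the Bermudan recursion: the value re-entering from the stopping region is paid for
  by the running reward on a thin layer above the boundary, up to a large deviation of the increment.\<close>

lemma grid_step:
  fixes y :: real
  assumes t: "0 \<le> t" "t \<le> s" and h: "0 < h" and sT: "s + real (Suc k) * h \<le> T1"
    and l: "0 < l" "L * h + \<nu>\<^sup>2 / 2 * h \<le> l / 2"
  defines "I \<equiv> \<lambda>A. \<integral>x. indicator A (fst x) * indicator {s..<s+h} (snd x) * fY t y x \<partial>PM"
    and "R \<equiv> \<integral>x. indicator (near (Suc k) h l t y s) (fst x) * indicator {s..<s+h} (snd x) * \<bar>fY t y x\<bar> \<partial>PM"
    and "E \<equiv> (\<integral>\<omega>. Q k h (s + h) (Y t y (s + h) \<omega>) \<partial>N) - (\<integral>\<omega>. Q (Suc k) h s (Y t y s \<omega>) \<partial>N)"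
  shows "0 \<le> I (pos (Suc k) h t y s) + E"
    and "I (pos (Suc k) h t y s) + E \<le> R + T1 * cmax * (48 * \<nu>^4 * h\<^sup>2 / l^4)"
proof -
  have kh: "0 \<le> real k * h" using h by simp
  have shk: "s + h + real k * h \<le> T1" using sT by (simp add: algebra_simps)
  have sh: "s + h \<le> T1" "s < T1" "0 \<le> s" "s \<le> T1" "0 \<le> s + h" "s + h + real k * h \<le> T1"
    using shk kh t h by linarith+
  define S where "S \<omega> = Q (Suc k) h s (Y t y s \<omega>)" for \<omega>
  define S' where "S' \<omega> = Q k h (s + h) (Y t y (s + h) \<omega>)" for \<omega>
  have S_int: "integrable N S" unfolding S_def by (rule QY_int[OF h sh(3) sT])
  have S'_int: "integrable N S'" unfolding S'_def by (rule QY_int[OF h sh(5,6)])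
  have S'0: "0 \<le> S' \<omega>" for \<omega> by (simp add: S'_def Q_nonneg)
  have Sc: "S \<omega> = max 0 (cont k h s (Y t y s \<omega>))" for \<omega> by (simp add: S_def Q_Suc del: Q.simps)
  define P where "P = pos (Suc k) h t y s"
  define A where "A = near (Suc k) h l t y s"
  have PF: "P \<in> sets (F s)" and AF: "A \<in> sets (F s)" using near_sets[OF t sh(4) h] by (auto simp: P_def A_def)
  have PN[measurable]: "P \<in> sets N" and AN[measurable]: "A \<in> sets N" using PF AF F_sub by auto
  have P_iff: "\<omega> \<in> P \<longleftrightarrow> \<omega> \<in> space N \<and> 0 < S \<omega>" for \<omega> by (simp add: P_def pos_def S_def del: Q.simps)
  have "(\<integral>\<omega>. S \<omega> \<partial>N) = (\<integral>\<omega>. indicator P \<omega> * cont k h s (Y t y s \<omega>) \<partial>N)"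
    by (intro Bochner_Integration.integral_cong refl) (auto simp: P_iff Sc indicator_def)
  also have "\<dots> = I P + (\<integral>\<omega>. indicator P \<omega> * S' \<omega> \<partial>N)"
    unfolding I_def S'_def by (rule cont_step(1)[OF t h sT PF])
  finally have ES: "(\<integral>\<omega>. S \<omega> \<partial>N) = I P + (\<integral>\<omega>. indicator P \<omega> * S' \<omega> \<partial>N)" .
  have iP: "integrable N (\<lambda>\<omega>. indicator B \<omega> * S' \<omega>)" if "B \<in> sets N" for B
    using integrable_mult_indicator[OF that S'_int] by simp
  have "(\<integral>\<omega>. S' \<omega> \<partial>N) - (\<integral>\<omega>. indicator P \<omega> * S' \<omega> \<partial>N) = (\<integral>\<omega>. indicator (space N - P) \<omega> * S' \<omega> \<partial>N)"
    unfolding Bochner_Integration.integral_diff[OF S'_int iP[OF PN], symmetric]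
    by (intro Bochner_Integration.integral_cong refl) (auto split: split_indicator)
  \<comment> \<open>The balance of one step: reward on the continuing part plus change of expected
    value equals the later value of the paths that are in the stopping region at s.\<close>
  then have main: "I P + E = (\<integral>\<omega>. indicator (space N - P) \<omega> * S' \<omega> \<partial>N)"
    using ES unfolding E_def S_def S'_def by linarith
  then show "0 \<le> I (pos (Suc k) h t y s) + E"
    using S'0 unfolding P_def by simp
  define C where "C = {\<omega> \<in> space N. ys s + l \<le> Y t y s \<omega>}"
  have CN[measurable]: "C \<in> sets N" unfolding C_def by measurable
  have m4: "has_bochner_integral N (\<lambda>\<omega>. (W (s + h) \<omega> - W s \<omega>) ^ 4) (3 * h\<^sup>2)"
    using increment_moment4[of s "s + h"] h sh by simp
  have fb0: "0 \<le> T1 * cmax * (16 * \<nu>^4 / l^4) * (W (s + h) \<omega> - W s \<omega>) ^ 4" for \<omega>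
    using T1_pos cmax_pos l by (intro mult_nonneg_nonneg) (auto simp: zero_le_even_power)
  \<comment> \<open>The boundary rises by at most \<open>L * h\<close>, so from at least l above it
    a positive value at \<open>s + h\<close> forces \<open>\<bar>\<nu> * D\<bar>\<close> to be at
    least \<open>l / 2\<close>. The fourth power of \<open>2 * \<nu> * D / l\<close>, whence the
    factor 16, then dominates the indicator of this event.\<close>
  have far: "S' \<omega> \<le> T1 * cmax * (16 * \<nu>^4 / l^4) * (W (s + h) \<omega> - W s \<omega>) ^ 4" if w: "\<omega> \<in> C" for \<omega>
  proof (cases "0 < S' \<omega>")
    case True
    define D where "D = W (s + h) \<omega> - W s \<omega>"
    \<comment> \<open>With k = 0 the later value would vanish; with at least one step left,
      \<open>s + h\<close> is strictly before \<open>T1\<close>, where the boundary is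
      specified.\<close>
    have "k \<noteq> 0" using True by (cases k) (auto simp: S'_def)
    then have "h \<le> real k * h" using h by (simp add: Suc_leI)
    then have shT: "s + h < T1" using sh h by linarith
    have "Cont (s + h) (Y t y (s + h) \<omega>)"
      using True unfolding S'_def by (intro Q_pos_imp_Cont[OF sh(5) h sh(6)])
    then have "Y t y (s + h) \<omega> < ys (s + h)" using boundary[OF sh(5) shT] by simp
    also have "\<dots> \<le> ys s + L * h" using ys_shift[of s "s + h"] sh shT h by simp
    also have "\<dots> \<le> Y t y s \<omega> - l + L * h" using w by (simp add: C_def)
    finally have "\<nu> * D - \<nu>\<^sup>2 / 2 * h < - l + L * h"
      using Y_step[of t y "s + h" \<omega> s] by (simp add: D_def)
    then have "l / 2 \<le> \<bar>\<nu> * D\<bar>" using l by linarith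
    then have "1 \<le> \<bar>\<nu> * D\<bar> / (l / 2)" using l by (subst le_divide_eq_1_pos) auto
    then have "1 \<le> (\<bar>\<nu> * D\<bar> / (l / 2)) ^ 4" by (rule one_le_power)
    also have "\<dots> = 16 * \<nu>^4 / l^4 * D ^ 4" by (simp add: power_divide power_mult_distrib power_even_abs)
    finally have "T1 * cmax * 1 \<le> T1 * cmax * (16 * \<nu>^4 / l^4 * D ^ 4)"
      using T1_pos cmax_pos by (intro mult_left_mono) auto
    moreover have "S' \<omega> \<le> T1 * cmax"
    proof -
      have "S' \<omega> \<le> real k * h * cmax" unfolding S'_def by (rule Q_le[OF h sh(5,6)])
      also have "\<dots> \<le> T1 * cmax" using cmax_pos sh by (intro mult_right_mono) auto
      finally show ?thesis .
    qed
    ultimately show ?thesis by (simp add: D_def mult.assoc)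
  next
    case False
    then show ?thesis using fb0[of \<omega>] by linarith
  qed
  have fb: "has_bochner_integral N (\<lambda>\<omega>. T1 * cmax * (16 * \<nu>^4 / l^4) * (W (s + h) \<omega> - W s \<omega>) ^ 4)
      (T1 * cmax * (16 * \<nu>^4 / l^4) * (3 * h\<^sup>2))"
    by (rule has_bochner_integral_mult_right) (rule m4)
  have Rint: "integrable PM (\<lambda>x. indicator A (fst x) * indicator {s..<s+h} (snd x) * fY t y x)"
    using t sh by (intro fY_int[OF t(1)]) (auto split: split_indicator)
  \<comment> \<open>On A stopping is optimal, so the continuation value is nonpositive and the
    re-entering value is at most minus the running reward.\<close>
  have "(\<integral>\<omega>. indicator A \<omega> * cont k h s (Y t y s \<omega>) \<partial>N) \<le> (\<integral>\<omega>. 0 \<partial>N)"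
  proof (rule integral_mono[OF cont_step(2)[OF t h sT AF]])
    fix \<omega>
    show "indicator A \<omega> * cont k h s (Y t y s \<omega>) \<le> 0"
      by (cases "\<omega> \<in> A") (auto simp: A_def near_def Q_Suc max_def split: if_splits simp del: Q.simps)
  qed simp
  then have "(\<integral>\<omega>. indicator A \<omega> * S' \<omega> \<partial>N) \<le> - I A"
    using cont_step(1)[OF t h sT AF, of y] unfolding I_def S'_def by simp
  also have "\<dots> \<le> R"
  proof -
    have "- I A = (\<integral>x. - (indicator A (fst x) * indicator {s..<s+h} (snd x) * fY t y x) \<partial>PM)"
      unfolding I_def by simp
    also have "\<dots> \<le> (\<integral>x. indicator A (fst x) * indicator {s..<s+h} (snd x) * \<bar>fY t y x\<bar> \<partial>PM)"
    proof (rule integral_mono)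
      show "integrable PM (\<lambda>x. - (indicator A (fst x) * indicator {s..<s+h} (snd x) * fY t y x))"
        using Rint by simp
      show "integrable PM (\<lambda>x. indicator A (fst x) * indicator {s..<s+h} (snd x) * \<bar>fY t y x\<bar>)"
        using integrable_abs[OF Rint] by (simp add: abs_mult)
    qed (auto split: split_indicator)
    finally show ?thesis by (simp add: R_def A_def)
  qed
  finally have nearb: "(\<integral>\<omega>. indicator A \<omega> * S' \<omega> \<partial>N) \<le> R" .
  have "(\<integral>\<omega>. indicator (space N - P) \<omega> * S' \<omega> \<partial>N)
     \<le> (\<integral>\<omega>. indicator A \<omega> * S' \<omega> + T1 * cmax * (16 * \<nu>^4 / l^4) * (W (s + h) \<omega> - W s \<omega>) ^ 4 \<partial>N)"
  proof (rule integral_mono)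
    show "integrable N (\<lambda>\<omega>. indicator (space N - P) \<omega> * S' \<omega>)" by (intro iP) auto
    show "integrable N (\<lambda>\<omega>. indicator A \<omega> * S' \<omega> + T1 * cmax * (16 * \<nu>^4 / l^4) * (W (s + h) \<omega> - W s \<omega>) ^ 4)"
      using fb iP[OF AN] by (intro Bochner_Integration.integrable_add) (auto simp: has_bochner_integral_iff)
    fix \<omega> assume w: "\<omega> \<in> space N"
    show "indicator (space N - P) \<omega> * S' \<omega> \<le> indicator A \<omega> * S' \<omega> + T1 * cmax * (16 * \<nu>^4 / l^4) * (W (s + h) \<omega> - W s \<omega>) ^ 4"
    proof (cases "\<omega> \<in> P")
      case True
      then show ?thesis using fb0[of \<omega>] S'0[of \<omega>] by (auto split: split_indicator)
    next
      case False
      then have "S \<omega> = 0" using w Sc[of \<omega>] by (auto simp: P_iff)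
      then have "\<omega> \<in> A \<or> \<omega> \<in> C" using w by (auto simp: A_def near_def C_def S_def simp del: Q.simps)
      then show ?thesis
      proof
        assume "\<omega> \<in> A" then show ?thesis using fb0[of \<omega>] S'0[of \<omega>] False w by simp
      next
        assume "\<omega> \<in> C"
        from far[OF this] show ?thesis using S'0[of \<omega>] False w by (auto split: split_indicator)
      qed
    qed
  qed
  also have "\<dots> = (\<integral>\<omega>. indicator A \<omega> * S' \<omega> \<partial>N) + T1 * cmax * (16 * \<nu>^4 / l^4) * (3 * h\<^sup>2)"
    using fb iP[OF AN] by (subst Bochner_Integration.integral_add) (auto simp: has_bochner_integral_iff)
  also have "T1 * cmax * (16 * \<nu>^4 / l^4) * (3 * h\<^sup>2) = T1 * cmax * (48 * \<nu>^4 * h\<^sup>2 / l^4)" by simp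
  finally show "I (pos (Suc k) h t y s) + E \<le> R + T1 * cmax * (48 * \<nu>^4 * h\<^sup>2 / l^4)"
    using nearb main unfolding P_def by linarith
qed

text \<open>\<open>n - i\<close> steps remain at the date \<open>t + i * h\<close>, so that all
  cells refer to one Bermudan problem ending at \<open>t + n * h\<close>.\<close>

definition Kg :: "nat \<Rightarrow> real \<Rightarrow> real \<Rightarrow> real \<Rightarrow> 'a \<times> real \<Rightarrow> real" where
  "Kg n h t y x = (\<Sum>i<n. indicator (pos (n - i) h t y (t + real i * h)) (fst x) *
     indicator {t + real i * h..<t + real i * h + h} (snd x) * fY t y x)"

definition Rg :: "nat \<Rightarrow> real \<Rightarrow> real \<Rightarrow> real \<Rightarrow> real \<Rightarrow> 'a \<times> real \<Rightarrow> real" where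
  "Rg n h l t y x = (\<Sum>i<n. indicator (near (n - i) h l t y (t + real i * h)) (fst x) *
     indicator {t + real i * h..<t + real i * h + h} (snd x) * \<bar>fY t y x\<bar>)"

text \<open>The changes of expected value in \<open>grid_step\<close> telescope and both ends
  vanish: the path starts on the boundary, where the Bermudan value is 0, and no step remains at the
  end.\<close>

lemma grid_estimate:
  assumes t: "0 \<le> t" "t < T1" and h: "0 < h" and n: "t + real n * h = T1"
    and l: "0 < l" "L * h + \<nu>\<^sup>2 / 2 * h \<le> l / 2" and y: "y = ys t"
  shows "integrable PM (Kg n h t y)" "integrable PM (Rg n h l t y)"
    and "0 \<le> (\<integral>x. Kg n h t y x \<partial>PM)"
    and "(\<integral>x. Kg n h t y x \<partial>PM) \<le> (\<integral>x. Rg n h l t y x \<partial>PM) + real n * (T1 * cmax * (48 * \<nu>^4 * h\<^sup>2 / l^4))"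
proof -
  define s where "s i = t + real i * h" for i
  define Ki where "Ki i x = indicator (pos (n - i) h t y (s i)) (fst x) * indicator {s i..<s i + h} (snd x) * fY t y x" for i x
  define Ri where "Ri i x = indicator (near (n - i) h l t y (s i)) (fst x) * indicator {s i..<s i + h} (snd x) * \<bar>fY t y x\<bar>" for i x
  have Kg: "Kg n h t y = (\<lambda>x. \<Sum>i<n. Ki i x)" and Rg: "Rg n h l t y = (\<lambda>x. \<Sum>i<n. Ri i x)"
    by (auto simp: Kg_def Rg_def Ki_def Ri_def s_def fun_eq_iff)
  define S where "S i = (\<integral>\<omega>. Q (n - i) h (s i) (Y t y (s i) \<omega>) \<partial>N)" for i
  have st: "t \<le> s i" for i using h by (simp add: s_def)
  have sS: "s i + h = s (Suc i)" for i by (simp add: s_def algebra_simps)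
  have send: "s i + real (Suc (n - Suc i)) * h \<le> T1" if "i < n" for i
  proof -
    have "real (Suc (n - Suc i)) = real n - real i" using that by simp
    then show ?thesis using n by (simp add: s_def algebra_simps)
  qed
  have sT: "s i + h \<le> T1" if "i < n" for i
  proof -
    have "0 \<le> real (n - Suc i) * h" using h by simp
    moreover have "s i + h + real (n - Suc i) * h \<le> T1" using send[OF that] by (simp add: algebra_simps)
    ultimately show ?thesis by linarith
  qed
  have Sn: "n - i = Suc (n - Suc i)" if "i < n" for i using that by simp
  have sets: "pos (n - i) h t y (s i) \<in> sets N" "near (n - i) h l t y (s i) \<in> sets N" if "i < n" for i
  proof -
    have "s i \<le> T1" using sT[OF that] h by simp
    then show "pos (n - i) h t y (s i) \<in> sets N" "near (n - i) h l t y (s i) \<in> sets N"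
      using near_sets[OF t(1) st _ h] F_sub by blast+
  qed
  have Ki: "integrable PM (Ki i)" if i: "i < n" for i
  proof -
    note [measurable] = sets[OF i]
    show ?thesis unfolding Ki_def
      using sT[OF i] st[of i] by (intro fY_int[OF t(1)]) (auto split: split_indicator)
  qed
  have Ri: "integrable PM (Ri i)" if i: "i < n" for i
  proof -
    note [measurable] = sets[OF i]
    have "integrable PM (\<lambda>x. indicator (near (n - i) h l t y (s i)) (fst x) * indicator {s i..<s i + h} (snd x) * fY t y x)"
      using sT[OF i] st[of i] by (intro fY_int[OF t(1)]) (auto split: split_indicator)
    from integrable_abs[OF this] show ?thesis unfolding Ri_def by (simp add: abs_mult)
  qed
  show "integrable PM (Kg n h t y)" unfolding Kg using Ki by (intro Bochner_Integration.integrable_sum) auto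
  show "integrable PM (Rg n h l t y)" unfolding Rg using Ri by (intro Bochner_Integration.integrable_sum) auto
  have "0 \<le> (\<integral>x. Ki i x \<partial>PM) + (S (Suc i) - S i)"
    "(\<integral>x. Ki i x \<partial>PM) + (S (Suc i) - S i) \<le> (\<integral>x. Ri i x \<partial>PM) + T1 * cmax * (48 * \<nu>^4 * h\<^sup>2 / l^4)" if i: "i < n" for i
    using grid_step[OF t(1) st h send[OF i] l, of y] unfolding Ki_def Ri_def S_def sS Sn[OF i, symmetric] by auto
  note st1 = this
  have KI: "(\<integral>x. Kg n h t y x \<partial>PM) = (\<Sum>i<n. \<integral>x. Ki i x \<partial>PM)"
    unfolding Kg using Ki by (intro Bochner_Integration.integral_sum) auto
  have RI: "(\<integral>x. Rg n h l t y x \<partial>PM) = (\<Sum>i<n. \<integral>x. Ri i x \<partial>PM)"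
    unfolding Rg using Ri by (intro Bochner_Integration.integral_sum) auto
  have S0: "S 0 = 0"
  proof -
    have "\<not> 0 < Q n h t y"
      using Q_pos_imp_Cont[OF t(1) h, of n y] n boundary[OF t, of y] y by auto
    then have "Q n h t y = 0" using Q_nonneg[of n h t y] by simp
    then show ?thesis by (simp add: S_def s_def)
  qed
  have Sn0: "S n = 0" by (simp add: S_def)
  have tele: "(\<Sum>i<n. S (Suc i) - S i) = 0" using S0 Sn0 by (simp add: sum_lessThan_telescope)
  have "0 \<le> (\<Sum>i<n. (\<integral>x. Ki i x \<partial>PM) + (S (Suc i) - S i))"
    using st1(1) by (intro sum_nonneg) auto
  then show "0 \<le> (\<integral>x. Kg n h t y x \<partial>PM)" unfolding sum.distrib tele KI by simp
  have "(\<Sum>i<n. (\<integral>x. Ki i x \<partial>PM) + (S (Suc i) - S i)) \<le> (\<Sum>i<n. (\<integral>x. Ri i x \<partial>PM) + T1 * cmax * (48 * \<nu>^4 * h\<^sup>2 / l^4))"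
    using st1(2) by (intro sum_mono) auto
  then show "(\<integral>x. Kg n h t y x \<partial>PM) \<le> (\<integral>x. Rg n h l t y x \<partial>PM) + real n * (T1 * cmax * (48 * \<nu>^4 * h\<^sup>2 / l^4))"
    unfolding sum.distrib tele KI RI by simp
qed

end

section \<open>Passage to the limit along refining grids\<close>

context stopping_boundary
begin

lemma Kg_eq:
  assumes "0 < h"
  shows "Kg n h t y x = (if t \<le> snd x \<and> snd x < t + real n * h
    then indicator (pos (n - nat \<lfloor>(snd x - t) / h\<rfloor>) h t y (t + real (nat \<lfloor>(snd x - t) / h\<rfloor>) * h)) (fst x) * fY t y x else 0)"
  using grid_sum[OF assms, where k = n and s = t and u = "snd x" and g = "\<lambda>i. indicator (pos (n - i) h t y (t + real i * h)) (fst x) * fY t y x"]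
  unfolding Kg_def by (simp add: ac_simps)

lemma Rg_eq:
  assumes "0 < h"
  shows "Rg n h l t y x = (if t \<le> snd x \<and> snd x < t + real n * h
    then indicator (near (n - nat \<lfloor>(snd x - t) / h\<rfloor>) h l t y (t + real (nat \<lfloor>(snd x - t) / h\<rfloor>) * h)) (fst x) * \<bar>fY t y x\<bar> else 0)"
  using grid_sum[OF assms, where k = n and s = t and u = "snd x" and g = "\<lambda>i. indicator (near (n - i) h l t y (t + real i * h)) (fst x) * \<bar>fY t y x\<bar>"]
  unfolding Rg_def by (simp add: ac_simps)

text \<open>Below the boundary a slightly higher level continues at u, and
  \<open>Q_time_shift\<close> brings this back to the last grid date before u. Above it, continuity
  of \<open>ys\<close> at u and the vanishing width keep the path eventually out of both sets. On
  the boundary both integrands are 0.\<close>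

lemma grid_integrands_tendsto:
  assumes t: "0 \<le> t" and u: "t < u" "u < T1" and w: "\<omega> \<in> space N"
    and cont_u: "continuous (at u within {0..<T1}) ys"
    and off: "Y t y u \<omega> \<noteq> ys u \<or> fY t y (\<omega>, u) = 0"
    and l: "l \<longlonglongrightarrow> 0" and l_pos: "\<And>n. 0 < l n"
  defines "h \<equiv> \<lambda>n. (T1 - t) / real (Suc n)"
  shows "(\<lambda>n. Kg (Suc n) (h n) t y (\<omega>, u)) \<longlonglongrightarrow> of_bool (Y t y u \<omega> < ys u) * fY t y (\<omega>, u)"
    and "(\<lambda>n. Rg (Suc n) (h n) (l n) t y (\<omega>, u)) \<longlonglongrightarrow> 0"
proof -
  have h: "0 < h n" for n using u by (simp add: h_def)
  have hn: "t + real (Suc n) * h n = T1" for n by (simp add: h_def)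
  have h0: "h \<longlonglongrightarrow> 0"
    unfolding h_def using LIMSEQ_Suc[OF lim_const_over_n[of "T1 - t"]] by simp
  define i where "i n = nat \<lfloor>(u - t) / h n\<rfloor>" for n
  define s where "s n = t + real (i n) * h n" for n
  define k where "k n = Suc n - i n" for n
  have s_bd: "s n \<le> u" "u < s n + h n" for n
  proof -
    have "0 \<le> (u - t) / h n" using u h[of n] by simp
    then have ri: "real (i n) = of_int \<lfloor>(u - t) / h n\<rfloor>" by (simp add: i_def)
    have "real (i n) \<le> (u - t) / h n" "(u - t) / h n < real (i n) + 1" unfolding ri by linarith+
    then show "s n \<le> u" "u < s n + h n" using h[of n] by (auto simp: s_def field_simps)
  qed
  have s_ge: "t \<le> s n" for n using h[of n] by (simp add: s_def)
  have s_lt: "s n < T1" for n using s_bd(1)[of n] u by simp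
  have i_lt: "i n < Suc n" for n
  proof -
    have "t + real (i n) * h n < t + real (Suc n) * h n" using s_lt[of n] hn[of n] by (simp add: s_def)
    then show ?thesis using h[of n] by simp
  qed
  have sk: "s n + real (k n) * h n = T1" for n
  proof -
    have k': "real (k n) = real (Suc n) - real (i n)" using i_lt[of n] by (simp add: k_def of_nat_diff)
    have "s n + real (k n) * h n = t + real (Suc n) * h n" unfolding s_def k' by (simp only: algebra_simps)
    then show ?thesis using hn by simp
  qed
  have s0: "s \<longlonglongrightarrow> u"
  proof (rule tendsto_sandwich[where f = "\<lambda>n. u - h n" and h = "\<lambda>_. u"])
    show "(\<lambda>n. u - h n) \<longlonglongrightarrow> u" using tendsto_diff[OF tendsto_const h0, of u] by simp
    show "\<forall>\<^sub>F n in sequentially. u - h n \<le> s n" using s_bd(2) by (intro always_eventually allI) (simp add: less_imp_le algebra_simps)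
    show "\<forall>\<^sub>F n in sequentially. s n \<le> u" by (intro always_eventually allI s_bd)
  qed simp
  have Ys: "(\<lambda>n. Y t y (s n) \<omega>) \<longlonglongrightarrow> Y t y u \<omega>"
    using continuous_on_tendsto_compose[OF Y_cont[OF w] s0] by simp
  have yss: "(\<lambda>n. ys (s n)) \<longlonglongrightarrow> ys u"
  proof -
    have "\<forall>n. s n \<in> {0..<T1}" using s_lt order_trans[OF t s_ge] by auto
    then show ?thesis using cont_u s0 unfolding continuous_within_sequentially comp_def by blast
  qed
  have Keq: "Kg (Suc n) (h n) t y (\<omega>, u) = of_bool (0 < Q (k n) (h n) (s n) (Y t y (s n) \<omega>)) * fY t y (\<omega>, u)" for n
    unfolding Kg_eq[OF h] using u hn[of n] w by (simp add: pos_def i_def s_def k_def indicator_def)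
  have Req: "Rg (Suc n) (h n) (l n) t y (\<omega>, u)
    = of_bool (Q (k n) (h n) (s n) (Y t y (s n) \<omega>) = 0 \<and> Y t y (s n) \<omega> < ys (s n) + l n) * \<bar>fY t y (\<omega>, u)\<bar>" for n
    unfolding Rg_eq[OF h] using u hn[of n] w by (simp add: near_def i_def s_def k_def indicator_def)
  consider "Y t y u \<omega> < ys u" | "ys u < Y t y u \<omega>" | "fY t y (\<omega>, u) = 0" "Y t y u \<omega> = ys u" using off by linarith
  then have "(\<lambda>n. Kg (Suc n) (h n) t y (\<omega>, u)) \<longlonglongrightarrow> of_bool (Y t y u \<omega> < ys u) * fY t y (\<omega>, u) \<and>
    (\<lambda>n. Rg (Suc n) (h n) (l n) t y (\<omega>, u)) \<longlonglongrightarrow> 0"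
  proof cases
    case 1
    define y0 where "y0 = (Y t y u \<omega> + ys u) / 2"
    have y0: "Y t y u \<omega> < y0" "y0 < ys u" using 1 by (auto simp: y0_def)
    have u0: "0 \<le> u" using t u by simp
    have "Cont u y0" using boundary[OF u0 u(2)] y0 by simp
    then obtain H where H: "0 < H" "\<And>h k. 0 < h \<Longrightarrow> h < H \<Longrightarrow> u + real k * h \<le> T1 \<Longrightarrow> T1 \<le> u + real k * h + h \<Longrightarrow> 0 < Q k h u y0"
      using Cont_imp_Q_pos[OF u0] by blast
    have "(\<lambda>n. Y t y (s n) \<omega> + L * (u - s n)) \<longlonglongrightarrow> Y t y u \<omega> + L * (u - u)"
      by (intro tendsto_intros Ys s0)
    then have e1: "\<forall>\<^sub>F n in sequentially. Y t y (s n) \<omega> + L * (u - s n) < y0"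
      using y0 by (intro order_tendstoD(2)) auto
    have e2: "\<forall>\<^sub>F n in sequentially. h n < H" using h0 H(1) by (rule order_tendstoD)
    have ev: "\<forall>\<^sub>F n in sequentially. 0 < Q (k n) (h n) (s n) (Y t y (s n) \<omega>)"
      using e1 e2
    proof eventually_elim
      case (elim n)
      \<comment> \<open>A grid restarted at u has one step less, because u lies inside the cell that
        starts at \<open>s n\<close>; \<open>Q_mono_steps\<close> restores that step.\<close>
      obtain k' where k': "k n = Suc k'" using i_lt[of n] by (cases "k n") (auto simp: k_def)
      have c: "u + real k' * h n \<le> T1" "T1 \<le> u + real k' * h n + h n"
        using sk[of n] s_bd[of n] unfolding k' by (auto simp: algebra_simps)
      have kk: "s n + real k' * h n \<le> T1" using c s_bd(1)[of n] by linarith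
      have "0 < exp (- \<theta> * (u - s n)) * Q k' (h n) u y0" using H(2)[OF h elim(2) c] by simp
      also have "\<dots> \<le> Q k' (h n) (s n) (y0 - L * (u - s n))"
        using t s_ge[of n] by (intro Q_time_shift h s_bd c) auto
      also have "\<dots> \<le> Q (Suc k') (h n) (s n) (y0 - L * (u - s n))"
        using t s_ge[of n] sk[of n] unfolding k' by (intro Q_mono_steps h) auto
      also have "\<dots> \<le> Q (k n) (h n) (s n) (Y t y (s n) \<omega>)"
        unfolding k' using t s_ge[of n] sk[of n] elim(1) unfolding k' by (intro Q_antimono h) auto
      finally show ?case .
    qed
    show ?thesis
    proof
      show "(\<lambda>n. Kg (Suc n) (h n) t y (\<omega>, u)) \<longlonglongrightarrow> of_bool (Y t y u \<omega> < ys u) * fY t y (\<omega>, u)"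
        by (rule tendsto_eventually) (use ev in eventually_elim, use 1 in \<open>simp add: Keq\<close>)
      show "(\<lambda>n. Rg (Suc n) (h n) (l n) t y (\<omega>, u)) \<longlonglongrightarrow> 0"
        by (rule tendsto_eventually) (use ev in eventually_elim, simp add: Req)
    qed
  next
    case 2
    have "(\<lambda>n. Y t y (s n) \<omega> - (ys (s n) + l n)) \<longlonglongrightarrow> Y t y u \<omega> - (ys u + 0)"
      by (intro tendsto_intros Ys yss l)
    then have e1: "\<forall>\<^sub>F n in sequentially. 0 < Y t y (s n) \<omega> - (ys (s n) + l n)"
      using 2 by (intro order_tendstoD(1)) auto
    have noQ: "\<not> 0 < Q (k n) (h n) (s n) (Y t y (s n) \<omega>)" if "0 < Y t y (s n) \<omega> - (ys (s n) + l n)" for n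
    proof
      assume "0 < Q (k n) (h n) (s n) (Y t y (s n) \<omega>)"
      then have "Cont (s n) (Y t y (s n) \<omega>)"
        using t s_ge[of n] sk[of n] by (intro Q_pos_imp_Cont[OF _ h]) auto
      then have "Y t y (s n) \<omega> < ys (s n)" using boundary[of "s n"] t s_ge[of n] s_lt[of n] by simp
      then show False using that l_pos[of n] by simp
    qed
    show ?thesis
    proof
      show "(\<lambda>n. Kg (Suc n) (h n) t y (\<omega>, u)) \<longlonglongrightarrow> of_bool (Y t y u \<omega> < ys u) * fY t y (\<omega>, u)"
        by (rule tendsto_eventually) (use e1 in eventually_elim, use 2 noQ in \<open>simp add: Keq\<close>)
      show "(\<lambda>n. Rg (Suc n) (h n) (l n) t y (\<omega>, u)) \<longlonglongrightarrow> 0"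
        by (rule tendsto_eventually) (use e1 in eventually_elim, simp add: Req)
    qed
  next
    case 3
    then show ?thesis by (simp add: Keq Req)
  qed
  then show "(\<lambda>n. Kg (Suc n) (h n) t y (\<omega>, u)) \<longlonglongrightarrow> of_bool (Y t y u \<omega> < ys u) * fY t y (\<omega>, u)"
    "(\<lambda>n. Rg (Suc n) (h n) (l n) t y (\<omega>, u)) \<longlonglongrightarrow> 0" by auto
qed

theorem boundary_integral_equation:
  assumes t: "0 \<le> t" "t < T1"
  shows "(\<integral>x. indicator {t<..<T1} (snd x) * (of_bool (Y t (ys t) (snd x) (fst x) < ys (snd x)) * fY t (ys t) x) \<partial>PM) = 0"
proof -
  define y where "y = ys t"
  define h where "h n = (T1 - t) / real (Suc n)" for n
  \<comment> \<open>The eighth root of h. Then \<open>h / l = l^7\<close> tends to 0, which meets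
    the width condition of \<open>grid_step\<close> eventually, and
    \<open>h^2 / l^4 = h * sqrt h\<close> outweighs the number of steps.\<close>
  define l where "l n = sqrt (sqrt (sqrt (h n)))" for n
  have h: "0 < h n" for n using t by (simp add: h_def)
  have hn: "t + real (Suc n) * h n = T1" for n by (simp add: h_def)
  have h0: "h \<longlonglongrightarrow> 0"
    unfolding h_def using LIMSEQ_Suc[OF lim_const_over_n[of "T1 - t"]] by simp
  have l_pos: "0 < l n" for n using h[of n] by (simp add: l_def)
  have l0: "l \<longlonglongrightarrow> 0"
    unfolding l_def using tendsto_real_sqrt[OF tendsto_real_sqrt[OF tendsto_real_sqrt[OF h0]]] by simp
  have l2: "(l n)\<^sup>2 = sqrt (sqrt (h n))" for n unfolding l_def using h[of n] by simp
  have l4: "(l n) ^ 4 = sqrt (h n)" for n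
    using power_mult[of "l n" 2 2] h[of n] by (simp add: l2)
  have l8: "(l n) ^ 8 = h n" for n
    using power_mult[of "l n" 4 2] h[of n] by (simp add: l4)
  define NL' where "NL' = (N \<Otimes>\<^sub>M (lborel :: real measure))"
  define K where "K x = indicator {t<..<T1} (snd x) * (of_bool (Y t y (snd x) (fst x) < ysm (snd x)) * fY t y x)" for x :: "'a \<times> real"
  have K_meas: "K \<in> borel_measurable NL'"
    unfolding K_def NL'_def of_bool_def by measurable
  have ev_l: "\<forall>\<^sub>F n in sequentially. L * h n + \<nu>\<^sup>2 / 2 * h n \<le> l n / 2"
  proof -
    have "(\<lambda>n. (L + \<nu>\<^sup>2 / 2) * (l n) ^ 7) \<longlonglongrightarrow> (L + \<nu>\<^sup>2 / 2) * 0 ^ 7"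
      by (intro tendsto_intros l0)
    then have "\<forall>\<^sub>F n in sequentially. (L + \<nu>\<^sup>2 / 2) * (l n) ^ 7 < 1 / 2"
      by (intro order_tendstoD(2)) auto
    then show ?thesis
    proof eventually_elim
      case (elim n)
      have "h n = (l n) ^ 7 * l n" using l8[of n] by (simp add: power_Suc2[symmetric] del: power_Suc)
      then have "L * h n + \<nu>\<^sup>2 / 2 * h n = ((L + \<nu>\<^sup>2 / 2) * (l n) ^ 7) * l n" by (simp add: algebra_simps)
      also have "\<dots> \<le> 1 / 2 * l n" using elim l_pos[of n] by (intro mult_right_mono) auto
      finally show ?case by simp
    qed
  qed
  define D where "D = {u \<in> {0..<T1}. \<not> continuous (at u within {0..<T1}) ys}"
  have D: "countable D" unfolding D_def by (rule ys_discont_countable)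
  have D_sets[measurable]: "D \<in> sets borel" by (rule sets.countable[OF _ D]) simp
  \<comment> \<open>\<open>AE_off_boundary\<close> gives the null sets at fixed times; exchanging
    the order of the two quantifiers makes them one null set of the product.\<close>
  have AE1: "AE x in NL'. snd x \<in> {t<..<T1} \<longrightarrow> snd x \<notin> D \<and> (Y t y (snd x) (fst x) \<noteq> ysm (snd x) \<or> f (snd x) (Y t y (snd x) (fst x)) = 0)"
    unfolding NL'_def
  proof (rule NL.AE_pair_measure)
    let ?P = "\<lambda>\<omega> u. u \<in> {t<..<T1} \<longrightarrow> u \<notin> D \<and> (Y t y u \<omega> \<noteq> ysm u \<or> f u (Y t y u \<omega>) = 0)"
    have fm: "(\<lambda>x. f (snd x) (Y t y (snd x) (fst x))) \<in> borel_measurable PM"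
      using fY_meas[of t y] unfolding fY_def by simp
    note [measurable] = fm
    show meas: "{x \<in> space PM. ?P (fst x) (snd x)} \<in> sets PM"
      by measurable
    have "AE u in lborel. AE \<omega> in N. ?P \<omega> u"
    proof -
      have "AE u in lborel. u \<notin> D" using countable_imp_null_set_lborel[OF D] by (rule AE_not_in)
      with AE_off_boundary[OF t, of y] show ?thesis
      proof eventually_elim
        case (elim u)
        show ?case
        proof (cases "u \<in> {t<..<T1}")
          case True
          then have "AE \<omega> in N. Y t y u \<omega> \<noteq> ysm u \<or> f u (Y t y u \<omega>) = 0" using elim by simp
          then show ?thesis by eventually_elim (use elim in simp)
        next
          case False
          show ?thesis by (rule AE_I2) (use False in auto)
        qed
      qed
    qed
    then show "AE \<omega> in N. AE u in lborel. ?P (fst (\<omega>, u)) (snd (\<omega>, u))"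
      unfolding fst_conv snd_conv by (subst NL.AE_commute[OF meas])
  qed
  \<comment> \<open>The grid integrands also live at the starting time, the limit does not.\<close>
  have AEt: "AE x in NL'. snd x \<noteq> t"
    unfolding NL'_def
  proof (rule NL.AE_pair_measure)
    show "{x \<in> space PM. snd x \<noteq> t} \<in> sets PM" by measurable
    show "AE \<omega> in N. AE u in lborel. snd (\<omega>, u) \<noteq> t"
      using AE_lborel_singleton[of t] by simp
  qed
  have sp: "fst x \<in> space N" if "x \<in> space NL'" for x using that by (simp add: NL'_def space_NL)
  have lim: "AE x in NL'. (\<lambda>n. Kg (Suc n) (h n) t y x) \<longlonglongrightarrow> K x \<and> (\<lambda>n. Rg (Suc n) (h n) (l n) t y x) \<longlonglongrightarrow> 0"
    using AE1 AEt AE_space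
  proof eventually_elim
    case (elim x)
    show ?case
    proof (cases "snd x \<in> {t<..<T1}")
      case True
      then have u: "t < snd x" "snd x < T1" "snd x \<notin> D" using elim(1) by auto
      then have c: "continuous (at (snd x) within {0..<T1}) ys" using t by (auto simp: D_def)
      have e: "ysm (snd x) = ys (snd x)" using u t by (intro ysm_eq) auto
      have off: "Y t y (snd x) (fst x) \<noteq> ys (snd x) \<or> fY t y (fst x, snd x) = 0"
        using elim True e by (auto simp: fY_def)
      show ?thesis
        using grid_integrands_tendsto[OF t(1) u(1,2) sp[OF elim(3)] c off l0 l_pos, folded h_def] True e
        unfolding K_def by simp
    next
      case False
      then have out: "\<not> (t \<le> snd x \<and> snd x < T1)" using elim(2) by auto
      have "Kg (Suc n) (h n) t y x = 0" "Rg (Suc n) (h n) (l n) t y x = 0" for n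
        unfolding Kg_eq[OF h] Rg_eq[OF h] hn if_not_P[OF out] by (rule refl)+
      then show ?thesis using False by (simp add: K_def)
    qed
  qed
  have fb0: "0 \<le> fbd t y x" for x using fY_bound[OF t(1), of 0 x y] by simp
  have fb1: "\<bar>fY t y x\<bar> \<le> fbd t y x" if "t \<le> snd x \<and> snd x < T1" for x
    using fY_bound[OF t(1), of 1 x y] that by simp
  have bdK: "\<bar>Kg (Suc n) (h n) t y x\<bar> \<le> fbd t y x" for n x
    unfolding Kg_eq[OF h] hn using fb0[of x] fb1[of x] by (simp split: split_indicator)
  have bdR: "\<bar>Rg (Suc n) (h n) (l n) t y x\<bar> \<le> fbd t y x" for n x
    unfolding Rg_eq[OF h] hn using fb0[of x] fb1[of x] by (simp split: split_indicator)
  obtain n0 where n0: "\<And>n. n0 \<le> n \<Longrightarrow> L * h n + \<nu>\<^sup>2 / 2 * h n \<le> l n / 2"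
    using ev_l unfolding eventually_sequentially by blast
  note ge = grid_estimate[OF t h hn l_pos n0 y_def, folded NL'_def]
  have fbd_NL: "integrable NL' (fbd t y)" unfolding NL'_def by (rule fbd_int[OF t(1)])
  have IK: "(\<lambda>n. \<integral>x. Kg (Suc (n + n0)) (h (n + n0)) t y x \<partial>NL') \<longlonglongrightarrow> (\<integral>x. K x \<partial>NL')"
  proof (rule integral_dominated_convergence[where w = "fbd t y"])
    show "Kg (Suc (n + n0)) (h (n + n0)) t y \<in> borel_measurable NL'" for n
      using ge(1)[of "n + n0"] by simp
    show "AE x in NL'. (\<lambda>n. Kg (Suc (n + n0)) (h (n + n0)) t y x) \<longlonglongrightarrow> K x"
      using lim by eventually_elim (use LIMSEQ_ignore_initial_segment in blast)
  qed (use K_meas fbd_NL bdK in auto)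
  have "(\<lambda>n. \<integral>x. Rg (Suc (n + n0)) (h (n + n0)) (l (n + n0)) t y x \<partial>NL') \<longlonglongrightarrow> (\<integral>x. 0 \<partial>NL')"
  proof (rule integral_dominated_convergence[where w = "fbd t y"])
    show "Rg (Suc (n + n0)) (h (n + n0)) (l (n + n0)) t y \<in> borel_measurable NL'" for n
      using ge(2)[of "n + n0"] by simp
    show "AE x in NL'. (\<lambda>n. Rg (Suc (n + n0)) (h (n + n0)) (l (n + n0)) t y x) \<longlonglongrightarrow> 0"
      using lim by eventually_elim (use LIMSEQ_ignore_initial_segment in blast)
  qed (use fbd_NL bdR in auto)
  then have IR: "(\<lambda>n. \<integral>x. Rg (Suc (n + n0)) (h (n + n0)) (l (n + n0)) t y x \<partial>NL') \<longlonglongrightarrow> 0" by simp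
  have "real (Suc n) * (T1 * cmax * (48 * \<nu>^4 * (h n)\<^sup>2 / (l n)^4)) = 48 * T1 * cmax * \<nu>^4 * (T1 - t) * sqrt (h n)" for n
  proof -
    have "h n / sqrt (h n) = sqrt (h n)" using h[of n] by (simp add: real_div_sqrt)
    moreover have "real (Suc n) * h n = T1 - t" using hn[of n] by linarith
    moreover have "real (Suc n) * (T1 * cmax * (48 * \<nu>^4 * (h n)\<^sup>2 / (l n)^4))
        = 48 * T1 * cmax * \<nu>^4 * (real (Suc n) * h n) * (h n / sqrt (h n))"
      unfolding l4 by (simp add: power2_eq_square)
    ultimately show ?thesis by (simp only:)
  qed
  moreover have "(\<lambda>n. 48 * T1 * cmax * \<nu>^4 * (T1 - t) * sqrt (h n)) \<longlonglongrightarrow> 48 * T1 * cmax * \<nu>^4 * (T1 - t) * sqrt 0"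
    by (intro tendsto_intros h0)
  ultimately have "(\<lambda>n. real (Suc n) * (T1 * cmax * (48 * \<nu>^4 * (h n)\<^sup>2 / (l n)^4))) \<longlonglongrightarrow> 0" by simp
  then have err: "(\<lambda>n. real (Suc (n + n0)) * (T1 * cmax * (48 * \<nu>^4 * (h (n + n0))\<^sup>2 / (l (n + n0))^4))) \<longlonglongrightarrow> 0"
    by (rule LIMSEQ_ignore_initial_segment)
  have "(\<integral>x. K x \<partial>NL') \<le> 0 + 0"
    by (rule LIMSEQ_le[OF IK tendsto_add[OF IR err]], intro exI allI impI, rule ge(4)) simp
  moreover have "0 \<le> (\<integral>x. K x \<partial>NL')"
    by (rule LIMSEQ_le_const[OF IK], intro exI allI impI, rule ge(3)) simp
  ultimately have "(\<integral>x. K x \<partial>NL') = 0" by simp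
  moreover have "(\<integral>x. indicator {t<..<T1} (snd x) * (of_bool (Y t (ys t) (snd x) (fst x) < ys (snd x)) * fY t (ys t) x) \<partial>PM) = (\<integral>x. K x \<partial>NL')"
    unfolding NL'_def K_def y_def using t
    by (intro Bochner_Integration.integral_cong refl) (auto simp: ysm_eq split: split_indicator)
  ultimately show ?thesis by simp
qed

end

section \<open>Change of measure\<close>

context brownian_on
begin

definition tilt :: "real \<Rightarrow> real \<Rightarrow> real \<Rightarrow> 'a \<Rightarrow> real" where
  "tilt c s u \<omega> = exp (c * (W u \<omega> - W s \<omega>) - c\<^sup>2 / 2 * (u - s))"

lemma tilt_meas[measurable]: "tilt c s u \<in> borel_measurable N"
  unfolding tilt_def by measurable

lemma tilt_adapt:
  assumes "0 \<le> s" "s \<le> u" "u \<le> T1"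
  shows "(\<lambda>\<omega>. ennreal (tilt c s u \<omega>)) \<in> borel_measurable (F u)"
proof -
  have [measurable]: "W s \<in> borel_measurable (F u)" "W u \<in> borel_measurable (F u)"
    using assms W_adapt'[of s u] W_adapt'[of u u] by auto
  show ?thesis unfolding tilt_def by measurable
qed

lemma tilt_mult: "ennreal (tilt c s u \<omega>) * ennreal (tilt c u v \<omega>) = ennreal (tilt c s v \<omega>)"
  by (simp add: tilt_def ennreal_mult[symmetric] exp_add[symmetric]) (simp add: field_simps)

text \<open>The density gained after u is independent of \<open>F u\<close> and has mean one, so
  whatever is known at u may be weighed with the density up to u.\<close>

lemma nn_integral_tilt:
  assumes "0 \<le> u" "u \<le> T1" and G: "G \<in> borel_measurable (F u)"
  shows "(\<integral>\<^sup>+\<omega>. G \<omega> * ennreal (tilt c u T1 \<omega>) \<partial>N) = (\<integral>\<^sup>+\<omega>. G \<omega> \<partial>N)"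
proof (cases "u = T1")
  case False
  then have u: "u < T1" using assms by simp
  have m: "(\<lambda>x. G (fst x) * ennreal (exp (c * snd x - c\<^sup>2 / 2 * (T1 - u)))) \<in> borel_measurable (F u \<Otimes>\<^sub>M borel)"
  proof (rule borel_measurable_times_ennreal[OF measurable_compose[OF measurable_fst G]])
    show "(\<lambda>x. ennreal (exp (c * snd x - c\<^sup>2 / 2 * (T1 - u)))) \<in> borel_measurable (F u \<Otimes>\<^sub>M borel)" by measurable
  qed
  have "(\<integral>\<^sup>+x. ennreal (exp (c * x - c\<^sup>2 / 2 * (T1 - u))) \<partial>gauss (T1 - u)) = 1"
  proof -
    have "(\<integral>x. exp (c * x - c\<^sup>2 / 2 * (T1 - u)) \<partial>gauss (T1 - u)) = (\<integral>x. exp (c * x) * exp (- (c\<^sup>2 / 2 * (T1 - u))) \<partial>gauss (T1 - u))"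
      by (simp only: exp_add[symmetric] add_uminus_conv_diff)
    also have "\<dots> = 1" unfolding Bochner_Integration.integral_mult_left_zero using gauss_exp(2)[of "T1 - u" c] u by (simp add: exp_add[symmetric])
    finally have 1: "(\<integral>x. exp (c * x - c\<^sup>2 / 2 * (T1 - u)) \<partial>gauss (T1 - u)) = 1" .
    have "integrable (gauss (T1 - u)) (\<lambda>x. exp (c * x - c\<^sup>2 / 2 * (T1 - u)))"
      using gauss_exp(1)[of "T1 - u" c] u by (simp add: exp_diff)
    then show ?thesis using 1 by (subst nn_integral_eq_integral) auto
  qed
  then have "(\<integral>\<^sup>+x. G \<omega> * ennreal (exp (c * x - c\<^sup>2 / 2 * (T1 - u))) \<partial>gauss (T1 - u)) = G \<omega>" for \<omega>
    by (subst nn_integral_cmult) auto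
  then show ?thesis
    using nn_integral_increment[OF assms(1) u order_refl m] unfolding tilt_def by simp
qed (simp add: tilt_def)

lemma gauss_shift:
  assumes "0 < h" and C[measurable]: "C \<in> sets borel"
  shows "(\<integral>\<^sup>+x. indicator C (x - c * h) * ennreal (exp (c * x - c\<^sup>2 / 2 * h)) \<partial>gauss h) = emeasure (gauss h) C"
proof -
  have "(\<integral>\<^sup>+x. indicator C (x - c * h) * ennreal (exp (c * x - c\<^sup>2 / 2 * h)) \<partial>gauss h)
      = (\<integral>\<^sup>+x. ennreal (normal_density 0 (sqrt h) x) * (indicator C (x - c * h) * ennreal (exp (c * x - c\<^sup>2 / 2 * h))) \<partial>lborel)"
    unfolding gauss_def by (subst nn_integral_density) auto
  also have "\<dots> = (\<integral>\<^sup>+x. ennreal (normal_density (c * h) (sqrt h) x) * indicator C (x - c * h) \<partial>lborel)"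
    using normal_density_exp_tilt[OF assms(1), of _ c]
    by (intro nn_integral_cong) (simp add: ennreal_mult[symmetric] split: split_indicator)
  also have "\<dots> = (\<integral>\<^sup>+x. ennreal (normal_density 0 (sqrt h) x) * indicator C x \<partial>lborel)"
    by (subst nn_integral_real_affine[of _ 1 "c * h"]) (auto simp: normal_density_def intro!: nn_integral_cong)
  also have "\<dots> = emeasure (gauss h) C"
    unfolding gauss_def by (subst emeasure_density) auto
  finally show ?thesis .
qed

text \<open>The substance is \<open>W_indep\<close>: the density up to u factors at s, the product
  law of the increment allows integrating it out, and the Gaussian shift turns its tilted law back
  into a centred one.\<close>

lemma girsanov:
  assumes "0 < T1"
  shows "brownian_on (density N (\<lambda>\<omega>. ennreal (tilt c 0 T1 \<omega>))) F (\<lambda>u \<omega>. W u \<omega> - c * u) T1"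
proof -
  let ?N = "density N (\<lambda>\<omega>. ennreal (tilt c 0 T1 \<omega>))"
  have emA: "emeasure ?N A = (\<integral>\<^sup>+\<omega>. indicator A \<omega> * ennreal (tilt c 0 s \<omega>) \<partial>N)" if A: "A \<in> sets (F s)" and s: "0 \<le> s" "s \<le> T1" for A s
  proof -
    have AN: "A \<in> sets N" using A F_sub by auto
    have m: "(\<lambda>\<omega>. indicator A \<omega> * ennreal (tilt c 0 s \<omega>)) \<in> borel_measurable (F s)"
      by (rule borel_measurable_times_ennreal[OF borel_measurable_indicator[OF A] tilt_adapt]) (use s in auto)
    have "emeasure ?N A = (\<integral>\<^sup>+\<omega>. (indicator A \<omega> * ennreal (tilt c 0 s \<omega>)) * ennreal (tilt c s T1 \<omega>) \<partial>N)"
      using AN unfolding mult.assoc tilt_mult by (subst emeasure_density) (auto intro!: nn_integral_cong simp: mult.commute)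
    also have "\<dots> = (\<integral>\<^sup>+\<omega>. indicator A \<omega> * ennreal (tilt c 0 s \<omega>) \<partial>N)"
      by (rule nn_integral_tilt[OF s m])
    finally show ?thesis .
  qed
  show ?thesis
  proof (intro brownian_on.intro brownian_on_axioms.intro)
    have top: "space N \<in> sets (F 0)" using sets.top[of "F 0"] by simp
    have "emeasure ?N (space N) = (\<integral>\<^sup>+\<omega>. indicator (space N) \<omega> * ennreal (tilt c 0 0 \<omega>) \<partial>N)"
      using emA[OF top] assms by simp
    also have "\<dots> = 1" by (simp add: tilt_def emeasure_space_1)
    finally show "prob_space ?N" by (intro prob_spaceI) simp
    show "filtration (space ?N) F" using filt by simp
    show "sets (F u) \<subseteq> sets ?N" for u using F_sub by simp
    show "continuous_on UNIV (\<lambda>u. W u \<omega> - c * u)" if "\<omega> \<in> space ?N" for \<omega>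
      using W_cont[of \<omega>] that by (intro continuous_intros) auto
    show "(\<lambda>\<omega>. W u \<omega> - c * u) \<in> borel_measurable (F u)" if "0 \<le> u" "u \<le> T1" for u
      using W_adapt[OF that] by measurable
    show "(\<lambda>\<omega>. W u \<omega> - c * u) \<in> borel_measurable ?N" for u by measurable
    fix s u A C assume su: "0 \<le> s" "s < u" "u \<le> T1" and A: "A \<in> sets (F s)" and C: "C \<in> sets (borel :: real measure)"
    have AN: "A \<in> sets N" using A F_sub by auto
    have h: "0 < u - s" using su by simp
    \<comment> \<open>The event in terms of the old increment, with the drift moved into the Borel
      set.\<close>
    define B where "B = A \<inter> {\<omega> \<in> space N. W u \<omega> - W s \<omega> \<in> (\<lambda>x. x - c * (u - s)) -` C}"
    have Au: "A \<in> sets (F u)" using A F_mono[of s u] su by auto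
    have inc: "(\<lambda>\<omega>. W u \<omega> - W s \<omega>) \<in> borel_measurable (F u)"
      by (rule borel_measurable_diff) (use W_adapt'[of s u] W_adapt'[of u u] su in auto)
    have C': "(\<lambda>x. x - c * (u - s)) -` C \<in> sets (borel :: real measure)"
      using measurable_sets[of "\<lambda>x. x - c * (u - s)" borel borel C] C by simp
    have Bu: "B \<in> sets (F u)"
    proof -
      have "{\<omega> \<in> space N. W u \<omega> - W s \<omega> \<in> (\<lambda>x. x - c * (u - s)) -` C} \<in> sets (F u)"
        using measurable_sets[OF inc C'] by (simp add: vimage_def Int_def conj_commute)
      then show ?thesis unfolding B_def by (rule sets.Int[OF Au])
    qed
    have mA: "(\<lambda>\<omega>. indicator A \<omega> * ennreal (tilt c 0 s \<omega>)) \<in> borel_measurable (F s)"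
      by (rule borel_measurable_times_ennreal[OF borel_measurable_indicator[OF A] tilt_adapt]) (use su in auto)
    have "A \<inter> {\<omega> \<in> space ?N. W u \<omega> - c * u - (W s \<omega> - c * s) \<in> C} = B"
      unfolding B_def by (auto simp: algebra_simps)
    then have "emeasure ?N (A \<inter> {\<omega> \<in> space ?N. W u \<omega> - c * u - (W s \<omega> - c * s) \<in> C}) = (\<integral>\<^sup>+\<omega>. indicator B \<omega> * ennreal (tilt c 0 u \<omega>) \<partial>N)"
      using emA[OF Bu] su by simp
    also have "\<dots> = (\<integral>\<^sup>+\<omega>. (indicator A \<omega> * ennreal (tilt c 0 s \<omega>)) * (indicator C ((W u \<omega> - W s \<omega>) - c * (u - s)) * ennreal (exp (c * (W u \<omega> - W s \<omega>) - c\<^sup>2 / 2 * (u - s)))) \<partial>N)"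
    proof (intro nn_integral_cong)
      fix \<omega> assume "\<omega> \<in> space N"
      then show "indicator B \<omega> * ennreal (tilt c 0 u \<omega>) = (indicator A \<omega> * ennreal (tilt c 0 s \<omega>)) * (indicator C ((W u \<omega> - W s \<omega>) - c * (u - s)) * ennreal (exp (c * (W u \<omega> - W s \<omega>) - c\<^sup>2 / 2 * (u - s))))"
        unfolding tilt_def[of c s u \<omega>, symmetric] using tilt_mult[of c 0 s \<omega> u]
        by (auto simp: B_def split: split_indicator)
    qed
    also have "\<dots> = (\<integral>\<^sup>+\<omega>. \<integral>\<^sup>+x. (indicator A \<omega> * ennreal (tilt c 0 s \<omega>)) * (indicator C (x - c * (u - s)) * ennreal (exp (c * x - c\<^sup>2 / 2 * (u - s)))) \<partial>gauss (u - s) \<partial>N)"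
    proof -
      have Cm: "(\<lambda>x. indicator C (snd x - c * (u - s)) :: ennreal) \<in> borel_measurable (F s \<Otimes>\<^sub>M (borel :: real measure))"
        by (rule measurable_compose[OF _ borel_measurable_indicator[OF C]]) measurable
      have m: "(\<lambda>x. (indicator A (fst x) * ennreal (tilt c 0 s (fst x))) * (indicator C (snd x - c * (u - s)) * ennreal (exp (c * snd x - c\<^sup>2 / 2 * (u - s))))) \<in> borel_measurable (F s \<Otimes>\<^sub>M borel)"
        by (rule borel_measurable_times_ennreal[OF measurable_compose[OF measurable_fst mA] borel_measurable_times_ennreal[OF Cm]]) measurable
      show ?thesis using nn_integral_increment[OF su m] by simp
    qed
    also have "\<dots> = (\<integral>\<^sup>+\<omega>. (indicator A \<omega> * ennreal (tilt c 0 s \<omega>)) * emeasure (gauss (u - s)) C \<partial>N)"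
      using C gauss_shift[OF h C, of c] by (intro nn_integral_cong) (subst nn_integral_cmult, auto)
    also have "\<dots> = (\<integral>\<^sup>+\<omega>. indicator A \<omega> * ennreal (tilt c 0 s \<omega>) \<partial>N) * emeasure (gauss (u - s)) C"
      using measurable_F_N mA by (intro nn_integral_multc) (auto intro: measurable_from_subalg[OF subalgebra_F])
    also have "(\<integral>\<^sup>+\<omega>. indicator A \<omega> * ennreal (tilt c 0 s \<omega>) \<partial>N) = emeasure ?N A" using emA[OF A] su by simp
    finally show "emeasure ?N (A \<inter> {\<omega> \<in> space ?N. W u \<omega> - c * u - (W s \<omega> - c * s) \<in> C}) = emeasure ?N A * emeasure (gauss (u - s)) C" .
  qed
qed

end

context stopping_problem
begin

subsection \<open>Stopping a discounted terminal value\<close>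

definition tail :: "(real \<Rightarrow> real) \<Rightarrow> real \<Rightarrow> real" where
  "tail g s = (\<integral>u. indicator {s..<T1} u * g u \<partial>lborel)"

text \<open>Freeze the martingale at \<tau>. Its mean stays \<open>exp y\<close>, so integrating it
  against g up to \<open>T1\<close> gives \<open>exp y * tail g t\<close>. The part before \<tau> is
  the running term, and the part after it is \<open>exp Y\<close> at \<tau> times the tail.\<close>

lemma stopped_value:
  assumes t: "0 \<le> t" and st: "stops t \<tau>" and g: "continuous_on UNIV g"
  shows "integrable PM (\<lambda>x. indicator {t..<\<tau> (fst x)} (snd x) * (g (snd x) * exp (Y t y (snd x) (fst x))))"
    and "integrable N (\<lambda>\<omega>. exp (Y t y (\<tau> \<omega>) \<omega>) * (V1 + tail g (\<tau> \<omega>)))"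
    and "(\<integral>x. indicator {t..<\<tau> (fst x)} (snd x) * (g (snd x) * exp (Y t y (snd x) (fst x))) \<partial>PM)
      + (\<integral>\<omega>. exp (Y t y (\<tau> \<omega>) \<omega>) * (V1 + tail g (\<tau> \<omega>)) \<partial>N) = exp y * (V1 + tail g t)"
proof -
  have stop: "stopping_time F \<tau>" and \<tau>b: "\<And>\<omega>. \<omega> \<in> space N \<Longrightarrow> t \<le> \<tau> \<omega> \<and> \<tau> \<omega> \<le> T1"
    using st by (auto simp: stops_def)
  have \<tau>m[measurable]: "\<tau> \<in> borel_measurable N" by (rule stopping_time_meas[OF stop])
  have [measurable]: "g \<in> borel_measurable borel" using g by (rule borel_measurable_continuous_onI)
  have "compact (g ` {t..T1})" using continuous_on_subset[OF g] by (intro compact_continuous_image) auto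
  then obtain gm where "\<forall>u\<in>{t..T1}. \<bar>g u\<bar> \<le> gm"
    by (auto dest!: compact_imp_bounded simp: bounded_iff)
  then have gm: "\<And>u. t \<le> u \<Longrightarrow> u \<le> T1 \<Longrightarrow> \<bar>g u\<bar> \<le> gm" by auto
  \<comment> \<open>\<open>exp Y\<close> stopped at \<tau>; optional stopping at the minimum of u
    and \<tau> gives its mean.\<close>
  define E where "E x = exp (Y t y (min (snd x) (\<tau> (fst x))) (fst x))" for x :: "'a \<times> real"
  have E_meas[measurable]: "E \<in> borel_measurable (N \<Otimes>\<^sub>M borel)"
  proof -
    have "(\<lambda>x. (fst x, min (snd x) (\<tau> (fst x)))) \<in> measurable (N \<Otimes>\<^sub>M borel) (N \<Otimes>\<^sub>M borel)" by measurable
    from measurable_compose[OF this Y_joint[of t y]] show ?thesis unfolding E_def by simp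
  qed
  have EE: "has_bochner_integral N (\<lambda>\<omega>. E (\<omega>, u)) (exp y)" if "t \<le> u" "u \<le> T1" for u
  proof -
    have "stops t (\<lambda>\<omega>. min u (\<tau> \<omega>))"
      unfolding stops_def using that \<tau>b stopping_time_min[OF stopping_time_const stop, of u] by (auto simp: min_def)
    from expY_stopped[OF t this, of y] show ?thesis by (simp add: E_def)
  qed
  define G where "G x = indicator {t..<T1} (snd x) * (g (snd x) * E x)" for x :: "'a \<times> real"
  have G_meas[measurable]: "G \<in> borel_measurable (N \<Otimes>\<^sub>M borel)" unfolding G_def by measurable
  have G_int: "integrable PM G"
  proof (rule integrableI_bounded)
    show "G \<in> borel_measurable PM" by measurable
    have "(\<integral>\<^sup>+x. ennreal (norm (G x)) \<partial>PM) = (\<integral>\<^sup>+u. \<integral>\<^sup>+\<omega>. ennreal (norm (G (\<omega>, u))) \<partial>N \<partial>lborel)"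
      by (subst NL.nn_integral_snd[symmetric]) (auto simp: split_beta')
    also have "\<dots> \<le> (\<integral>\<^sup>+u. ennreal (gm * exp y) * indicator {t..<T1} u \<partial>lborel)"
    proof (rule nn_integral_mono)
      fix u :: real
      show "(\<integral>\<^sup>+\<omega>. ennreal (norm (G (\<omega>, u))) \<partial>N) \<le> ennreal (gm * exp y) * indicator {t..<T1} u"
      proof (cases "u \<in> {t..<T1}")
        case True
        then have u: "t \<le> u" "u \<le> T1" by auto
        have gm0: "0 \<le> gm" using gm[OF u] by simp
        have "(\<integral>\<^sup>+\<omega>. ennreal (norm (G (\<omega>, u))) \<partial>N) \<le> (\<integral>\<^sup>+\<omega>. ennreal (gm * E (\<omega>, u)) \<partial>N)"
          using True gm[OF u] by (intro nn_integral_mono ennreal_leI) (auto simp: G_def abs_mult E_def)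
        also have "\<dots> = ennreal (gm * exp y)"
          using EE[OF u] gm0 by (subst nn_integral_eq_integral) (auto simp: has_bochner_integral_iff E_def)
        finally show ?thesis using True by simp
      qed (simp add: G_def)
    qed
    also have "\<dots> < \<infinity>"
      using emeasure_bounded_finite[of "{t..<T1}"] by (simp add: nn_integral_cmult_indicator ennreal_mult_less_top)
    finally show "(\<integral>\<^sup>+x. ennreal (norm (G x)) \<partial>PM) < \<infinity>" .
  qed
  have G_val: "(\<integral>x. G x \<partial>PM) = exp y * tail g t"
  proof -
    have "(\<integral>x. G x \<partial>PM) = (\<integral>u. \<integral>\<omega>. G (\<omega>, u) \<partial>N \<partial>lborel)"
      using NL.integral_snd[of "\<lambda>\<omega> u. G (\<omega>, u)"] G_int by simp
    also have "\<dots> = (\<integral>u. exp y * (indicator {t..<T1} u * g u) \<partial>lborel)"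
    proof (intro Bochner_Integration.integral_cong refl)
      fix u
      show "(\<integral>\<omega>. G (\<omega>, u) \<partial>N) = exp y * (indicator {t..<T1} u * g u)"
        using EE[of u] by (cases "u \<in> {t..<T1}") (auto simp: G_def has_bochner_integral_iff)
    qed
    finally show ?thesis unfolding tail_def by simp
  qed
  define G1 where "G1 x = indicator {t..<\<tau> (fst x)} (snd x) * G x" for x :: "'a \<times> real"
  define G2 where "G2 x = indicator {\<tau> (fst x)..<T1} (snd x) * G x" for x :: "'a \<times> real"
  have i2m: "(\<lambda>x. indicator {\<tau> (fst x)..<T1} (snd x) :: real) \<in> borel_measurable (N \<Otimes>\<^sub>M borel)"
    unfolding indicator_def atLeastLessThan_iff by measurable
  have G1i: "integrable PM G1"
  proof (rule Bochner_Integration.integrable_bound[OF G_int])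
    show "G1 \<in> borel_measurable PM"
      unfolding G1_def using borel_measurable_times[OF stop_indicator_meas[OF \<tau>m, of t] G_meas] by simp
  qed (auto simp: G1_def abs_mult split: split_indicator)
  have G2i: "integrable PM G2"
  proof (rule Bochner_Integration.integrable_bound[OF G_int])
    show "G2 \<in> borel_measurable PM"
      unfolding G2_def using borel_measurable_times[OF i2m G_meas] by simp
  qed (auto simp: G2_def abs_mult split: split_indicator)
  have Geq: "G x = G1 x + G2 x" if "x \<in> space PM" for x
    using \<tau>b[of "fst x"] that unfolding space_NL G1_def G2_def by (auto simp: G_def split: split_indicator)
  have G1eq: "G1 x = indicator {t..<\<tau> (fst x)} (snd x) * (g (snd x) * exp (Y t y (snd x) (fst x)))" if "x \<in> space PM" for x
    using \<tau>b[of "fst x"] that unfolding space_NL G1_def G_def E_def by (auto split: split_indicator)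
  show i1: "integrable PM (\<lambda>x. indicator {t..<\<tau> (fst x)} (snd x) * (g (snd x) * exp (Y t y (snd x) (fst x))))"
    using G1i by (rule iffD1[OF Bochner_Integration.integrable_cong[OF refl G1eq], rotated])
  have G2eq: "(\<integral>u. G2 (\<omega>, u) \<partial>lborel) = exp (Y t y (\<tau> \<omega>) \<omega>) * tail g (\<tau> \<omega>)" if "\<omega> \<in> space N" for \<omega>
  proof -
    have "(\<integral>u. G2 (\<omega>, u) \<partial>lborel) = (\<integral>u. exp (Y t y (\<tau> \<omega>) \<omega>) * (indicator {\<tau> \<omega>..<T1} u * g u) \<partial>lborel)"
      using \<tau>b[OF that] by (intro Bochner_Integration.integral_cong refl) (auto simp: G2_def G_def E_def min_def split: split_indicator)
    then show ?thesis unfolding tail_def by simp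
  qed
  have "integrable N (\<lambda>\<omega>. \<integral>u. G2 (\<omega>, u) \<partial>lborel)" by (rule NL.integrable_fst'[OF G2i])
  then have i2: "integrable N (\<lambda>\<omega>. exp (Y t y (\<tau> \<omega>) \<omega>) * tail g (\<tau> \<omega>))"
    by (rule iffD1[OF Bochner_Integration.integrable_cong[OF refl G2eq], rotated])
  have v2: "(\<integral>\<omega>. exp (Y t y (\<tau> \<omega>) \<omega>) * tail g (\<tau> \<omega>) \<partial>N) = (\<integral>x. G2 x \<partial>PM)"
    using NL.integral_fst'[OF G2i] Bochner_Integration.integral_cong[OF refl G2eq, of N "\<lambda>x. x"] by simp
  have ex: "integrable N (\<lambda>\<omega>. exp (Y t y (\<tau> \<omega>) \<omega>))" "(\<integral>\<omega>. exp (Y t y (\<tau> \<omega>) \<omega>) \<partial>N) = exp y"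
    using expY_stopped[OF t st, of y] by (auto simp: has_bochner_integral_iff)
  show "integrable N (\<lambda>\<omega>. exp (Y t y (\<tau> \<omega>) \<omega>) * (V1 + tail g (\<tau> \<omega>)))"
    unfolding distrib_left using ex(1) i2 by simp
  have "(\<integral>\<omega>. exp (Y t y (\<tau> \<omega>) \<omega>) * (V1 + tail g (\<tau> \<omega>)) \<partial>N) = exp y * V1 + (\<integral>x. G2 x \<partial>PM)"
    unfolding distrib_left using ex i2 v2 by simp
  moreover have "(\<integral>x. G1 x \<partial>PM) + (\<integral>x. G2 x \<partial>PM) = exp y * tail g t"
    unfolding G_val[symmetric] Bochner_Integration.integral_add[OF G1i G2i, symmetric]
    by (intro Bochner_Integration.integral_cong refl) (simp add: Geq)
  moreover have "(\<integral>x. indicator {t..<\<tau> (fst x)} (snd x) * (g (snd x) * exp (Y t y (snd x) (fst x))) \<partial>PM) = (\<integral>x. G1 x \<partial>PM)"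
    by (intro Bochner_Integration.integral_cong refl) (simp add: G1eq)
  ultimately show "(\<integral>x. indicator {t..<\<tau> (fst x)} (snd x) * (g (snd x) * exp (Y t y (snd x) (fst x))) \<partial>PM)
      + (\<integral>\<omega>. exp (Y t y (\<tau> \<omega>) \<omega>) * (V1 + tail g (\<tau> \<omega>)) \<partial>N) = exp y * (V1 + tail g t)"
    by (simp add: algebra_simps)
qed

text \<open>Everything except J is a constant that does not depend on \<tau>. This is why J measures
  the gain over stopping at once.\<close>

lemma stopped_reward:
  assumes t: "0 \<le> t" and st: "stops t \<tau>" and g: "continuous_on UNIV g"
  shows "has_bochner_integral N (\<lambda>\<omega>. (\<integral>u. indicator {t..<\<tau> \<omega>} u * (g u * exp (Y t y u \<omega>) + f u (Y t y u \<omega>)) \<partial>lborel)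
      + exp (Y t y (\<tau> \<omega>) \<omega>) * (V1 + tail g (\<tau> \<omega>))) (J t y \<tau> + exp y * (V1 + tail g t))"
proof -
  note sv = stopped_value[OF assms, of y]
  have stop: "stopping_time F \<tau>" and \<tau>b: "\<And>\<omega>. \<omega> \<in> space N \<Longrightarrow> t \<le> \<tau> \<omega> \<and> \<tau> \<omega> \<le> T1"
    using st by (auto simp: stops_def)
  have \<tau>m[measurable]: "\<tau> \<in> borel_measurable N" by (rule stopping_time_meas[OF stop])
  have bm: "(\<lambda>x. indicator ({t..<\<tau> (fst x)} \<inter> {t..<T1}) (snd x) :: real) \<in> borel_measurable (N \<Otimes>\<^sub>M borel)"
    unfolding indicator_inter_arith by (intro borel_measurable_times stop_indicator_meas[OF \<tau>m]) measurable
  have "integrable PM (\<lambda>x. indicator ({t..<\<tau> (fst x)} \<inter> {t..<T1}) (snd x) * fY t y x)"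
    by (rule fY_int[OF t bm]) (auto split: split_indicator)
  moreover have "indicator ({t..<\<tau> (fst x)} \<inter> {t..<T1}) (snd x) * fY t y x = indicator {t..<\<tau> (fst x)} (snd x) * fY t y x"
    if "x \<in> space PM" for x
    using \<tau>b[of "fst x"] that unfolding space_NL by (auto split: split_indicator)
  ultimately have i2: "integrable PM (\<lambda>x. indicator {t..<\<tau> (fst x)} (snd x) * fY t y x)"
    by (subst (asm) Bochner_Integration.integrable_cong[OF refl]) auto
  define H where "H x = indicator {t..<\<tau> (fst x)} (snd x) * (g (snd x) * exp (Y t y (snd x) (fst x)) + f (snd x) (Y t y (snd x) (fst x)))" for x :: "'a \<times> real"
  have H: "H = (\<lambda>x. indicator {t..<\<tau> (fst x)} (snd x) * (g (snd x) * exp (Y t y (snd x) (fst x))) + indicator {t..<\<tau> (fst x)} (snd x) * fY t y x)"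
    by (auto simp: H_def fY_def algebra_simps)
  have Hi: "integrable PM H" unfolding H using sv(1) i2 by (rule Bochner_Integration.integrable_add)
  have HI: "(\<integral>x. H x \<partial>PM) = (\<integral>x. indicator {t..<\<tau> (fst x)} (snd x) * (g (snd x) * exp (Y t y (snd x) (fst x))) \<partial>PM) + J t y \<tau>"
    unfolding H J_def using sv(1) i2 by (rule Bochner_Integration.integral_add)
  have "has_bochner_integral N (\<lambda>\<omega>. \<integral>u. H (\<omega>, u) \<partial>lborel) (\<integral>x. H x \<partial>PM)"
    using NL.integrable_fst'[OF Hi] NL.integral_fst'[OF Hi] by (simp add: has_bochner_integral_iff)
  from has_bochner_integral_add[OF this has_bochner_integral_integrable[OF sv(2)[of V1]]]
  have "has_bochner_integral N (\<lambda>\<omega>. (\<integral>u. H (\<omega>, u) \<partial>lborel) + exp (Y t y (\<tau> \<omega>) \<omega>) * (V1 + tail g (\<tau> \<omega>)))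
    ((\<integral>x. H x \<partial>PM) + (\<integral>\<omega>. exp (Y t y (\<tau> \<omega>) \<omega>) * (V1 + tail g (\<tau> \<omega>)) \<partial>N))" .
  moreover have "(\<integral>x. H x \<partial>PM) + (\<integral>\<omega>. exp (Y t y (\<tau> \<omega>) \<omega>) * (V1 + tail g (\<tau> \<omega>)) \<partial>N) = J t y \<tau> + exp y * (V1 + tail g t)"
    using sv(3)[of V1] HI by linarith
  ultimately show ?thesis unfolding H_def fst_conv snd_conv by simp
qed

end

section \<open>Power utilities\<close>

text \<open>Convexity of exp, that is, the weighted inequality of arithmetic and geometric means;
  equality holds at x = 1.\<close>

lemma power_concave_bound:
  assumes "0 < \<gamma>" "\<gamma> \<noteq> 1" "0 < (x::real)"
  shows "x powr (1 - \<gamma>) / (1 - \<gamma>) - x \<le> \<gamma> / (1 - \<gamma>)"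
proof (cases "\<gamma> < 1")
  case True
  have "exp ((1 - (1 - \<gamma>)) *\<^sub>R 0 + (1 - \<gamma>) *\<^sub>R ln x) \<le> (1 - (1 - \<gamma>)) * exp 0 + (1 - \<gamma>) * exp (ln x)"
    using True assms by (intro convex_onD[OF exp_convex]) auto
  then have "x powr (1 - \<gamma>) \<le> \<gamma> + (1 - \<gamma>) * x" using assms by (simp add: powr_def)
  then have "x powr (1 - \<gamma>) / (1 - \<gamma>) \<le> (\<gamma> + (1 - \<gamma>) * x) / (1 - \<gamma>)" using True by (intro divide_right_mono) auto
  also have "\<dots> = \<gamma> / (1 - \<gamma>) + x" using True by (simp add: add_divide_distrib)
  finally show ?thesis by simp
next
  case False
  then have g: "1 < \<gamma>" using assms by simp
  \<comment> \<open>The weights are chosen so that the exponents cancel: for \<gamma> > 1 the power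
    of x is negative.\<close>
  have "exp ((1 - 1 / \<gamma>) *\<^sub>R ln x + (1 / \<gamma>) *\<^sub>R ((1 - \<gamma>) * ln x)) \<le> (1 - 1 / \<gamma>) * exp (ln x) + (1 / \<gamma>) * exp ((1 - \<gamma>) * ln x)"
    using g by (intro convex_onD[OF exp_convex]) auto
  moreover have "(1 - 1 / \<gamma>) *\<^sub>R ln x + (1 / \<gamma>) *\<^sub>R ((1 - \<gamma>) * ln x) = 0" using g by (simp add: field_simps)
  ultimately have "1 \<le> (1 - 1 / \<gamma>) * x + (1 / \<gamma>) * x powr (1 - \<gamma>)" using assms by (simp add: powr_def)
  then have "\<gamma> * 1 \<le> \<gamma> * ((1 - 1 / \<gamma>) * x + (1 / \<gamma>) * x powr (1 - \<gamma>))" using g by (intro mult_left_mono) auto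
  then have "\<gamma> + (1 - \<gamma>) * x \<le> x powr (1 - \<gamma>)" using g by (simp add: algebra_simps)
  then have "x powr (1 - \<gamma>) / (1 - \<gamma>) \<le> (\<gamma> + (1 - \<gamma>) * x) / (1 - \<gamma>)" using g by (intro divide_right_mono_neg) auto
  also have "\<dots> = \<gamma> / (1 - \<gamma>) + x" using g by (simp add: add_divide_distrib)
  finally show ?thesis by simp
qed

text \<open>\<open>c0\<close> solves the first-order condition
  \<open>k * c powr (- \<gamma>) = p\<close>; substituting \<open>c = c0 * x\<close> reduces the
  claim to the scale-free bound.\<close>

lemma power_conjugate:
  assumes g: "0 < \<gamma>" "\<gamma> \<noteq> 1" and k: "0 < k" and p: "0 < p"
  shows "(SUP c\<in>{0<..}. k * c powr (1 - \<gamma>) / (1 - \<gamma>) - p * c) = k powr (1 / \<gamma>) * p powr (- gtilde \<gamma>) / gtilde \<gamma>"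
proof -
  define c0 where "c0 = (k / p) powr (1 / \<gamma>)"
  have c0: "0 < c0" using k p by (simp add: c0_def)
  have c0e: "c0 = exp ((ln k - ln p) / \<gamma>)" using k p by (simp add: c0_def powr_def ln_div)
  have kc: "k * c0 powr (1 - \<gamma>) = p * c0"
  proof -
    have "ln k + (1 - \<gamma>) * ((ln k - ln p) / \<gamma>) = ln p + (ln k - ln p) / \<gamma>"
      using g by (simp add: field_simps)
    then have "exp (ln k) * exp ((1 - \<gamma>) * ((ln k - ln p) / \<gamma>)) = exp (ln p) * exp ((ln k - ln p) / \<gamma>)"
      unfolding exp_add[symmetric] by simp
    then show ?thesis using k p by (simp add: c0e powr_def)
  qed
  have v: "k powr (1 / \<gamma>) * p powr (- gtilde \<gamma>) = p * c0"
  proof -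
    have "(1 / \<gamma>) * ln k + (- gtilde \<gamma>) * ln p = ln p + (ln k - ln p) / \<gamma>"
      using g by (simp add: gtilde_def field_simps)
    then have "exp ((1 / \<gamma>) * ln k) * exp ((- gtilde \<gamma>) * ln p) = exp (ln p) * exp ((ln k - ln p) / \<gamma>)"
      unfolding exp_add[symmetric] by simp
    then show ?thesis using k p by (simp add: c0e powr_def)
  qed
  show ?thesis unfolding v
  proof (rule cSup_eq_maximum)
    have "p * c0 / gtilde \<gamma> = k * c0 powr (1 - \<gamma>) / (1 - \<gamma>) - p * c0"
      unfolding kc using g by (simp add: gtilde_def field_simps)
    then show "p * c0 / gtilde \<gamma> \<in> (\<lambda>c. k * c powr (1 - \<gamma>) / (1 - \<gamma>) - p * c) ` {0<..}"
      using c0 by auto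
    fix w assume "w \<in> (\<lambda>c. k * c powr (1 - \<gamma>) / (1 - \<gamma>) - p * c) ` {0<..}"
    then obtain c where c: "0 < c" "w = k * c powr (1 - \<gamma>) / (1 - \<gamma>) - p * c" by auto
    define x where "x = c / c0"
    have x: "0 < x" "c = c0 * x" using c c0 by (auto simp: x_def)
    have "k * c powr (1 - \<gamma>) = (k * c0 powr (1 - \<gamma>)) * x powr (1 - \<gamma>)"
      unfolding x(2) using c0 x(1) by (simp add: powr_mult)
    then have kx: "k * c powr (1 - \<gamma>) = (p * c0) * x powr (1 - \<gamma>)" unfolding kc .
    have "w = (p * c0) * (x powr (1 - \<gamma>) / (1 - \<gamma>) - x)"
      unfolding c(2) kx using x(2) by (simp add: right_diff_distrib)
    also have "\<dots> \<le> (p * c0) * (\<gamma> / (1 - \<gamma>))"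
      using p c0 power_concave_bound[OF g x(1)] by (intro mult_left_mono) auto
    finally show "w \<le> p * c0 / gtilde \<gamma>" by (simp add: gtilde_def)
  qed
qed

section \<open>Closed forms and regularity of the coefficients\<close>

lemma LBINT_Ico:
  fixes g :: "real \<Rightarrow> real" and a b :: real
  assumes "a \<le> b"
  shows "(LBINT u=a..b. g u) = (\<integral>u. indicator {a..<b} u * g u \<partial>lborel)"
  using interval_integral_Ico[OF assms, of g] by (simp add: set_lebesgue_integral_def)

lemma LBINT_Ioo:
  fixes g :: "real \<Rightarrow> real" and a b :: real
  assumes "a \<le> b"
  shows "(LBINT u=a..b. g u) = (\<integral>u. indicator {a<..<b} u * g u \<partial>lborel)"
  using assms by (simp add: interval_lebesgue_integral_def set_lebesgue_integral_def)

lemma integral_exp_Ico: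
  fixes k a b :: real
  assumes "k \<noteq> 0" "a \<le> b"
  shows "(\<integral>u. indicator {a..<b} u * exp (k * u) \<partial>lborel) = (exp (k * b) - exp (k * a)) / k"
proof -
  have "(LBINT u=a..b. exp (k * u)) = exp (k * b) / k - exp (k * a) / k"
    using assms
    by (intro interval_integral_FTC_finite)
      (auto intro!: continuous_intros derivative_eq_intros simp: has_real_derivative_iff_has_vector_derivative[symmetric])
  then show ?thesis using LBINT_Ico[OF assms(2)] by (simp add: diff_divide_distrib)
qed

text \<open>Closed form of \<open>pT\<close>; the rate \<alpha> - \<beta> - r may vanish, which
  calls for the separate case.\<close>

definition pTc :: "real \<Rightarrow> real \<Rightarrow> real \<Rightarrow> real" where
  "pTc k T s = (if k = 0 then T - s else (exp (k * (T - s)) - 1) / k)"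

lemma pT_eq:
  assumes "s \<le> T"
  shows "pT \<alpha> \<beta> r T s = pTc (\<alpha> - \<beta> - r) T s"
proof (cases "\<alpha> - \<beta> - r = 0")
  case True
  have "(LBINT u=s..T. (1::real)) = T - s" using assms LBINT_Ico[OF assms, of "\<lambda>_. 1"] by simp
  then show ?thesis using True by (simp add: pT_def pTc_def)
next
  case False
  define k where "k = \<alpha> - \<beta> - r"
  have "(LBINT u=s..T. exp (k * (u - s))) = exp (k * (T - s)) / k - exp (k * (s - s)) / k"
    using assms False
    by (intro interval_integral_FTC_finite)
      (auto intro!: continuous_intros derivative_eq_intros simp: k_def has_real_derivative_iff_has_vector_derivative[symmetric])
  then show ?thesis using False by (simp add: pT_def pTc_def k_def diff_divide_distrib)
qed

lemma pTc_deriv: "(pTc k T has_real_derivative - exp (k * (T - s))) (at s within S)"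
proof (cases "k = 0")
  case True
  then have eq: "pTc k T = (\<lambda>s. T - s)" by (simp add: pTc_def fun_eq_iff)
  show ?thesis unfolding eq using True by (auto intro!: derivative_eq_intros)
next
  case False
  then have eq: "pTc k T = (\<lambda>s. (exp (k * (T - s)) - 1) / k)" by (simp add: pTc_def fun_eq_iff)
  show ?thesis unfolding eq using False by (auto intro!: derivative_eq_intros)
qed

lemma pTc_nonneg: "s \<le> T \<Longrightarrow> 0 \<le> pTc k T s"
proof (cases "0 \<le> k")
  case True
  assume "s \<le> T"
  then have "1 \<le> exp (k * (T - s))" using True by simp
  then show ?thesis using \<open>s \<le> T\<close> True by (simp add: pTc_def)
next
  case False
  assume "s \<le> T"
  then have "k * (T - s) \<le> 0" using False by (intro mult_nonpos_nonneg) auto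
  then have "exp (k * (T - s)) \<le> 1" by simp
  then show ?thesis using False by (simp add: pTc_def divide_nonpos_neg)
qed

text \<open>The path is frozen outside \<open>[0, T]\<close> because \<open>brownian_on\<close> asks for continuity on the whole line.\<close>

lemma brownian_motion_imp_brownian_on:
  assumes "prob_space M" "usual_filtration M F" "brownian_motion M F B" "0 < T"
  shows "brownian_on M F (\<lambda>u \<omega>. B (max 0 (min u T)) \<omega>) T"
proof -
  interpret prob_space M by fact
  have F: "filtration (space M) F" "\<And>u. sets (F u) \<subseteq> sets M" 
    using assms(2) unfolding usual_filtration_def by blast+
  have sF: "space (F u) = space M" for u using F(1) by (simp add: filtration_def)
  note bm = assms(3)[unfolded brownian_motion_def]
  note B_cont = bm[THEN conjunct2, THEN conjunct1, rule_format]
  note B_ad = bm[THEN conjunct2, THEN conjunct2, THEN conjunct1, rule_format]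
  note B_inc = bm[THEN conjunct2, THEN conjunct2, THEN conjunct2, rule_format, OF conjI]
  note B_ind = B_inc[THEN conjunct1] and B_dist = B_inc[THEN conjunct2]
  have B_meas: "B u \<in> borel_measurable M" if "0 \<le> u" for u
    using B_ad[OF that] F(2)[of u] sF[of u] by (auto simp: measurable_def)
  show ?thesis
  proof (intro brownian_on.intro brownian_on_axioms.intro)
    show "prob_space M" "filtration (space M) F" "\<And>u. sets (F u) \<subseteq> sets M" by fact+
    show "continuous_on UNIV (\<lambda>u. B (max 0 (min u T)) \<omega>)" if "\<omega> \<in> space M" for \<omega>
      by (rule continuous_on_compose2[OF B_cont[OF that]]) (auto intro!: continuous_intros)
    show "(\<lambda>\<omega>. B (max 0 (min u T)) \<omega>) \<in> borel_measurable (F u)" if "0 \<le> u" "u \<le> T" for u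
      using B_ad[OF that(1)] that by (simp add: min_def max_def)
    show "(\<lambda>\<omega>. B (max 0 (min u T)) \<omega>) \<in> borel_measurable M" for u
      using B_meas[of "max 0 (min u T)"] by simp
    fix s u A C assume su: "0 \<le> s" "s < u" "u \<le> T" and A: "A \<in> sets (F s)" and C: "C \<in> sets (borel :: real measure)"
    have eq: "max 0 (min u T) = u" "max 0 (min s T) = s" using su by auto
    define D where "D = (\<lambda>\<omega>. B u \<omega> - B s \<omega>) -` C \<inter> space M"
    have "prob (A \<inter> D) = prob A * prob D"
      using indep_setD[OF B_ind[OF su(1,2)] A, of D] C by (auto simp: D_def)
    then have "emeasure M (A \<inter> D) = emeasure M A * emeasure M D"
      by (simp add: emeasure_eq_measure ennreal_mult[symmetric])
    moreover have "emeasure M D = emeasure (distr M lborel (\<lambda>\<omega>. B u \<omega> - B s \<omega>)) C"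
      unfolding D_def using C B_dist[OF su(1,2)] by (subst emeasure_distr) (auto simp: distributed_def)
    moreover have "distr M lborel (\<lambda>\<omega>. B u \<omega> - B s \<omega>) = gauss (u - s)"
      unfolding gauss_def by (rule distributed_distr_eq_density[OF B_dist[OF su(1,2)]])
    moreover have "A \<inter> {\<omega> \<in> space M. B u \<omega> - B s \<omega> \<in> C} = A \<inter> D" by (auto simp: D_def)
    ultimately show "emeasure M (A \<inter> {\<omega> \<in> space M. B (max 0 (min u T)) \<omega> - B (max 0 (min s T)) \<omega> \<in> C}) = emeasure M A * emeasure (gauss (u - s)) C"
      unfolding eq by simp
  qed
qed

text \<open>A Lipschitz constant divided by the minimum controls relative growth, and
  \<open>1 + x \<le> exp x\<close> gives the exponential form. Clamping contracts distances, so the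
  constant survives the extension to the line.\<close>

lemma C1_clamp_growth:
  fixes A A' :: "real \<Rightarrow> real"
  assumes T: "0 < T" and d: "\<And>u. u \<in> {0..T} \<Longrightarrow> (A has_real_derivative A' u) (at u within {0..T})"
    and c: "continuous_on {0..T} A'" and pos: "\<And>u. u \<in> {0..T} \<Longrightarrow> 0 < A u"
  obtains L amax where "0 \<le> L" "\<And>u. A (max 0 (min u T)) \<le> amax"
    "\<And>v w. v \<le> w \<Longrightarrow> A (max 0 (min v T)) \<le> exp (L * (w - v)) * A (max 0 (min w T))"
    "continuous_on UNIV (\<lambda>u. A (max 0 (min u T)))"
proof -
  have Ac: "continuous_on {0..T} A"
    using d by (rule DERIV_continuous_on)
  have ne: "{0..T} \<noteq> {}" using T by auto
  obtain C where "\<forall>u\<in>{0..T}. \<bar>A' u\<bar> \<le> C"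
    using compact_imp_bounded[OF compact_continuous_image[OF c]] by (auto simp: bounded_iff)
  then have C: "\<And>u. u \<in> {0..T} \<Longrightarrow> \<bar>A' u\<bar> \<le> C" by blast
  have C0: "0 \<le> C" using C[of 0] T by fastforce
  obtain um where um: "um \<in> {0..T}" "\<And>u. u \<in> {0..T} \<Longrightarrow> A um \<le> A u"
    using continuous_attains_inf[OF _ ne Ac] by auto
  obtain uM where uM: "uM \<in> {0..T}" "\<And>u. u \<in> {0..T} \<Longrightarrow> A u \<le> A uM"
    using continuous_attains_sup[OF _ ne Ac] by auto
  have lip: "\<bar>A v - A w\<bar> \<le> C * \<bar>v - w\<bar>" if "v \<in> {0..T}" "w \<in> {0..T}" for v w
    using field_differentiable_bound[of "{0..T}" A A' C v w] d C that by auto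
  define L where "L = C / A um"
  have amin: "0 < A um" by (rule pos[OF um(1)])
  define cl where "cl u = max 0 (min u T)" for u
  have cl: "cl u \<in> {0..T}" for u using T by (auto simp: cl_def)
  have cll: "\<bar>cl v - cl w\<bar> \<le> \<bar>v - w\<bar>" for v w by (auto simp: cl_def)
  show thesis
  proof (rule that[of L "A uM"])
    show "0 \<le> L" using C0 amin by (simp add: L_def)
    show "A (max 0 (min u T)) \<le> A uM" for u using uM(2)[OF cl] unfolding cl_def .
    show "continuous_on UNIV (\<lambda>u. A (max 0 (min u T)))"
      by (rule continuous_on_compose2[OF Ac]) (use T in \<open>auto intro!: continuous_intros\<close>)
    fix v w :: real assume vw: "v \<le> w"
    have "A (cl v) \<le> A (cl w) + C * \<bar>cl v - cl w\<bar>" using lip[OF cl cl, of v w] by linarith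
    also have "\<dots> \<le> A (cl w) + C * (w - v)" using C0 cll[of v w] vw by (intro add_left_mono mult_left_mono) auto
    also have "C * (w - v) = L * (w - v) * A um" using amin by (simp add: L_def)
    also have "A (cl w) + \<dots> \<le> A (cl w) + L * (w - v) * A (cl w)"
      using um(2)[OF cl] C0 amin vw by (intro add_left_mono mult_left_mono) (auto simp: L_def)
    also have "\<dots> = (1 + L * (w - v)) * A (cl w)" by (simp add: algebra_simps)
    also have "\<dots> \<le> exp (L * (w - v)) * A (cl w)" using pos[OF cl, of w] by (intro mult_right_mono exp_ge_add_one_self) auto
    finally show "A (max 0 (min v T)) \<le> exp (L * (w - v)) * A (max 0 (min w T))" by (simp add: cl_def)
  qed
qed

section \<open>Reduction of the retirement problem\<close>

locale power_market =
  fixes M :: "'a measure" and F :: "real \<Rightarrow> 'a measure" and B :: "real \<Rightarrow> 'a \<Rightarrow> real"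
    and T1 T r \<kappa> \<rho> \<mu>w \<sigma>w \<alpha> \<beta> \<gamma> :: real and K :: "real \<Rightarrow> real"
  assumes prob: "prob_space M" and usual: "usual_filtration M F" and bm: "brownian_motion M F B"
    and T1: "0 < T1" "T1 < T" and alpha: "0 < \<alpha>" and gamma: "0 < \<gamma>" "\<gamma> \<noteq> 1"
    and K_smooth: "smooth_on {0..T} K" and K_pos: "t \<in> {0..T} \<Longrightarrow> 0 < K t"
    and Delta_neg: "t \<in> {0..T1} \<Longrightarrow> Delta \<gamma> K t < 0"
    and theta_nonzero: "theta r \<mu>w \<kappa> \<sigma>w \<noteq> 0"
begin

abbreviation gt :: real where "gt \<equiv> gtilde \<gamma>"
abbreviation th :: real where "th \<equiv> theta r \<mu>w \<kappa> \<sigma>w"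
abbreviation mu :: "real \<Rightarrow> real" where "mu \<equiv> muT \<alpha> \<beta> r T"
text \<open>\<open>dr\<close> is the drift of B under the new measure, \<open>vol\<close> the
  volatility of \<open>- gt * ln Z\<close>, and \<open>mm\<close> the growth rate of
  \<open>Z powr (- gt)\<close> under that measure. Subtracting \<open>mm * u\<close> from the
  logarithm leaves the logarithm of a martingale.\<close>

definition dr :: real where "dr = \<sigma>w - \<kappa>"
definition vol :: real where "vol = \<kappa> / \<gamma> - \<sigma>w"
definition mm :: real where "mm = vol * dr + vol\<^sup>2 / 2 - (\<rho> - \<kappa>\<^sup>2 / 2 - r) / \<gamma> - \<mu>w + \<sigma>w\<^sup>2 / 2"
definition k2 :: "real \<Rightarrow> real" where "k2 u = K u powr (1 / \<gamma>) * mu u powr (- gt) / gt"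
text \<open>The conjugate utilities have the coefficients \<open>mu powr (- gt) / gt\<close> and
  \<open>k2\<close>; the first minus the second is \<open>Delta\<close> times
  \<open>mu powr (- gt)\<close>. With the opposite sign and the growth factor this is the
  coefficient of \<open>exp y\<close> in f, up to the discount.\<close>

definition A0 :: "real \<Rightarrow> real" where "A0 u = - Delta \<gamma> K u * mu u powr (- gt) * exp (mm * u)"
definition a :: "real \<Rightarrow> real" where "a u = A0 (max 0 (min u T1))"
definition WN :: "real \<Rightarrow> 'a \<Rightarrow> real" where "WN u \<omega> = B (max 0 (min u T1)) \<omega> - dr * u"

lemma gt_nonzero: "gt \<noteq> 0"
  using gamma by (simp add: gtilde_def)

lemma mu_eq: "s \<le> T \<Longrightarrow> mu s = 1 + \<alpha> * pTc (\<alpha> - \<beta> - r) T s"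
  by (simp add: muT_def pT_eq)

lemma mu_pos: "s \<le> T \<Longrightarrow> 0 < mu s"
  using pTc_nonneg[of s T "\<alpha> - \<beta> - r"] alpha by (simp add: mu_eq add_pos_nonneg)

lemma K_derivatives:
  obtains K' where "\<And>u. u \<in> {0..T} \<Longrightarrow> (K has_real_derivative K' u) (at u within {0..T})" "continuous_on {0..T} K'"
proof -
  from K_smooth obtain D where D: "\<And>x. x \<in> {0..T} \<Longrightarrow> D 0 x = K x"
    "\<And>n x. x \<in> {0..T} \<Longrightarrow> (D n has_real_derivative D (Suc n) x) (at x within {0..T})"
    unfolding smooth_on_def by blast
  show thesis
  proof (rule that[of "D 1"])
    show "(K has_real_derivative D 1 u) (at u within {0..T})" if "u \<in> {0..T}" for u
      using has_field_derivative_transform_within[OF D(2)[OF that, of 0] zero_less_one that, of K] D(1) by simp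
    show "continuous_on {0..T} (D 1)"
      using D(2)[of _ 1] by (rule DERIV_continuous_on)
  qed
qed

lemma K_cont: "continuous_on {0..T} K"
  using K_derivatives by (metis DERIV_continuous_on)

lemma mu_cont: "continuous_on {0..T} mu"
proof -
  have "continuous_on {0..T} (\<lambda>s. 1 + \<alpha> * pTc (\<alpha> - \<beta> - r) T s)"
    using DERIV_continuous_on[OF pTc_deriv] by (intro continuous_intros) auto
  then show ?thesis by (rule continuous_on_eq) (simp add: mu_eq)
qed

lemma k2_cont: "continuous_on UNIV (\<lambda>u. k2 (max 0 (min u T)))"
proof -
  have "continuous_on {0..T} k2"
    unfolding k2_def using K_pos mu_pos gt_nonzero
    by (intro continuous_intros K_cont mu_cont) (auto simp: less_imp_neq[symmetric])
  then show ?thesis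
    by (rule continuous_on_compose2) (use T1 in \<open>auto intro!: continuous_intros\<close>)
qed

lemma A0_pos: "u \<in> {0..T1} \<Longrightarrow> 0 < A0 u"
  unfolding A0_def using Delta_neg[of u] mu_pos[of u] T1 by (intro mult_pos_pos) auto

lemma A0_C1:
  obtains A' where "\<And>u. u \<in> {0..T1} \<Longrightarrow> (A0 has_real_derivative A' u) (at u within {0..T1})" "continuous_on {0..T1} A'"
proof -
  obtain K' where K': "\<And>u. u \<in> {0..T} \<Longrightarrow> (K has_real_derivative K' u) (at u within {0..T})" "continuous_on {0..T} K'"
    using K_derivatives by blast
  define m where "m s = 1 + \<alpha> * pTc (\<alpha> - \<beta> - r) T s" for s
  define m' where "m' s = \<alpha> * (- exp ((\<alpha> - \<beta> - r) * (T - s)))" for s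
  have sub: "{0..T1} \<subseteq> {0..T}" using T1 by auto
  have mpos: "0 < m u" if "u \<in> {0..T1}" for u using mu_pos[of u] mu_eq[of u] that T1 by (simp add: m_def)
  have Kpos: "0 < K u" if "u \<in> {0..T1}" for u using K_pos[of u] that T1 by auto
  \<comment> \<open>This is \<open>- Delta\<close>, with powers written through exp and ln to make
    the derivatives elementary.\<close>
  define P1 where "P1 u = (exp (1 / \<gamma> * ln (K u)) - 1) / gt" for u
  define P1' where "P1' u = exp (1 / \<gamma> * ln (K u)) * (1 / \<gamma> * (K' u / K u)) / gt" for u
  define P2 where "P2 u = exp (- gt * ln (m u))" for u
  define P2' where "P2' u = exp (- gt * ln (m u)) * (- gt * (m' u / m u))" for u
  define P3 where "P3 u = exp (mm * u)" for u
  define P3' where "P3' u = exp (mm * u) * mm" for u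
  have dK: "(K has_real_derivative K' u) (at u within {0..T1})" if "u \<in> {0..T1}" for u
    using DERIV_subset[OF K'(1) sub] that sub by auto
  have dm: "(m has_real_derivative m' u) (at u within {0..T1})" for u
    unfolding m_def m'_def by (auto intro!: derivative_eq_intros pTc_deriv)
  have d1: "(P1 has_real_derivative P1' u) (at u within {0..T1})" if "u \<in> {0..T1}" for u
    unfolding P1_def P1'_def using Kpos[OF that] gamma gt_nonzero
    by (auto intro!: derivative_eq_intros dK[OF that] simp: field_simps)
  have d2: "(P2 has_real_derivative P2' u) (at u within {0..T1})" if "u \<in> {0..T1}" for u
    unfolding P2_def P2'_def using mpos[OF that]
    by (auto intro!: derivative_eq_intros dm simp: field_simps)
  have d3: "(P3 has_real_derivative P3' u) (at u within {0..T1})" for u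
    unfolding P3_def P3'_def by (auto intro!: derivative_eq_intros)
  have cK: "continuous_on {0..T1} K" and cK': "continuous_on {0..T1} K'"
    using continuous_on_subset[OF K_cont sub] continuous_on_subset[OF K'(2) sub] by auto
  have cm: "continuous_on {0..T1} m" using dm by (rule DERIV_continuous_on)
  have cm': "continuous_on {0..T1} m'" unfolding m'_def by (intro continuous_intros)
  have ne: "\<forall>u\<in>{0..T1}. K u \<noteq> 0" "\<forall>u\<in>{0..T1}. m u \<noteq> 0" using Kpos mpos by (auto simp: less_imp_neq[symmetric])
  have eq: "A0 u = P1 u * P2 u * P3 u" if "u \<in> {0..T1}" for u
    unfolding A0_def P1_def P2_def P3_def Delta_def powr_def using Kpos[OF that] mpos[OF that] mu_eq[of u] that T1
    by (simp add: m_def diff_divide_distrib)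
  show thesis
  proof (rule that[of "\<lambda>u. (P1' u * P2 u + P2' u * P1 u) * P3 u + P3' u * (P1 u * P2 u)"])
    fix u assume u: "u \<in> {0..T1}"
    have "((\<lambda>u. P1 u * P2 u * P3 u) has_real_derivative (P1' u * P2 u + P2' u * P1 u) * P3 u + P3' u * (P1 u * P2 u)) (at u within {0..T1})"
      by (rule DERIV_mult[OF DERIV_mult[OF d1[OF u] d2[OF u]] d3])
    then show "(A0 has_real_derivative (P1' u * P2 u + P2' u * P1 u) * P3 u + P3' u * (P1 u * P2 u)) (at u within {0..T1})"
      by (rule has_field_derivative_transform_within[OF _ zero_less_one u]) (simp add: eq)
  next
    show "continuous_on {0..T1} (\<lambda>u. (P1' u * P2 u + P2' u * P1 u) * P3 u + P3' u * (P1 u * P2 u))"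
      unfolding P1_def P1'_def P2_def P2'_def P3_def P3'_def using ne gt_nonzero
      by (intro continuous_intros cK cK' cm cm') auto
  qed
qed

sublocale BM1: brownian_on M F "\<lambda>u \<omega>. B (max 0 (min u T1)) \<omega>" T1
  by (rule brownian_motion_imp_brownian_on[OF prob usual bm T1(1)])

definition N :: "'a measure" where "N = density M (\<lambda>\<omega>. ennreal (BM1.tilt dr 0 T1 \<omega>))"

lemma space_N[simp]: "space N = space M" by (simp add: N_def)

lemma stopping_problem_exists: "\<exists>L amax. stopping_problem N F WN T1 L amax a"
proof -
  obtain A' where A': "\<And>u. u \<in> {0..T1} \<Longrightarrow> (A0 has_real_derivative A' u) (at u within {0..T1})" "continuous_on {0..T1} A'"
    using A0_C1 by blast
  obtain L amax where L: "0 \<le> L" "\<And>u. A0 (max 0 (min u T1)) \<le> amax"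
    "\<And>v w. v \<le> w \<Longrightarrow> A0 (max 0 (min v T1)) \<le> exp (L * (w - v)) * A0 (max 0 (min w T1))"
    "continuous_on UNIV (\<lambda>u. A0 (max 0 (min u T1)))"
    using C1_clamp_growth[OF T1(1) A' A0_pos] by blast
  have "brownian_on N F WN T1"
    using BM1.girsanov[OF T1(1), of dr] unfolding N_def WN_def[abs_def] .
  then have "stopping_problem N F WN T1 L amax a"
    using L T1 A0_pos by (intro stopping_problem.intro stopping_problem_axioms.intro) (auto simp: a_def)
  then show ?thesis by blast
qed

text \<open>B starts at 0, hence \<open>Ecal\<close> at \<open>T1\<close> is the density of
  \<open>N\<close>. The pointwise equation lets X be the literal expression of the problem, whose
  integrability is known through G.\<close>

lemma Etilde_eq:
  assumes "has_bochner_integral N G v" and eq: "\<And>\<omega>. \<omega> \<in> space M \<Longrightarrow> X \<omega> = G \<omega>"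
  shows "Etilde M \<sigma>w \<kappa> B T1 X = v"
proof -
  have G: "G \<in> borel_measurable M" using borel_measurable_has_bochner_integral[OF assms(1)] by (simp add: N_def)
  have B0: "B 0 \<omega> = 0" if "\<omega> \<in> space M" for \<omega> using bm that by (simp add: brownian_motion_def)
  have "Etilde M \<sigma>w \<kappa> B T1 X = (\<integral>\<omega>. BM1.tilt dr 0 T1 \<omega> *\<^sub>R G \<omega> \<partial>M)"
    unfolding Etilde_def
  proof (intro Bochner_Integration.integral_cong refl)
    fix \<omega> assume w: "\<omega> \<in> space M"
    have "Ecal \<sigma>w \<kappa> B T1 \<omega> = BM1.tilt dr 0 T1 \<omega>"
      using T1 B0[OF w] by (simp add: Ecal_def BM1.tilt_def dr_def)
    then show "Ecal \<sigma>w \<kappa> B T1 \<omega> * X \<omega> = BM1.tilt dr 0 T1 \<omega> *\<^sub>R G \<omega>" using eq[OF w] by simp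
  qed
  also have "\<dots> = (\<integral>\<omega>. G \<omega> \<partial>N)"
    unfolding N_def using G by (subst integral_density) (auto simp: BM1.tilt_def intro: BM1.tilt_meas[unfolded BM1.tilt_def])
  finally show ?thesis using assms(1) by (simp add: has_bochner_integral_iff)
qed

lemma Vhat1_eq:
  assumes "u \<le> T" "0 < z"
  shows "Vhat (U1 \<gamma>) mu u z = (z * mu u) powr (- gt) / gt"
  using power_conjugate[OF gamma, of 1 "z * mu u"] mu_pos[OF assms(1)] assms(2) by (simp add: Vhat_def U1_def)

lemma Vhat2_eq:
  assumes "0 \<le> u" "u \<le> T" "0 < z"
  shows "Vhat (U2 \<gamma> K) mu u z = k2 u * z powr (- gt)"
  using power_conjugate[OF gamma, of "K u" "z * mu u"] mu_pos[OF assms(2)] assms K_pos[of u]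
  by (simp add: Vhat_def U2_def k2_def powr_mult)

definition c3 :: real where "c3 = - \<rho> - gt * (\<rho> - \<kappa>\<^sup>2 / 2 - r) + (gt * \<kappa>)\<^sup>2 / 2"

text \<open>The left side is a growth rate under the original measure, the right side belongs to the
  new one. Their agreement makes the discounted \<open>Vtilde\<close> a multiple of
  \<open>exp Y\<close>, so that \<open>stopped_value\<close> applies to the terminal payoff.\<close>

lemma c3_eq: "c3 = th + mm"
proof -
  have g: "gt = 1 / \<gamma> - 1" using gamma by (simp add: gtilde_def field_simps)
  define i where "i = 1 / \<gamma>"
  have v: "vol = \<kappa> * i - \<sigma>w" and q: "(\<rho> - \<kappa>\<^sup>2 / 2 - r) / \<gamma> = (\<rho> - \<kappa>\<^sup>2 / 2 - r) * i"
    by (simp_all add: vol_def i_def)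
  show ?thesis
    unfolding c3_def theta_def mm_def q v dr_def g i_def[symmetric]
    by (simp add: power2_eq_square algebra_simps) (simp add: field_simps)
qed

lemma Yproc_exp: "Yproc \<rho> \<kappa> r B t z u \<omega> = z * exp ((\<rho> - \<kappa>\<^sup>2 / 2 - r) * (u - t) - \<kappa> * (B u \<omega> - B t \<omega>))"
  unfolding Yproc_def xi_from_def xi_def exp_diff[symmetric] mult.assoc exp_add[symmetric]
  by (simp add: field_simps)

lemma Vtilde_eq:
  assumes s: "0 \<le> s" "s \<le> T" and z: "0 < z"
  shows "Vtilde M B \<gamma> K \<alpha> \<beta> r T \<rho> \<kappa> s z = z powr (- gt) * (\<integral>u. indicator {s..<T} u * (k2 (max 0 (min u T)) * exp (c3 * (u - s))) \<partial>lborel)"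
proof -
  have T0: "0 < T" using T1 by simp
  interpret BT: brownian_on M F "\<lambda>u \<omega>. B (max 0 (min u T)) \<omega>" T
    by (rule brownian_motion_imp_brownian_on[OF prob usual bm T0])
  \<comment> \<open>The second phase involves no choice of a stopping time. The interpretation under
    the original measure serves to apply \<open>stopped_value\<close> at the constant time T;
    \<open>gt * \<kappa>\<close> is the volatility of \<open>- gt\<close> times the logarithm of
    \<open>Yproc\<close>.\<close>
  interpret VP: stopping_problem M F "\<lambda>u \<omega>. B (max 0 (min u T)) \<omega>" T "gt * \<kappa>" 0 0 1 "\<lambda>_. 1"
    by unfold_locales (use T0 in auto)
  define g where "g u = k2 (max 0 (min u T)) * exp (c3 * (u - s))" for u
  have g: "continuous_on UNIV g" unfolding g_def by (intro continuous_intros k2_cont)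
  have st: "VP.stops s (\<lambda>_. T)" using s by (simp add: VP.stops_def stopping_time_const)
  have int: "integrable (M \<Otimes>\<^sub>M lborel) (\<lambda>x. indicator {s..<T} (snd x) * (g (snd x) * exp (VP.Y s 0 (snd x) (fst x))))"
    using VP.stopped_value(1)[OF s(1) st g, of 0] by simp
  have val: "(\<integral>x. indicator {s..<T} (snd x) * (g (snd x) * exp (VP.Y s 0 (snd x) (fst x))) \<partial>(M \<Otimes>\<^sub>M lborel)) = VP.tail g s"
    using VP.stopped_value(3)[OF s(1) st g, of 0 0] by (simp add: VP.tail_def[of g T])
  have path: "(LBINT u=s..T. exp (- \<rho> * (u - s)) * Vhat (U2 \<gamma> K) mu u (Yproc \<rho> \<kappa> r B s z u \<omega>))
    = z powr (- gt) * (\<integral>u. indicator {s..<T} u * (g u * exp (VP.Y s 0 u \<omega>)) \<partial>lborel)" for \<omega>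
    unfolding LBINT_Ico[OF s(2)] Bochner_Integration.integral_mult_right_zero[symmetric]
  proof (intro Bochner_Integration.integral_cong refl)
    fix u
    show "indicator {s..<T} u * (exp (- \<rho> * (u - s)) * Vhat (U2 \<gamma> K) mu u (Yproc \<rho> \<kappa> r B s z u \<omega>))
      = z powr (- gt) * (indicator {s..<T} u * (g u * exp (VP.Y s 0 u \<omega>)))"
    proof (cases "u \<in> {s..<T}")
      case True
      then have u: "0 \<le> u" "u \<le> T" "max 0 (min u T) = u" "max 0 (min s T) = s" using s by auto
      define e where "e = (\<rho> - \<kappa>\<^sup>2 / 2 - r) * (u - s) - \<kappa> * (B u \<omega> - B s \<omega>)"
      have "Vhat (U2 \<gamma> K) mu u (Yproc \<rho> \<kappa> r B s z u \<omega>) = k2 u * (z * exp e) powr (- gt)"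
        unfolding Yproc_exp e_def using z by (intro Vhat2_eq u) auto
      also have "\<dots> = z powr (- gt) * (k2 u * exp (- gt * e))" using z by (simp add: powr_mult) (simp add: powr_def)
      finally have 1: "Vhat (U2 \<gamma> K) mu u (Yproc \<rho> \<kappa> r B s z u \<omega>) = z powr (- gt) * (k2 u * exp (- gt * e))" .
      have 2: "exp (- \<rho> * (u - s)) * exp (- gt * e) = exp (c3 * (u - s)) * exp (VP.Y s 0 u \<omega>)"
        unfolding exp_add[symmetric] VP.Y_def u c3_def e_def by (simp add: field_simps)
      have "exp (- \<rho> * (u - s)) * (z powr (- gt) * (k2 u * exp (- gt * e))) = z powr (- gt) * (k2 u * (exp (- \<rho> * (u - s)) * exp (- gt * e)))"
        by (simp only: mult.left_commute)
      then show ?thesis using True unfolding 1 2 g_def u by (simp add: mult.assoc)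
    qed simp
  qed
  have "Vtilde M B \<gamma> K \<alpha> \<beta> r T \<rho> \<kappa> s z = z powr (- gt) * (\<integral>\<omega>. (\<integral>u. indicator {s..<T} u * (g u * exp (VP.Y s 0 u \<omega>)) \<partial>lborel) \<partial>M)"
    unfolding Vtilde_def path by simp
  also have "(\<integral>\<omega>. (\<integral>u. indicator {s..<T} u * (g u * exp (VP.Y s 0 u \<omega>)) \<partial>lborel) \<partial>M) = VP.tail g s"
    unfolding val[symmetric] using VP.NL.integral_fst'[OF int] by simp
  finally show ?thesis by (simp add: VP.tail_def g_def)
qed

end

text \<open>f is bounded above. Without such a bound the real supremum in \<open>wtilde\<close>
  could not be compared with its members.\<close>

lemma (in stopping_problem) J_bounded:
  assumes "0 \<le> t"
  obtains C where "\<And>\<tau>. stops t \<tau> \<Longrightarrow> J t y \<tau> \<le> C"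
proof (rule that)
  fix \<tau> assume "stops t \<tau>"
  then have stop: "stopping_time F \<tau>" and \<tau>b: "\<And>\<omega>. \<omega> \<in> space N \<Longrightarrow> t \<le> \<tau> \<omega> \<and> \<tau> \<omega> \<le> T1"
    by (auto simp: stops_def)
  have \<tau>m: "\<tau> \<in> borel_measurable N" by (rule stopping_time_meas[OF stop])
  have bm: "(\<lambda>x. indicator ({t..<\<tau> (fst x)} \<inter> {t..<T1}) (snd x) :: real) \<in> borel_measurable (N \<Otimes>\<^sub>M borel)"
    unfolding indicator_inter_arith by (intro borel_measurable_times stop_indicator_meas[OF \<tau>m]) measurable
  have "J t y \<tau> = (\<integral>x. indicator ({t..<\<tau> (fst x)} \<inter> {t..<T1}) (snd x) * fY t y x \<partial>PM)"
    unfolding J_def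
    by (intro Bochner_Integration.integral_cong refl) (auto simp: space_NL split: split_indicator dest!: \<tau>b)
  also have "\<dots> \<le> (\<integral>x. indicator {t..<T1} (snd x) * cmax \<partial>PM)"
  proof (rule integral_mono[OF fY_int[OF assms bm] prod_const_int])
    show "\<bar>indicator ({t..<\<tau> (fst x)} \<inter> {t..<T1}) (snd x)\<bar> \<le> (indicator {t..<T1} (snd x) :: real)" for x :: "'a \<times> real"
      by (auto split: split_indicator)
    show "indicator ({t..<\<tau> (fst x)} \<inter> {t..<T1}) (snd x) * fY t y x \<le> indicator {t..<T1} (snd x) * cmax" for x :: "'a \<times> real"
      using assms cmax_pos f_le[of "snd x"] by (auto simp: fY_def split: split_indicator)
  qed
  finally show "J t y \<tau> \<le> (\<integral>x. indicator {t..<T1} (snd x) * cmax \<partial>PM)" .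
qed

text \<open>L and \<open>amax\<close> are only known to exist, so they enter as parameters of a
  further locale.\<close>

locale reduced_market = power_market +
  fixes L amax :: real
  assumes sp: "stopping_problem N F WN T1 L amax a"
begin

sublocale SP: stopping_problem N F WN T1 vol th L amax a
  by (rule sp)

abbreviation Zp :: "real \<Rightarrow> real \<Rightarrow> real \<Rightarrow> 'a \<Rightarrow> real" where
  "Zp t z u \<omega> \<equiv> Zproc \<gamma> \<rho> \<kappa> r \<mu>w \<sigma>w B t z u \<omega>"

definition lev :: "real \<Rightarrow> real \<Rightarrow> real" where
  "lev t z = - gt * ln z - mm * t"

lemma Z_eq:
  assumes "0 \<le> t" "t \<le> u" "u \<le> T1" "0 < z"
  shows "Zp t z u \<omega> = exp (- (SP.Y t (lev t z) u \<omega> + mm * u) / gt)"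
proof -
  define a1 where "a1 = (\<rho> - \<kappa>\<^sup>2 / 2 - r) * (u - t) - \<kappa> * (B u \<omega> - B t \<omega>)"
  define a2 where "a2 = (\<mu>w - \<sigma>w\<^sup>2 / 2) * (u - t) + \<sigma>w * (B u \<omega> - B t \<omega>)"
  have cl: "max 0 (min u T1) = u" "max 0 (min t T1) = t" using assms by auto
  have "Zp t z u \<omega> = exp (ln z) * exp (1 / (1 - \<gamma>) * a1) * exp (\<gamma> / (1 - \<gamma>) * a2)"
    unfolding Zproc_def Yproc_exp Wproc_def a1_def a2_def powr_def using assms by simp
  also have "\<dots> = exp (ln z + 1 / (1 - \<gamma>) * a1 + \<gamma> / (1 - \<gamma>) * a2)" by (simp add: exp_add)
  also have "ln z + 1 / (1 - \<gamma>) * a1 + \<gamma> / (1 - \<gamma>) * a2 = - (- gt * ln z - a1 / \<gamma> - a2) / gt"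
  proof -
    have e: "1 / (1 - \<gamma>) = 1 / \<gamma> / gt" "\<gamma> / (1 - \<gamma>) = 1 / gt" using gamma by (simp_all add: gtilde_def)
    have "ln z + 1 / \<gamma> / d * a1 + 1 / d * a2 = - (- d * ln z - a1 / \<gamma> - a2) / d" if "d \<noteq> 0" for d
      using that by (simp add: add_divide_distrib diff_divide_distrib)
    from this[OF gt_nonzero] show ?thesis unfolding e .
  qed
  also have "- gt * ln z - a1 / \<gamma> - a2 = SP.Y t (lev t z) u \<omega> + mm * u"
  proof -
    define i where "i = 1 / \<gamma>"
    have di: "x / \<gamma> = x * i" for x by (simp add: i_def)
    show ?thesis
      unfolding SP.Y_def unfolding WN_def cl lev_def a1_def a2_def mm_def vol_def dr_def di
      by (simp add: power2_eq_square field_simps)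
  qed
  finally show ?thesis .
qed

lemma Z_powr:
  assumes "0 \<le> t" "t \<le> u" "u \<le> T1" "0 < z"
  shows "0 < Zp t z u \<omega>" "Zp t z u \<omega> powr (- gt) = exp (SP.Y t (lev t z) u \<omega>) * exp (mm * u)"
    "lev u (Zp t z u \<omega>) = SP.Y t (lev t z) u \<omega>"
  using gt_nonzero unfolding Z_eq[OF assms] lev_def by (auto simp: powr_def exp_add[symmetric])

lemma a_eq: "0 \<le> u \<Longrightarrow> u \<le> T1 \<Longrightarrow> a u = A0 u"
  by (simp add: a_def)

lemma reward_eq:
  assumes "0 \<le> t" "t \<le> u" "u \<le> T1" "0 < z"
  shows "exp (th * u) * (1 + Delta \<gamma> K u * (mu u * Zp t z u \<omega>) powr (- gt)) = SP.f u (SP.Y t (lev t z) u \<omega>)"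
  using mu_pos[of u] T1 Z_powr[OF assms, of \<omega>] assms
  unfolding SP.f_def by (simp add: a_eq A0_def powr_mult)

definition g :: "real \<Rightarrow> real" where "g u = k2 (max 0 (min u T)) * exp (c3 * u)"

text \<open>\<open>tail\<close> covers the times up to \<open>T1\<close>; this is the remaining
  contribution of \<open>[T1, T)\<close> to the terminal value.\<close>

definition V1 :: real where "V1 = (\<integral>u. indicator {T1..<T} u * g u \<partial>lborel)"

lemma g_cont: "continuous_on UNIV g"
  unfolding g_def by (intro continuous_intros k2_cont)

lemma Vtilde_tail:
  assumes "0 \<le> s" "s \<le> T1" "0 < z"
  shows "exp (th * s) * Vtilde M B \<gamma> K \<alpha> \<beta> r T \<rho> \<kappa> s z = exp (lev s z) * (V1 + SP.tail g s)"
proof -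
  have sT: "s \<le> T" using assms T1 by simp
  have "V1 + SP.tail g s = (\<integral>u. indicator {s..<T} u * g u \<partial>lborel)"
    unfolding V1_def SP.tail_def
    by (subst Bochner_Integration.integral_add[symmetric])
      (use assms T1 in \<open>auto intro!: SP.cont_interval_int g_cont Bochner_Integration.integral_cong split: split_indicator\<close>)
  moreover have "(\<integral>u. indicator {s..<T} u * (k2 (max 0 (min u T)) * exp (c3 * (u - s))) \<partial>lborel)
    = exp (- c3 * s) * (\<integral>u. indicator {s..<T} u * g u \<partial>lborel)"
    unfolding Bochner_Integration.integral_mult_right_zero[symmetric]
    by (intro Bochner_Integration.integral_cong refl) (simp add: g_def exp_add[symmetric] algebra_simps exp_diff exp_minus divide_inverse)
  moreover have "exp (th * s) * z powr (- gt) * exp (- c3 * s) = exp (lev s z)"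
    using assms(3) by (simp add: powr_def exp_add[symmetric] lev_def c3_eq algebra_simps)
  ultimately show ?thesis unfolding Vtilde_eq[OF assms(1) sT assms(3)] by (simp add: mult.assoc[symmetric])
qed

text \<open>Postponing the payment of \<open>qfun\<close> from t to s saves a discount integral,
  whose integrand supplies the 1 in f.\<close>

lemma qfun_eq:
  assumes "t \<le> s"
  shows "exp (th * (s - t)) * qfun th T1 s = qfun th T1 t - exp (- th * t) * (\<integral>u. indicator {t..<s} u * exp (th * u) \<partial>lborel)"
  unfolding integral_exp_Ico[OF theta_nonzero assms] qfun_def using theta_nonzero
  by (simp add: field_simps exp_add[symmetric])

text \<open>g is the coefficient of the second phase, and that of the first phase is smaller by
  \<open>exp (th * u) * a u\<close>. This difference together with the saving in \<open>qfun\<close>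
  forms f, while optional stopping makes the rest independent of \<tau>.\<close>

lemma stopping_value:
  assumes t: "0 \<le> t" and st: "SP.stops t \<tau>" and z: "0 < z"
  shows "Etilde M \<sigma>w \<kappa> B T1 (\<lambda>\<omega>.
           (LBINT u=t..\<tau> \<omega>. exp (th * (u - t)) * Vhat (U1 \<gamma>) mu u (Zp t z u \<omega>))
           + exp (th * (\<tau> \<omega> - t)) * (Vtilde M B \<gamma> K \<alpha> \<beta> r T \<rho> \<kappa> (\<tau> \<omega>) (Zp t z (\<tau> \<omega>) \<omega>) - qfun th T1 (\<tau> \<omega>)))
     = Vtilde M B \<gamma> K \<alpha> \<beta> r T \<rho> \<kappa> t z - qfun th T1 t + exp (- th * t) * SP.J t (lev t z) \<tau>"
proof -
  define y where "y = lev t z"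
  have \<tau>b: "t \<le> \<tau> \<omega>" "\<tau> \<omega> \<le> T1" if "\<omega> \<in> space M" for \<omega>
    using st that by (auto simp: SP.stops_def)
  have tT: "t \<le> T1" by (rule SP.stops_le[OF st])
  define G where "G \<omega> = (\<integral>u. indicator {t..<\<tau> \<omega>} u * (g u * exp (SP.Y t y u \<omega>) + SP.f u (SP.Y t y u \<omega>)) \<partial>lborel)
      + exp (SP.Y t y (\<tau> \<omega>) \<omega>) * (V1 + SP.tail g (\<tau> \<omega>))" for \<omega>
  have "has_bochner_integral N G (SP.J t y \<tau> + exp y * (V1 + SP.tail g t))"
    unfolding G_def by (rule SP.stopped_reward[OF t st g_cont])
  from has_bochner_integral_mult_right[OF this, of "exp (- th * t)"]
  have "has_bochner_integral N (\<lambda>\<omega>. exp (- th * t) * G \<omega>) (exp (- th * t) * (SP.J t y \<tau> + exp y * (V1 + SP.tail g t)))" .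
  moreover have "has_bochner_integral N (\<lambda>\<omega>. qfun th T1 t) (qfun th T1 t)"
    using SP.prob_space by (simp add: has_bochner_integral_iff)
  ultimately have hb: "has_bochner_integral N (\<lambda>\<omega>. exp (- th * t) * G \<omega> - qfun th T1 t)
      (exp (- th * t) * (SP.J t y \<tau> + exp y * (V1 + SP.tail g t)) - qfun th T1 t)"
    by (rule has_bochner_integral_diff)
  have ett: "exp (- th * t) * exp (th * t) = 1" by (simp add: exp_add[symmetric])
  have vt: "exp (- th * t) * (exp y * (V1 + SP.tail g t)) = Vtilde M B \<gamma> K \<alpha> \<beta> r T \<rho> \<kappa> t z"
    unfolding y_def Vtilde_tail[OF t tT z, symmetric] mult.assoc[symmetric] ett by simp
  have "Etilde M \<sigma>w \<kappa> B T1 (\<lambda>\<omega>.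
           (LBINT u=t..\<tau> \<omega>. exp (th * (u - t)) * Vhat (U1 \<gamma>) mu u (Zp t z u \<omega>))
           + exp (th * (\<tau> \<omega> - t)) * (Vtilde M B \<gamma> K \<alpha> \<beta> r T \<rho> \<kappa> (\<tau> \<omega>) (Zp t z (\<tau> \<omega>) \<omega>) - qfun th T1 (\<tau> \<omega>)))
     = exp (- th * t) * (SP.J t y \<tau> + exp y * (V1 + SP.tail g t)) - qfun th T1 t"
  proof (rule Etilde_eq[OF hb])
    fix \<omega> assume w: "\<omega> \<in> space M"
    define s where "s = \<tau> \<omega>"
    have s: "t \<le> s" "s \<le> T1" "0 \<le> s" using \<tau>b[OF w] t by (auto simp: s_def)
    define g1 where "g1 u = g u - exp (th * u) * a u" for u
    have Yc: "continuous_on UNIV (\<lambda>u. SP.Y t y u \<omega>)" using SP.Y_cont[of \<omega>] w by simp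
    have g1c: "continuous_on UNIV (\<lambda>u. g1 u * exp (SP.Y t y u \<omega>))"
      unfolding g1_def by (intro continuous_intros g_cont SP.a_cont Yc)
    have 1: "(LBINT u=t..s. exp (th * (u - t)) * Vhat (U1 \<gamma>) mu u (Zp t z u \<omega>))
      = exp (- th * t) * (\<integral>u. indicator {t..<s} u * (g1 u * exp (SP.Y t y u \<omega>)) \<partial>lborel)"
      unfolding LBINT_Ico[OF s(1)] Bochner_Integration.integral_mult_right_zero[symmetric]
    proof (intro Bochner_Integration.integral_cong refl)
      fix u
      show "indicator {t..<s} u * (exp (th * (u - t)) * Vhat (U1 \<gamma>) mu u (Zp t z u \<omega>))
        = exp (- th * t) * (indicator {t..<s} u * (g1 u * exp (SP.Y t y u \<omega>)))"
      proof (cases "u \<in> {t..<s}")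
        case True
        then have u: "t \<le> u" "u \<le> T1" "0 \<le> u" "u \<le> T" "max 0 (min u T) = u" using s t T1 by auto
        note Zu = Z_powr[OF t u(1,2) z, of \<omega>]
        have "Vhat (U1 \<gamma>) mu u (Zp t z u \<omega>) = mu u powr (- gt) / gt * (exp (SP.Y t y u \<omega>) * exp (mm * u))"
          unfolding Vhat1_eq[OF u(4) Zu(1)] y_def using Zu mu_pos[OF u(4)] by (simp add: powr_mult)
        moreover have "g1 u = mu u powr (- gt) / gt * exp (th * u) * exp (mm * u)"
          unfolding g1_def g_def k2_def a_eq[OF u(3,2)] A0_def Delta_def u(5) c3_eq using gt_nonzero
          by (simp add: exp_add algebra_simps diff_divide_distrib)
        moreover have "exp (th * (u - t)) = exp (- th * t) * exp (th * u)" by (simp add: exp_add[symmetric] algebra_simps)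
        ultimately show ?thesis using True by simp
      qed simp
    qed
    have 2: "exp (th * (s - t)) * Vtilde M B \<gamma> K \<alpha> \<beta> r T \<rho> \<kappa> s (Zp t z s \<omega>) = exp (- th * t) * (exp (SP.Y t y s \<omega>) * (V1 + SP.tail g s))"
    proof -
      note Zs = Z_powr[OF t s(1,2) z, of \<omega>]
      have "exp (th * (s - t)) = exp (- th * t) * exp (th * s)" by (simp add: exp_add[symmetric] algebra_simps)
      then show ?thesis using Vtilde_tail[OF s(3,2) Zs(1)] unfolding Zs(3) y_def by simp
    qed
    have "(\<integral>u. indicator {t..<s} u * (g u * exp (SP.Y t y u \<omega>) + SP.f u (SP.Y t y u \<omega>)) \<partial>lborel)
      = (\<integral>u. indicator {t..<s} u * (g1 u * exp (SP.Y t y u \<omega>)) + indicator {t..<s} u * exp (th * u) \<partial>lborel)"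
      by (intro Bochner_Integration.integral_cong refl) (simp add: g1_def SP.f_def algebra_simps)
    also have "\<dots> = (\<integral>u. indicator {t..<s} u * (g1 u * exp (SP.Y t y u \<omega>)) \<partial>lborel) + (\<integral>u. indicator {t..<s} u * exp (th * u) \<partial>lborel)"
      by (intro Bochner_Integration.integral_add SP.cont_interval_int g1c SP.exp_theta_cont)
    finally have 3: "(\<integral>u. indicator {t..<s} u * (g u * exp (SP.Y t y u \<omega>) + SP.f u (SP.Y t y u \<omega>)) \<partial>lborel)
      = (\<integral>u. indicator {t..<s} u * (g1 u * exp (SP.Y t y u \<omega>)) \<partial>lborel) + (\<integral>u. indicator {t..<s} u * exp (th * u) \<partial>lborel)" .
    show "(LBINT u=t..\<tau> \<omega>. exp (th * (u - t)) * Vhat (U1 \<gamma>) mu u (Zp t z u \<omega>))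
           + exp (th * (\<tau> \<omega> - t)) * (Vtilde M B \<gamma> K \<alpha> \<beta> r T \<rho> \<kappa> (\<tau> \<omega>) (Zp t z (\<tau> \<omega>) \<omega>) - qfun th T1 (\<tau> \<omega>))
       = exp (- th * t) * G \<omega> - qfun th T1 t"
    proof -
      define X1 where "X1 = (\<integral>u. indicator {t..<s} u * (g1 u * exp (SP.Y t y u \<omega>)) \<partial>lborel)"
      define X2 where "X2 = (\<integral>u. indicator {t..<s} u * exp (th * u) \<partial>lborel)"
      define X3 where "X3 = exp (SP.Y t y s \<omega>) * (V1 + SP.tail g s)"
      have G: "G \<omega> = X1 + X2 + X3" unfolding G_def s_def[symmetric] 3 X1_def X2_def X3_def ..
      show ?thesis
        unfolding s_def[symmetric] 1 G right_diff_distrib[of "exp (th * (s - t))"] 2 qfun_eq[OF s(1)]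
          X1_def[symmetric] X2_def[symmetric] X3_def[symmetric] by (simp add: distrib_left)
    qed
  qed
  then show ?thesis using vt unfolding distrib_left y_def by simp
qed

lemma contregion_iff:
  assumes t: "0 \<le> t" "t < T1" and z: "0 < z"
  shows "(t, z) \<in> contregion M F B \<gamma> K \<alpha> \<beta> r T T1 \<rho> \<kappa> \<mu>w \<sigma>w \<longleftrightarrow> SP.Cont t (lev t z)"
proof -
  define S where "S = {\<tau>. stopping_time F \<tau> \<and> (\<forall>\<omega>\<in>space M. t \<le> \<tau> \<omega> \<and> \<tau> \<omega> \<le> T1)}"
  have S: "S = {\<tau>. SP.stops t \<tau>}" by (simp add: S_def SP.stops_def)
  define V where "V = Vtilde M B \<gamma> K \<alpha> \<beta> r T \<rho> \<kappa> t z - qfun th T1 t"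
  have w: "wtilde M F B \<gamma> K \<alpha> \<beta> r T T1 \<rho> \<kappa> \<mu>w \<sigma>w t z = (SUP \<tau>\<in>S. V + exp (- th * t) * SP.J t (lev t z) \<tau>)"
    unfolding wtilde_def Let_def S_def[symmetric] V_def
    by (intro SUP_cong refl stopping_value[OF t(1) _ z]) (simp add: S)
  have ne: "S \<noteq> {}" using t by (auto simp: S_def intro!: exI[of _ "\<lambda>_. t"] stopping_time_const)
  obtain C where C: "\<And>\<tau>. SP.stops t \<tau> \<Longrightarrow> SP.J t (lev t z) \<tau> \<le> C" using SP.J_bounded[OF t(1)] by blast
  have bdd: "bdd_above ((\<lambda>\<tau>. V + exp (- th * t) * SP.J t (lev t z) \<tau>) ` S)"
    by (rule bdd_aboveI2[where M = "V + exp (- th * t) * C"]) (use C in \<open>auto simp: S\<close>)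
  have "V < (SUP \<tau>\<in>S. V + exp (- th * t) * SP.J t (lev t z) \<tau>) \<longleftrightarrow> (\<exists>\<tau>\<in>S. V < V + exp (- th * t) * SP.J t (lev t z) \<tau>)"
    by (rule less_cSUP_iff[OF ne bdd])
  also have "\<dots> \<longleftrightarrow> SP.Cont t (lev t z)"
    unfolding SP.Cont_def S by (auto simp: zero_less_mult_iff)
  finally show ?thesis
    using t z by (simp add: contregion_def w V_def)
qed

end

section \<open>The identity and the limit in the original variables\<close>

theorem mainTheorem9:
  fixes M :: "'a measure" and F :: "real \<Rightarrow> 'a measure" and B :: "real \<Rightarrow> 'a \<Rightarrow> real"
    and T1 T r \<mu> \<sigma> \<rho> \<mu>w \<sigma>w \<alpha> \<beta> \<gamma> \<delta> Mb :: real
    and K :: "real \<Rightarrow> real" and zstar :: "real \<Rightarrow> real"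
  assumes "prob_space M"
    and "usual_filtration M F"
    and "brownian_motion M F B"
    and "0 < T1" "T1 < T"
    and "0 < r" "0 < \<mu>" "0 < \<sigma>" "0 < \<rho>" "0 < \<mu>w" "0 < \<sigma>w" "0 < \<alpha>" "0 < \<beta>"
    and "theta r \<mu>w (kappa \<mu> r \<sigma>) \<sigma>w < 0"
    and "0 < \<gamma>" "\<gamma> \<noteq> 1"
    and "smooth_on {0..T} K" "\<forall>t\<in>{0..T}. 0 < K t"
    and "0 < \<delta>" "\<delta> \<le> Mb"
    and "\<forall>t\<in>{0..T1}. - Mb \<le> Delta \<gamma> K t \<and> Delta \<gamma> K t \<le> - \<delta>"
    and "\<forall>t\<in>{0..<T1}. 0 < zstar t"
    and "\<forall>t\<in>{0..<T1}. \<forall>z>0.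
           (t, z) \<in> contregion M F B \<gamma> K \<alpha> \<beta> r T T1 \<rho> (kappa \<mu> r \<sigma>) \<mu>w \<sigma>w \<longleftrightarrow>
           (if \<gamma> < 1 then z > zstar t else z < zstar t)"
  shows "(\<forall>t\<in>{0..<T1}.
            Etilde M \<sigma>w (kappa \<mu> r \<sigma>) B T1 (\<lambda>\<omega>.
              LBINT u=t..T1.
                exp (theta r \<mu>w (kappa \<mu> r \<sigma>) \<sigma>w * (u - t)) *
                (1 + Delta \<gamma> K u *
                   (muT \<alpha> \<beta> r T u * Zproc \<gamma> \<rho> (kappa \<mu> r \<sigma>) r \<mu>w \<sigma>w B t (zstar t) u \<omega>)
                     powr (- gtilde \<gamma>)) *
                (if \<gamma> > 1
                 then of_bool (Zproc \<gamma> \<rho> (kappa \<mu> r \<sigma>) r \<mu>w \<sigma>w B t (zstar t) u \<omega> < zstar u)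
                 else of_bool (Zproc \<gamma> \<rho> (kappa \<mu> r \<sigma>) r \<mu>w \<sigma>w B t (zstar t) u \<omega> > zstar u)))
            = 0)
         \<and> (zstar \<longlongrightarrow> (- Delta \<gamma> K T1) powr (1 / gtilde \<gamma>) / muT \<alpha> \<beta> r T T1) (at_left T1)"
proof -
  define \<kappa> where "\<kappa> = kappa \<mu> r \<sigma>"
  note A = assms[folded \<kappa>_def]
  have Dneg: "Delta \<gamma> K t < 0" if "t \<in> {0..T1}" for t
    using bspec[OF A(21) that] A(19) by linarith
  have thn: "theta r \<mu>w \<kappa> \<sigma>w \<noteq> 0" using A(14) by simp
  interpret power_market M F B T1 T r \<kappa> \<rho> \<mu>w \<sigma>w \<alpha> \<beta> \<gamma> K
    by (rule power_market.intro[OF A(1-5) A(12) A(15-17) bspec[OF A(18)] Dneg thn])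
  obtain L amax where "stopping_problem N F WN T1 L amax a" using stopping_problem_exists by blast
  then interpret reduced_market M F B T1 T r \<kappa> \<rho> \<mu>w \<sigma>w \<alpha> \<beta> \<gamma> K L amax
    by (intro reduced_market.intro power_market_axioms reduced_market_axioms.intro)
  define ys where "ys s = lev s (zstar s)" for s
  have zpos: "0 < zstar s" if "0 \<le> s" "s < T1" for s using A(22) that by auto
  have gt_sign: "0 < gt \<longleftrightarrow> \<gamma> < 1" "gt < 0 \<longleftrightarrow> 1 < \<gamma>"
    using gamma by (auto simp: gtilde_def zero_less_divide_iff divide_less_0_iff)
  have lev_less: "lev s z < lev s z' \<longleftrightarrow> (if \<gamma> < 1 then z' < z else z < z')" if "0 < z" "0 < z'" for s z z'
  proof (cases "\<gamma> < 1")
    case True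
    then show ?thesis using that gt_sign by (simp add: lev_def)
  next
    case False
    then have "gt < 0" using gt_sign gamma by auto
    then show ?thesis using that False by (simp add: lev_def)
  qed
  interpret BD: stopping_boundary N F WN T1 vol th L amax a ys
  proof
    fix s y assume s: "0 \<le> s" "s < T1"
    \<comment> \<open>The inverse of \<open>lev\<close> at time s: every real level comes from a
      positive z, so the hypothesis on z decides all y.\<close>
    define z where "z = exp (- (y + mm * s) / gt)"
    have z: "0 < z" "lev s z = y" using gt_nonzero by (auto simp: z_def lev_def)
    have "SP.Cont s y \<longleftrightarrow> (s, z) \<in> contregion M F B \<gamma> K \<alpha> \<beta> r T T1 \<rho> \<kappa> \<mu>w \<sigma>w"
      using contregion_iff[OF s z(1)] z(2) by simp
    also have "\<dots> \<longleftrightarrow> (if \<gamma> < 1 then z > zstar s else z < zstar s)"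
      using A(23) s z(1) by auto
    also have "\<dots> \<longleftrightarrow> y < ys s"
      using lev_less[OF z(1) zpos[OF s], of s] z(2) by (simp add: ys_def)
    finally show "SP.Cont s y \<longleftrightarrow> y < ys s" .
  qed
  have identity: "Etilde M \<sigma>w \<kappa> B T1 (\<lambda>\<omega>. LBINT u=t..T1. exp (th * (u - t)) *
                (1 + Delta \<gamma> K u * (mu u * Zp t (zstar t) u \<omega>) powr (- gt)) *
                (if \<gamma> > 1 then of_bool (Zp t (zstar t) u \<omega> < zstar u)
                 else of_bool (Zp t (zstar t) u \<omega> > zstar u))) = 0"
    if t: "0 \<le> t" "t < T1" for t
  proof -
    define H where "H x = indicator {t<..<T1} (snd x) * (of_bool (SP.Y t (ys t) (snd x) (fst x) < ys (snd x)) * SP.fY t (ys t) x)" for x :: "'a \<times> real"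
    \<comment> \<open>\<open>ysm\<close> replaces \<open>ys\<close> for joint measurability; the two
      agree on the open interval.\<close>
    define b where "b x = indicator {t<..<T1} (snd x) * (of_bool (SP.Y t (ys t) (snd x) (fst x) < BD.ysm (snd x)) :: real)" for x :: "'a \<times> real"
    have bm: "b \<in> borel_measurable (N \<Otimes>\<^sub>M borel)" unfolding b_def of_bool_def by measurable
    have Hb: "H = (\<lambda>x. b x * SP.fY t (ys t) x)"
      using t by (auto simp: H_def b_def BD.ysm_eq fun_eq_iff split: split_indicator)
    have Hi: "integrable SP.PM H"
      unfolding Hb by (rule SP.fY_int[OF t(1) bm]) (auto simp: b_def split: split_indicator)
    have "has_bochner_integral N (\<lambda>\<omega>. \<integral>u. H (\<omega>, u) \<partial>lborel) 0"
      using SP.NL.integrable_fst'[OF Hi] SP.NL.integral_fst'[OF Hi] BD.boundary_integral_equation[OF t]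
      unfolding H_def by (simp add: has_bochner_integral_iff)
    from has_bochner_integral_mult_right[OF this, of "exp (- th * t)"]
    have hb: "has_bochner_integral N (\<lambda>\<omega>. exp (- th * t) * (\<integral>u. H (\<omega>, u) \<partial>lborel)) 0" by simp
    show ?thesis
    proof (rule Etilde_eq[OF hb])
      fix \<omega> assume "\<omega> \<in> space M"
      have "(LBINT u=t..T1. exp (th * (u - t)) *
                (1 + Delta \<gamma> K u * (mu u * Zp t (zstar t) u \<omega>) powr (- gt)) *
                (if \<gamma> > 1 then of_bool (Zp t (zstar t) u \<omega> < zstar u) else of_bool (Zp t (zstar t) u \<omega> > zstar u)))
         = (\<integral>u. exp (- th * t) * H (\<omega>, u) \<partial>lborel)"
        \<comment> \<open>The open form is taken because \<open>zstar\<close> is constrained only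
          before \<open>T1\<close>.\<close>
        unfolding LBINT_Ioo[OF less_imp_le[OF t(2)]]
      proof (intro Bochner_Integration.integral_cong refl)
        fix u
        show "indicator {t<..<T1} u * (exp (th * (u - t)) *
                (1 + Delta \<gamma> K u * (mu u * Zp t (zstar t) u \<omega>) powr (- gt)) *
                (if \<gamma> > 1 then of_bool (Zp t (zstar t) u \<omega> < zstar u) else of_bool (Zp t (zstar t) u \<omega> > zstar u)))
          = exp (- th * t) * H (\<omega>, u)"
        proof (cases "u \<in> {t<..<T1}")
          case True
          then have u: "t \<le> u" "u \<le> T1" "0 \<le> u" "u < T1" using t by auto
          note Zu = Z_powr[OF t(1) u(1,2) zpos[OF t], of \<omega>]
          have "SP.Y t (ys t) u \<omega> < ys u \<longleftrightarrow> (if \<gamma> > 1 then Zp t (zstar t) u \<omega> < zstar u else Zp t (zstar t) u \<omega> > zstar u)"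
            using lev_less[OF Zu(1) zpos[OF u(3,4)], of u] gamma unfolding ys_def Zu(3) by auto
          moreover have "exp (th * (u - t)) = exp (- th * t) * exp (th * u)" by (simp add: exp_add[symmetric] algebra_simps)
          ultimately show ?thesis
            using True reward_eq[OF t(1) u(1,2) zpos[OF t], of \<omega>, folded ys_def] by (auto simp: H_def SP.fY_def)
        qed (simp add: H_def)
      qed
      then show "(LBINT u=t..T1. exp (th * (u - t)) *
                (1 + Delta \<gamma> K u * (mu u * Zp t (zstar t) u \<omega>) powr (- gt)) *
                (if \<gamma> > 1 then of_bool (Zp t (zstar t) u \<omega> < zstar u) else of_bool (Zp t (zstar t) u \<omega> > zstar u)))
         = exp (- th * t) * (\<integral>u. H (\<omega>, u) \<partial>lborel)" by simp
    qed
  qed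
  have lim: "(zstar \<longlongrightarrow> (- Delta \<gamma> K T1) powr (1 / gt) / mu T1) (at_left T1)"
  proof -
    have aT: "0 < - Delta \<gamma> K T1" "0 < mu T1" using Delta_neg[of T1] mu_pos[of T1] T1 by auto
    have "((\<lambda>s. exp (- (ys s + mm * s) / gt)) \<longlongrightarrow> exp (- (- ln (a T1) + mm * T1) / gt)) (at_left T1)"
      using gt_nonzero by (intro tendsto_intros BD.ys_lim) auto
    moreover have "exp (- (- ln (a T1) + mm * T1) / gt) = (- Delta \<gamma> K T1) powr (1 / gt) / mu T1"
    proof -
      have "ln (a T1) = ln (- Delta \<gamma> K T1) - gt * ln (mu T1) + mm * T1"
      proof -
        define D where "D = - Delta \<gamma> K T1"
        have "0 < D" using aT by (simp add: D_def)
        then have "ln (D * mu T1 powr (- gt) * exp (mm * T1)) = ln D - gt * ln (mu T1) + mm * T1"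
          using aT by (simp add: ln_mult ln_powr)
        then show ?thesis using T1 by (simp add: a_eq A0_def D_def)
      qed
      then have "- (- ln (a T1) + mm * T1) / gt = (1 / gt) * ln (- Delta \<gamma> K T1) - ln (mu T1)"
        using gt_nonzero by (simp add: field_simps)
      then show ?thesis using aT by (simp add: exp_diff powr_def)
    qed
    moreover have "\<forall>\<^sub>F s in at_left T1. exp (- (ys s + mm * s) / gt) = zstar s"
      using eventually_at_left_real[OF T1(1)]
    proof eventually_elim
      case (elim s)
      then have "0 < zstar s" by (intro zpos) auto
      then show ?case using gt_nonzero by (simp add: ys_def lev_def)
    qed
    ultimately show ?thesis using Lim_transform_eventually by simp
  qed
  show ?thesis unfolding \<kappa>_def[symmetric]
    by (intro conjI ballI lim, rule identity) simp_all
qed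

end
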